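(* Fix a prime power $q$. Consider any sequence of integers $2\le k\le r$ and $m\ge1$ (all allowed to vary along the sequence) such that $c:=\frac mr\binom rk$ is an integer, put $N=r+c$, and suppose $c/r^2\to\infty$. Assume $r\to r_\ast\in\{2,3,\dots,\infty\}$. Then $X_{N,r}$ converges in distribution to $\mathrm{Poisson}(C_{q,r_\ast})$, and $$\mathbb P(\alpha_N=r)\to1-e^{-C_{q,r_\ast}},\qquad \mathbb P(\alpha_N=r-1)\to e^{-C_{q,r_\ast}}.$$
   Context: Let $V_N=\mathbb F_q^N$ and let $\Theta_N$ be uniformly random in $\mathrm{Hom}(\Lambda^kV_N,\mathbb F_q^m)$. A subspace $H\le V_N$ is null if $\Theta_N(\Lambda^kH)=0$. $X_{N,r}$ is the number of $r$-dimensional null subspaces and $\alpha_N$ is the maximum dimension of a null subspace. For $\ell\ge1$, $C_{q,\ell}=\prod_{j=1}^{\ell}(1-q^{-j})^{-1}$, and $C_{q,\infty}=\prod_{j\ge1}(1-q^{-j})^{-1}$. The condition $c=\frac mr\binom rk$ with $N=r+c$ (that is, $m\binom rk=r(N-r)$) is called resonance. *)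

theory Defs
  imports
    "HOL-Probability.Probability"
    "HOL-Library.Function_Algebras"
    "Jordan_Normal_Form.Determinant"
begin

section \<open>Coordinate vector spaces\<close>

text \<open>
  Vectors are functions from an index type into the field, with the pointwise operations;
  \<open>coord_space I\<close> is the space \<open>F\<^sup>I\<close>, realised as the functions vanishing outside \<open>I\<close>. This makes
  the dimension an ordinary natural number, which may vary along a sequence.
\<close>

definition fscale :: "'a::field \<Rightarrow> ('i \<Rightarrow> 'a) \<Rightarrow> 'i \<Rightarrow> 'a" where
  "fscale c v = (\<lambda>i. c * v i)"

interpretation fvs: vector_space "fscale :: 'a::field \<Rightarrow> ('i \<Rightarrow> 'a) \<Rightarrow> 'i \<Rightarrow> 'a"
  by unfold_locales (auto simp: fscale_def fun_eq_iff algebra_simps)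

definition coord_space :: "'i set \<Rightarrow> ('i \<Rightarrow> 'a::field) set" where
  "coord_space I = {v. \<forall>i. i \<notin> I \<longrightarrow> v i = 0}"

abbreviation std_space :: "nat \<Rightarrow> (nat \<Rightarrow> 'a::field) set" where
  "std_space n \<equiv> coord_space {..<n}"

section \<open>Exterior powers\<close>

text \<open>
  The exterior power \<open>\<Lambda>\<^sup>k\<close> in its standard basis: \<open>\<Lambda>\<^sup>k F\<^sup>N\<close> has the basis \<open>e\<^sub>S\<close>, where \<open>S\<close> ranges over
  the \<open>k\<close>-subsets of \<open>{..<N}\<close>, and the \<open>S\<close>-coordinate of \<open>v\<^sub>0 \<and> \<dots> \<and> v\<^bsub>k-1\<^esub>\<close> is the minor of the matrix
  with rows \<open>v\<^sub>i\<close> on the columns in \<open>S\<close>, taken in increasing order. For a subspace \<open>H\<close>, \<open>\<Lambda>\<^sup>k H\<close> is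
  identified with its (injective) image in the ambient exterior power, the span of the
  \<open>v\<^sub>0 \<and> \<dots> \<and> v\<^bsub>k-1\<^esub>\<close> with all \<open>v\<^sub>i\<close> in \<open>H\<close>.
\<close>

definition wedge :: "nat \<Rightarrow> (nat \<Rightarrow> nat \<Rightarrow> 'a::field) \<Rightarrow> nat set \<Rightarrow> 'a" where
  "wedge k v S =
     (if finite S \<and> card S = k
      then Determinant.det (mat k k (\<lambda>(i, j). v i (sorted_list_of_set S ! j)))
      else 0)"

definition ext_power :: "nat \<Rightarrow> (nat \<Rightarrow> 'a::field) set \<Rightarrow> (nat set \<Rightarrow> 'a) set" where
  "ext_power k H = fvs.span {wedge k v | v. \<forall>i<k. v i \<in> H}"

lemma wedge_unit_vectors:
  fixes T :: "nat set"
  assumes T: "finite T" "card T = k"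
  shows "wedge k (\<lambda>i j. if j = sorted_list_of_set T ! i then 1 else 0)
       = (\<lambda>S. if S = T then 1 else (0::'a::field))"
proof
  fix S :: "nat set"
  let ?M = "\<lambda>S. mat k k (\<lambda>(i, j). if sorted_list_of_set S ! j = sorted_list_of_set T ! i
                                   then 1 else (0::'a))"
  consider "\<not> (finite S \<and> card S = k)" | "finite S" "card S = k" "S = T"
    | "finite S" "card S = k" "S \<noteq> T" by blast
  then show "wedge k (\<lambda>i j. if j = sorted_list_of_set T ! i then 1 else 0) S
       = (if S = T then 1 else (0::'a))"
  proof cases
    case 1
    then show ?thesis using T by (auto simp: wedge_def)
  next
    case 2
    have "?M T = 1\<^sub>m k"
      using T by (intro eq_matI) (auto simp: nth_eq_iff_index_eq)
    then show ?thesis using 2 by (simp add: wedge_def)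
  next
    case 3
    then obtain a where a: "a \<in> S" "a \<notin> T"
      using T by (metis card_subset_eq subsetI)
    then obtain j where j: "j < k" "sorted_list_of_set S ! j = a"
      using 3 by (metis in_set_conv_nth sorted_list_of_set.length_sorted_key_list_of_set
          set_sorted_list_of_set)
    have ne: "sorted_list_of_set T ! i \<noteq> a" if "i < k" for i
      using that a T by (metis nth_mem set_sorted_list_of_set
          sorted_list_of_set.length_sorted_key_list_of_set)
    have "Determinant.det (?M S) =
        (\<Sum>p | p permutes {0..<k}. signof p * (\<Prod>i = 0..<k. ?M S $$ (i, p i)))"
      by (simp add: Determinant.det_def)
    also have "\<dots> = 0"
    proof (rule sum.neutral, safe)
      fix p assume p: "p permutes {0..<k}"
      then obtain i where i: "i \<in> {0..<k}" "p i = j"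
        using j(1) by (metis atLeastLessThan_iff permutes_image imageE zero_le)
      then have "?M S $$ (i, p i) = 0" using j ne[of i] by auto
      then have "(\<Prod>i = 0..<k. ?M S $$ (i, p i)) = 0"
        using i(1) by (intro prod_zero) auto
      then show "signof p * (\<Prod>i = 0..<k. ?M S $$ (i, p i)) = 0" by simp
    qed
    finally show ?thesis using 3 by (simp add: wedge_def)
  qed
qed

section \<open>Null subspaces\<close>

text \<open>
  \<open>Hom(\<Lambda>\<^sup>k F\<^sup>N, F\<^sup>m)\<close>. Homomorphisms are extensional functions on \<open>\<Lambda>\<^sup>k F\<^sup>N\<close>, so that over a finite field
  this is a finite set and carries a uniform distribution.
\<close>

definition Hom_ext :: "nat \<Rightarrow> nat \<Rightarrow> nat \<Rightarrow> ((nat set \<Rightarrow> 'a::field) \<Rightarrow> nat \<Rightarrow> 'a) set" where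
  "Hom_ext k N m = {\<Theta> \<in> ext_power k (std_space N) \<rightarrow>\<^sub>E std_space m.
     (\<forall>x \<in> ext_power k (std_space N). \<forall>y \<in> ext_power k (std_space N). \<Theta> (x + y) = \<Theta> x + \<Theta> y) \<and>
     (\<forall>c. \<forall>x \<in> ext_power k (std_space N). \<Theta> (fscale c x) = fscale c (\<Theta> x))}"

definition null_subspaces ::
    "nat \<Rightarrow> nat \<Rightarrow> ((nat set \<Rightarrow> 'a::field) \<Rightarrow> nat \<Rightarrow> 'a) \<Rightarrow> (nat \<Rightarrow> 'a) set set" where
  "null_subspaces k N \<Theta> =
     {H. fvs.subspace H \<and> H \<subseteq> std_space N \<and> (\<forall>x \<in> ext_power k H. \<Theta> x = 0)}"

definition null_count ::
    "nat \<Rightarrow> nat \<Rightarrow> nat \<Rightarrow> ((nat set \<Rightarrow> 'a::field) \<Rightarrow> nat \<Rightarrow> 'a) \<Rightarrow> nat" where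
  "null_count k N r \<Theta> = card {H \<in> null_subspaces k N \<Theta>. fvs.dim H = r}"

definition max_null_dim ::
    "nat \<Rightarrow> nat \<Rightarrow> ((nat set \<Rightarrow> 'a::field) \<Rightarrow> nat \<Rightarrow> 'a) \<Rightarrow> nat" where
  "max_null_dim k N \<Theta> = Max (fvs.dim ` null_subspaces k N \<Theta>)"

definition random_hom ::
    "nat \<Rightarrow> nat \<Rightarrow> nat \<Rightarrow> ((nat set \<Rightarrow> 'a::{field,finite}) \<Rightarrow> nat \<Rightarrow> 'a) pmf" where
  "random_hom k N m = pmf_of_set (Hom_ext k N m)"

section \<open>The Poisson parameter and convergence in distribution\<close>

fun C_const :: "nat \<Rightarrow> enat \<Rightarrow> real" where
  "C_const q (enat l) = (\<Prod>j = 1..l. inverse (1 - 1 / real q ^ j))"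
| "C_const q \<infinity> = prodinf (\<lambda>j. inverse (1 - 1 / real q ^ Suc j))"

definition converges_to_Poisson :: "(nat \<Rightarrow> nat pmf) \<Rightarrow> real \<Rightarrow> bool" where
  "converges_to_Poisson P \<mu> \<longleftrightarrow>
     weak_conv_m (\<lambda>n. distr (measure_pmf (P n)) borel real)
                 (distr (measure_pmf (poisson_pmf \<mu>)) borel real)"

end

theory Submission
  imports Defs
begin

text \<open>
  The proof computes factorial moments. For a set \<open>\<H>\<close> of \<open>r\<close>-dimensional subspaces let \<open>u\<close> be the
  dimension of \<open>\<Sum>\<H>\<close> and \<open>w\<close> that of the sum of the \<open>\<Lambda>\<^sup>kH\<close>, \<open>H \<in> \<H>\<close>. All members of \<open>\<H>\<close> are null with
  probability \<open>q\<^bsup>-mw\<^esup>\<close>, and up to a factor \<open>q\<^bsup>O(r\<^sup>2)\<^esup>\<close> there are at most \<open>q\<^bsup>cu\<^esup>\<close> families \<open>\<H>\<close> of a given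
  size with a given \<open>u\<close>. Families in direct sum have \<open>w = s (r choose k)\<close>, hence \<open>mw = src\<close>, and give
  the main term \<open>\<mu>\<^sup>s / s!\<close> of the \<open>s\<close>-th binomial moment. All other families satisfy
  \<open>r w \<ge> (r choose k) (u + 1)\<close>, so that \<open>mw \<ge> c (u + 1)\<close> and their total contribution is
  \<open>q\<^bsup>O(r\<^sup>2) - c\<^esup>\<close>, which vanishes because \<open>c / r\<^sup>2 \<rightarrow> \<infinity>\<close>.

  For this inequality, let the slack be \<open>r w - (r choose k) u\<close>. It does not decrease when a subspace \<open>H\<close> is
  added, and grows by at least \<open>r choose k\<close> if \<open>H\<close> meets the span of the previous members in a proper
  nonzero subspace. In a minimal dependent family in which that never happens, each member is contained in
  the direct sum of the others, and the last one contributes at least \<open>(r - 1) choose (k - 1)\<close> new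
  dimensions to \<open>w\<close> and none to \<open>u\<close>.

  The Bonferroni inequalities turn the moments into the Poisson limit. For the maximal dimension, the first
  moment excludes null subspaces of dimension \<open>r + 1\<close>, and the second moment, estimated by the same slack
  inequality, produces one of dimension \<open>r - 1\<close>.
\<close>

section \<open>Linear algebra\<close>

text \<open>Resonance says \<open>c = m (r choose k) / r\<close>, so the families with ranks
  \<open>u\<close> and \<open>w\<close> carry total weight about q^(cu - mw) = q^(-(m/r) slack).
  Zero slack is exactly critical, and a slack of \<open>r choose k\<close>, the lower bound for
  dependent families, is worth exactly one factor q^(-c). This is the origin of the slack and of the
  \<open>+ 1\<close> in \<open>u + 1\<close>. All else need only be accurate up to q^(K r^2) with
  \<open>K\<close> depending on \<open>s\<close> alone, since \<open>k\<close>, \<open>r\<close> and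
  \<open>m\<close> vary along the sequence; hence the crude counts of subspaces and the explicit
  error terms. One dimension lower the balance is no longer critical: for \<open>k < r\<close> the
  mean is at least q^c, and the contribution of dependent pairs relative to the squared mean again
  loses q^(-c). Exterior powers are given by minors in coordinates, but identities between minors
  are avoided: their bases are recognised by comparing cardinality with dimension.\<close>

context vector_space begin

text \<open>\<open>dim\<close> is 0 for sets of infinite dimension, so monotonicity depends on a
  finite spanning set; the ambient \<open>W\<close> supplies one here and below. The sets are not
  assumed to be subspaces, since \<open>dim\<close> measures their span.\<close>

lemma dim_mono_fg:
  assumes "finite W" "V' \<subseteq> span W" "V \<subseteq> span V'"
  shows "dim V \<le> dim V'"
proof -
  obtain B where B: "B \<subseteq> V'" "independent B" "V' \<subseteq> span B" "card B = dim V'"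
    using basis_exists by blast
  have "B \<subseteq> span W" using B assms by blast
  then have "finite B" using independent_span_bound[OF assms(1) B(2)] by simp
  moreover have "V \<subseteq> span B" using assms(3) B(3) span_mono[of V' "span B"] span_span by blast
  ultimately show ?thesis using dim_le_card B(4) by metis
qed

lemma finite_basis_fg:
  assumes "finite W" "V \<subseteq> span W"
  obtains B where "finite B" "B \<subseteq> V" "independent B" "V \<subseteq> span B" "card B = dim V"
proof -
  obtain B where B: "B \<subseteq> V" "independent B" "V \<subseteq> span B" "card B = dim V"
    using basis_exists by blast
  moreover have "B \<subseteq> span W" using B assms by blast
  then have "finite B" using independent_span_bound[OF assms(1) B(2)] by simp
  ultimately show ?thesis using that by blast
qed

lemma extend_basis_fg:
  assumes "finite W" "V \<subseteq> span W" "D \<subseteq> V" "independent D"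
  obtains B where "D \<subseteq> B" "finite B" "B \<subseteq> V" "independent B" "V \<subseteq> span B" "card B = dim V"
proof -
  obtain B where B: "D \<subseteq> B" "B \<subseteq> V" "independent B" "V \<subseteq> span B"
    using maximal_independent_subset_extend[OF assms(3,4)] by blast
  moreover have "B \<subseteq> span W" using B assms by blast
  then have "finite B" using independent_span_bound[OF assms(1) B(3)] by simp
  ultimately show ?thesis using that basis_card_eq_dim by blast
qed

text \<open>A dependent set keeps its span when a suitable element is removed, so its dimension is
  smaller than its cardinality. Independence of wedges is obtained by this count.\<close>

lemma independent_if_card_le_dim:
  assumes "finite W" "card W \<le> dim W"
  shows "independent W"
proof
  assume "dependent W"
  then obtain x where x: "x \<in> W" "x \<in> span (W - {x})" unfolding dependent_def by blast
  have "W \<subseteq> span (W - {x})"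
  proof
    fix y assume "y \<in> W"
    then show "y \<in> span (W - {x})" using x(2) by (cases "y = x") (auto intro: span_base)
  qed
  then have "dim W \<le> card (W - {x})" using assms(1) by (intro dim_le_card) auto
  also have "\<dots> < card W" by (rule psubset_card_mono[OF assms(1)]) (use x(1) in blast)
  finally show False using assms(2) by linarith
qed

text \<open>The vectors extending a basis of \<open>A\<close> to one of \<open>A \<union> B\<close>,
  together with a basis of \<open>A'\<close>, span \<open>A' \<union> B\<close>. Thus
  \<open>B\<close> gains no more over a larger set, which carries a gain computed over a full
  exterior power down to its subsets.\<close>

lemma dim_submodular:
  assumes "finite W" "A' \<union> B \<subseteq> span W" "A \<subseteq> span A'"
  shows "dim (A' \<union> B) + dim A \<le> dim (A \<union> B) + dim A'"
proof -
  have sA': "span A' \<subseteq> span W" using assms(2) by (meson le_sup_iff span_minimal subspace_span)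
  have AW: "A \<subseteq> span W" using assms sA' by blast
  obtain D where D: "finite D" "D \<subseteq> A" "independent D" "A \<subseteq> span D" "card D = dim A"
    using finite_basis_fg[OF assms(1) AW] by blast
  have "A \<union> B \<subseteq> span W" using AW assms by blast
  then obtain E where E: "D \<subseteq> E" "finite E" "E \<subseteq> A \<union> B" "independent E"
      "A \<union> B \<subseteq> span E" "card E = dim (A \<union> B)"
    using extend_basis_fg[of W "A \<union> B" D] D assms(1) by blast
  have "A' \<subseteq> span W" using assms(2) by blast
  then obtain D' where D': "finite D'" "D' \<subseteq> A'" "independent D'" "A' \<subseteq> span D'" "card D' = dim A'"
    using finite_basis_fg[OF assms(1)] by metis
  let ?X = "D' \<union> (E - D)"
  have 1: "A' \<subseteq> span ?X" using D'(4) span_mono[of D' ?X] by blast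
  have "span A' \<subseteq> span ?X" using 1 by (simp add: span_minimal)
  then have "D \<subseteq> span ?X" using D(2) assms(3) by blast
  moreover have "E - D \<subseteq> span ?X" using span_superset[of ?X] by blast
  ultimately have "E \<subseteq> span ?X" by blast
  then have "span E \<subseteq> span ?X" by (simp add: span_minimal)
  then have "B \<subseteq> span ?X" using E(5) by blast
  then have "dim (A' \<union> B) \<le> card ?X" using 1 D'(1) E(2) by (intro dim_le_card) auto
  also have "\<dots> \<le> card D' + card (E - D)" by (rule card_Un_le)
  also have "card (E - D) = card E - card D" using D(1) E(1) by (simp add: card_Diff_subset)
  finally have "dim (A' \<union> B) \<le> card D' + (card E - card D)" .
  moreover have "card D \<le> card E" using E(1,2) by (simp add: card_mono)
  ultimately show ?thesis using D(5) D'(5) E(6) by linarith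
qed

lemma dim_Un_le:
  assumes "finite W" "A \<union> B \<subseteq> span W"
  shows "dim (A \<union> B) \<le> dim A + dim B"
proof -
  have "dim {} = 0" using dim_eq_card_independent[OF independent_empty] by simp
  then show ?thesis using dim_submodular[OF assms, of "{}"] by simp
qed

lemma span_Int_disjoint_independent:
  assumes "independent (A \<union> B)" "A \<inter> B = {}"
  shows "span A \<inter> span B = {0}"
proof -
  have "x = 0" if x: "x \<in> span A" "x \<in> span B" for x
  proof -
    have a: "representation (A \<union> B) x = representation A x"
      using assms x by (intro representation_extend) auto
    have b: "representation (A \<union> B) x = representation B x"
      using assms x by (intro representation_extend) auto
    have z: "representation (A \<union> B) x b = 0" for b
    proof (rule ccontr)
      assume "representation (A \<union> B) x b \<noteq> 0"
      then have "representation A x b \<noteq> 0" "representation B x b \<noteq> 0" by (simp_all flip: a b)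
      then have "b \<in> A" "b \<in> B" by (simp_all add: representation_ne_zero)
      then show False using assms(2) by blast
    qed
    have "x \<in> span (A \<union> B)" using x(1) span_mono[of A "A \<union> B"] by blast
    then show "x = 0" using sum_nonzero_representation_eq[OF assms(1), of x] by (simp add: z)
  qed
  then show ?thesis using span_zero by auto
qed

lemma independent_Un:
  assumes "finite B" "independent A" "independent B" "span A \<inter> span B \<subseteq> {0}"
  shows "independent (A \<union> B)"
  using assms
proof (induction B)
  case (insert b B)
  have iB: "independent B" "b \<notin> span B"
    using insert.prems insert.hyps independent_insert by auto
  have "span B \<subseteq> span (insert b B)" by (rule span_mono) auto
  then have "independent (A \<union> B)" using insert iB by blast
  moreover have "b \<notin> span (A \<union> B)"
  proof
    assume "b \<in> span (A \<union> B)"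
    then obtain x y where xy: "b = x + y" "x \<in> span A" "y \<in> span B" unfolding span_Un by blast
    have "b - y \<in> span (insert b B)"
      using \<open>span B \<subseteq> span (insert b B)\<close> xy by (intro span_diff) (auto intro: span_base)
    moreover have "b - y = x" using xy by simp
    ultimately have "x = 0" using xy insert.prems by auto
    then show False using xy iB by simp
  qed
  ultimately show ?case by (simp add: independent_insertI)
qed simp

lemma subspace_eq_dim:
  assumes "finite W" "T \<subseteq> span W" "subspace S" "subspace T" "S \<subseteq> T" "dim T \<le> dim S"
  shows "S = T"
proof -
  obtain B where B: "finite B" "B \<subseteq> S" "independent B" "S \<subseteq> span B" "card B = dim S"
    using finite_basis_fg[of W S] assms by blast
  obtain E where E: "B \<subseteq> E" "finite E" "E \<subseteq> T" "independent E" "T \<subseteq> span E" "card E = dim T"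
    using extend_basis_fg[of W T B] assms B by blast
  have "E = B" using card_seteq[OF E(2,1)] B(5) E(6) assms(6) by simp
  then show ?thesis using E(5) span_minimal[OF B(2) assms(3)] assms(5) by blast
qed

text \<open>A basis of the intersection is extended to \<open>S\<close> and to \<open>T\<close>
  separately. Wedges over \<open>B1\<close>, \<open>B2\<close> and \<open>B0\<close> then describe
  all exterior powers involved, and dimension formulas become inclusion-exclusion for
  \<open>k\<close>-subsets.\<close>

lemma basis_Un_Int:
  assumes "finite W" "S \<union> T \<subseteq> span W" "subspace S" "subspace T"
  obtains B0 B1 B2 where "finite B1" "finite B2" "B0 = B1 \<inter> B2" "independent (B1 \<union> B2)"
    "span B0 = S \<inter> T" "span B1 = S" "span B2 = T"
    "card B0 = dim (S \<inter> T)" "card B1 = dim S" "card B2 = dim T"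
proof -
  obtain B0 where B0: "finite B0" "B0 \<subseteq> S \<inter> T" "independent B0" "S \<inter> T \<subseteq> span B0" "card B0 = dim (S \<inter> T)"
    using finite_basis_fg[of W "S \<inter> T"] assms(1,2) by (metis le_sup_iff inf.coboundedI1)
  obtain B1 where B1: "B0 \<subseteq> B1" "finite B1" "B1 \<subseteq> S" "independent B1" "S \<subseteq> span B1" "card B1 = dim S"
    using extend_basis_fg[of W S B0] assms B0 by blast
  obtain B2 where B2: "B0 \<subseteq> B2" "finite B2" "B2 \<subseteq> T" "independent B2" "T \<subseteq> span B2" "card B2 = dim T"
    using extend_basis_fg[of W T B0] assms B0 by blast
  have "span B0 = S \<inter> T"
    using B0(2,4) assms(3,4) by (intro subset_antisym span_minimal subspace_inter)
  moreover have "span B1 = S" using B1(3,5) assms(3) by (intro subset_antisym span_minimal)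
  moreover have "span B2 = T" using B2(3,5) assms(4) by (intro subset_antisym span_minimal)
  ultimately have s: "span B0 = S \<inter> T" "span B1 = S" "span B2 = T" by simp_all
  have "B1 \<inter> B2 \<subseteq> B0"
  proof
    fix x assume x: "x \<in> B1 \<inter> B2"
    show "x \<in> B0"
    proof (rule ccontr)
      assume n: "x \<notin> B0"
      have "x \<in> span B0" using x B1(3) B2(3) B0(4) by blast
      moreover have "B0 \<subseteq> B1 - {x}" using n B1(1) by blast
      ultimately have "x \<in> span (B1 - {x})" using span_mono by blast
      moreover have "x \<in> B1" using x by simp
      ultimately have "dependent B1" unfolding dependent_def by (rule bexI)
      then show False using B1(4) by contradiction
    qed
  qed
  then have i: "B0 = B1 \<inter> B2" using B1(1) B2(1) by blast
  \<comment> \<open>The span of \<open>B1 - B0\<close> lies in \<open>S\<close>, so it meets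
    \<open>T\<close> inside \<open>S \<inter> T\<close>, the span of \<open>B0\<close>, and hence
    only in 0.\<close>
  have "independent (B2 \<union> (B1 - B0))"
  proof (rule independent_Un)
    show "independent (B1 - B0)" by (rule independent_mono[OF B1(4)]) blast
    have z: "span B0 \<inter> span (B1 - B0) = {0}"
      using B1(1,4) by (intro span_Int_disjoint_independent) (simp_all add: Un_absorb1)
    have "span (B1 - B0) \<subseteq> S" unfolding s(2)[symmetric] by (rule span_mono) blast
    then have "span B2 \<inter> span (B1 - B0) \<subseteq> span B0 \<inter> span (B1 - B0)" unfolding s(1,3) by blast
    then show "span B2 \<inter> span (B1 - B0) \<subseteq> {0}" by (simp only: z)
    show "finite (B1 - B0)" using B1(2) by simp
    show "independent B2" by (rule B2(4))
  qed
  also have "B2 \<union> (B1 - B0) = B1 \<union> B2" using B2(1) by blast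
  finally have ind: "independent (B1 \<union> B2)" .
  show ?thesis by (rule that[OF B1(2) B2(2) i ind s B0(5) B1(6) B2(6)])
qed

lemma dim_Un_Int:
  assumes "finite W" "S \<union> T \<subseteq> span W" "subspace S" "subspace T"
  shows "dim (S \<union> T) + dim (S \<inter> T) = dim S + dim T"
proof -
  obtain B0 B1 B2 where B:
    "finite B1" "finite B2" "B0 = B1 \<inter> B2" "independent (B1 \<union> B2)"
    "span B0 = S \<inter> T" "span B1 = S" "span B2 = T"
    "card B0 = dim (S \<inter> T)" "card B1 = dim S" "card B2 = dim T"
    by (rule basis_Un_Int[OF assms])
  have "span (S \<union> T) = span (B1 \<union> B2)"
    unfolding span_Un B(6,7)[symmetric] span_span ..
  then have "dim (S \<union> T) = dim (span (B1 \<union> B2))" by (metis dim_span)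
  also have "\<dots> = card (B1 \<union> B2)" by (rule dim_span_eq_card_independent[OF B(4)])
  finally have "dim (S \<union> T) = card (B1 \<union> B2)" .
  moreover have "card (B1 \<union> B2) + dim (S \<inter> T) = dim S + dim T"
    using card_Un_Int[OF B(1,2)] unfolding B(8)[symmetric] B(3) B(9,10) by linarith
  ultimately show ?thesis by linarith
qed

end

section \<open>Bases of exterior powers\<close>

lemma wedge_cong: "(\<And>i. i < k \<Longrightarrow> v i = v' i) \<Longrightarrow> wedge k v = wedge k v'"
  unfolding wedge_def by (auto simp: fun_eq_iff intro!: arg_cong[of _ _ Determinant.det])

text \<open>The Leibniz formula with the factor of row \<open>i\<close> pulled out: it displays each
  coordinate as a linear form in \<open>x\<close>, from which additivity and homogeneity
  follow.\<close>

lemma wedge_update: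
  assumes "i < k"
  shows "wedge k (v(i := x)) S = (if finite S \<and> card S = k then
    \<Sum>p | p permutes {0..<k}. (signof p * (\<Prod>j\<in>{0..<k} - {i}. v j (sorted_list_of_set S ! p j)))
      * x (sorted_list_of_set S ! p i) else 0)"
proof -
  have "(\<Prod>j = 0..<k. (v(i := x)) j (s ! p j)) = (\<Prod>j\<in>{0..<k} - {i}. v j (s ! p j)) * x (s ! p i)"
    for p and s :: "nat list"
    using assms by (subst prod.remove[of _ i]) (auto simp: mult.commute)
  moreover have "p j < k" if "p permutes {0..<k}" "j < k" for p j
    using permutes_in_image[OF that(1), of j] that(2) by simp
  ultimately show ?thesis
    unfolding wedge_def Determinant.det_def by (auto intro!: sum.cong simp: mult.assoc)
qed

lemma wedge_update_add:
  assumes "i < k"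
  shows "wedge k (v(i := x + y)) = wedge k (v(i := x)) + wedge k (v(i := y))"
  using assms by (auto simp: fun_eq_iff wedge_update algebra_simps sum.distrib)

lemma wedge_update_scale:
  assumes "i < k"
  shows "wedge k (v(i := fscale c x)) = fscale c (wedge k (v(i := x)))"
  using assms by (auto simp: fun_eq_iff wedge_update fscale_def sum_distrib_left mult_ac)

lemma wedge_update_zero: "i < k \<Longrightarrow> wedge k (v(i := 0)) = 0"
  by (auto simp: fun_eq_iff wedge_update)

lemma wedge_identical:
  assumes "i < k" "j < k" "i \<noteq> j" "v i = v j"
  shows "wedge k v = 0"
proof
  fix S
  have "Determinant.det (mat k k (\<lambda>(i, j). v i (sorted_list_of_set S ! j))) = 0"
    by (rule det_identical_rows[of _ k i j]) (use assms in \<open>auto simp: row_def\<close>)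
  then show "wedge k v S = 0 S" by (simp add: wedge_def)
qed

lemma wedge_permute:
  assumes "p permutes {0..<k}"
  shows "wedge k (v \<circ> p) = fscale (signof p) (wedge k v)"
proof
  fix S :: "nat set"
  let ?A = "mat k k (\<lambda>(i, j). v i (sorted_list_of_set S ! j))"
  have "p i < k" if "i < k" for i using permutes_in_image[OF assms, of i] that by simp
  then have "mat k k (\<lambda>(i, j). (v \<circ> p) i (sorted_list_of_set S ! j)) = mat k k (\<lambda>(i,j). ?A $$ (p i, j))"
    by (intro cong_mat) auto
  then have "Determinant.det (mat k k (\<lambda>(i, j). (v \<circ> p) i (sorted_list_of_set S ! j)))
      = signof p * Determinant.det ?A" using det_permute_rows[OF mat_carrier assms] by metis
  then show "wedge k (v \<circ> p) S = fscale (signof p) (wedge k v) S"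
    by (simp add: wedge_def fscale_def)
qed

text \<open>The order of the factors is chosen arbitrarily, so this wedge is determined only up to sign.\<close>

definition wedge_set :: "nat \<Rightarrow> (nat \<Rightarrow> 'a::field) set \<Rightarrow> nat set \<Rightarrow> 'a" where
  "wedge_set k A = wedge k (SOME v. bij_betw v {0..<k} A)"

text \<open>Two enumerations of \<open>A\<close> differ by a permutation, so the wedges differ by
  its sign. Only membership in spans matters later, hence \<open>c\<close> is kept as an unspecified
  nonzero scalar.\<close>

lemma wedge_set_eq:
  assumes "bij_betw v {0..<k} A"
  obtains c where "c \<noteq> 0" "wedge_set k A = fscale c (wedge k v)"
proof -
  define u where "u = (SOME v. bij_betw v {0..<k} A)"
  have u: "bij_betw u {0..<k} A" unfolding u_def by (rule someI[where P="\<lambda>v. bij_betw v {0..<k} A", OF assms])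
  \<comment> \<open>The identity beyond \<open>k\<close> is what \<open>permutes\<close> demands
    outside its set.\<close>
  define p where "p = (\<lambda>i. if i < k then inv_into {0..<k} v (u i) else i)"
  have "bij_betw (inv_into {0..<k} v \<circ> u) {0..<k} {0..<k}"
    by (rule bij_betw_trans[OF u bij_betw_inv_into[OF assms]])
  then have "bij_betw p {0..<k} {0..<k}"
    by (rule bij_betw_cong[THEN iffD1, rotated]) (simp add: p_def)
  then have p: "p permutes {0..<k}" by (rule bij_imp_permutes) (simp add: p_def)
  have "wedge k u = wedge k (v \<circ> p)"
  proof (rule wedge_cong)
    fix i assume "i < k"
    then have "u i \<in> v ` {0..<k}" using u assms by (auto simp: bij_betw_def)
    then show "u i = (v \<circ> p) i" using \<open>i < k\<close> by (simp add: p_def f_inv_into_f)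
  qed
  also have "\<dots> = fscale (signof p) (wedge k v)" by (rule wedge_permute[OF p])
  finally have "wedge_set k A = fscale (signof p) (wedge k v)" by (simp add: wedge_set_def u_def)
  moreover have "(signof p :: 'a) \<noteq> 0" by (simp add: sign_def)
  ultimately show ?thesis by (intro that)
qed

lemma wedge_set_in_span:
  assumes "bij_betw v {0..<k} A" "wedge k v \<in> fvs.span X"
  shows "wedge_set k A \<in> fvs.span X"
  using wedge_set_eq[OF assms(1)] assms(2) fvs.span_scale by metis

lemma wedge_in_span_wedge_set:
  assumes "bij_betw v {0..<k} A" "wedge_set k A \<in> fvs.span X"
  shows "wedge k v \<in> fvs.span X"
proof -
  obtain c where c: "c \<noteq> 0" "wedge_set k A = fscale c (wedge k v)" using wedge_set_eq[OF assms(1)] .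
  then have "fscale (inverse c) (wedge_set k A) = wedge k v" by (simp add: fscale_def fun_eq_iff)
  then show ?thesis using assms(2) fvs.span_scale by metis
qed

section \<open>Spanning sets of exterior powers\<close>

definition ksubsets :: "nat \<Rightarrow> 'b set \<Rightarrow> 'b set set" where
  "ksubsets k B = {A. A \<subseteq> B \<and> card A = k}"

lemma wedge_in_span:
  assumes "finite B" "\<And>i. i < k \<Longrightarrow> v i \<in> fvs.span B"
  shows "wedge k v \<in> fvs.span (wedge_set k ` ksubsets k B)"
proof -
  let ?Z = "fvs.span (wedge_set k ` ksubsets k B)"
  \<comment> \<open>Multilinear expansion, one row at a time: rows below \<open>j\<close> are
    arbitrary in the span, the remaining rows already belong to \<open>B\<close>.\<close>
  have "wedge k v \<in> ?Z"
    if "j \<le> k" "\<And>i. i < j \<Longrightarrow> v i \<in> fvs.span B" "\<And>i. j \<le> i \<Longrightarrow> i < k \<Longrightarrow> v i \<in> B" for j v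
    using that
  proof (induction j arbitrary: v)
    case 0
    \<comment> \<open>All rows now lie in \<open>B\<close>: they either enumerate a
      \<open>k\<close>-subset of \<open>B\<close> or contain a repetition, and then the wedge is
      0.\<close>
    show ?case
    proof (cases "inj_on v {0..<k}")
      case True
      then have b: "bij_betw v {0..<k} (v ` {0..<k})" by (simp add: bij_betw_def)
      have "v ` {0..<k} \<in> ksubsets k B" using 0 True by (auto simp: ksubsets_def card_image)
      then show ?thesis by (intro wedge_in_span_wedge_set[OF b] fvs.span_base) simp
    next
      case False
      then obtain i j where "i < k" "j < k" "i \<noteq> j" "v i = v j" by (auto simp: inj_on_def)
      then show ?thesis using wedge_identical fvs.span_zero by metis
    qed
  next
    case (Suc j)
    then have jk: "j < k" by simp
    have "wedge k (v(j := x)) \<in> ?Z" if "x \<in> fvs.span B" for x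
      using that
    proof (induction rule: fvs.span_induct_alt)
      case base
      then show ?case using wedge_update_zero[OF jk] fvs.span_zero by metis
    next
      case (step c x y)
      have "wedge k (v(j := x)) \<in> ?Z" using Suc step(1) by (intro Suc.IH) auto
      then show ?case
        unfolding wedge_update_add[OF jk] wedge_update_scale[OF jk]
        using \<open>wedge k (v(j := x)) \<in> ?Z\<close> step(2) by (intro fvs.span_add fvs.span_scale)
    qed
    then have "wedge k (v(j := v j)) \<in> ?Z" using Suc.prems(2) by blast
    then show ?case by simp
  qed
  from this[of k v] show ?thesis using assms by simp
qed

lemma ext_power_span:
  assumes "finite B"
  shows "ext_power k (fvs.span B) = fvs.span (wedge_set k ` ksubsets k B)"
proof
  show "ext_power k (fvs.span B) \<subseteq> fvs.span (wedge_set k ` ksubsets k B)"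
    unfolding ext_power_def
    by (intro fvs.span_minimal fvs.subspace_span) (use wedge_in_span[OF assms] in blast)
  have "wedge_set k A \<in> ext_power k (fvs.span B)" if A: "A \<in> ksubsets k B" for A
  proof -
    have "finite A" "card A = k" using A assms by (auto simp: ksubsets_def finite_subset)
    then obtain v where v: "bij_betw v {0..<k} A" using ex_bij_betw_nat_finite by blast
    have "\<forall>i<k. v i \<in> fvs.span B"
      using v A by (auto simp: ksubsets_def bij_betw_def intro!: fvs.span_base)
    then show ?thesis unfolding ext_power_def
      by (intro wedge_set_in_span[OF v] fvs.span_base) blast
  qed
  then show "fvs.span (wedge_set k ` ksubsets k B) \<subseteq> ext_power k (fvs.span B)"
    by (intro fvs.span_minimal) (auto simp: ext_power_def fvs.subspace_span)
qed

lemma ext_power_mono: "H \<subseteq> H' \<Longrightarrow> ext_power k H \<subseteq> ext_power k H'"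
  unfolding ext_power_def by (intro fvs.span_mono) blast

lemma subspace_ext_power: "fvs.subspace (ext_power k H)"
  unfolding ext_power_def by (rule fvs.subspace_span)

lemma card_ksubsets: "finite B \<Longrightarrow> card (ksubsets k B) = card B choose k"
  unfolding ksubsets_def by (rule n_subsets)

lemma finite_ksubsets: "finite B \<Longrightarrow> finite (ksubsets k B)"
  by (rule finite_subset[of _ "Pow B"]) (auto simp: ksubsets_def)

section \<open>Standard coordinates and independence of wedges\<close>

definition unit_fun :: "'i \<Rightarrow> 'i \<Rightarrow> 'a::field" where
  "unit_fun i = (\<lambda>j. if j = i then 1 else 0)"

lemma inj_unit_fun: "inj (unit_fun :: 'i \<Rightarrow> 'i \<Rightarrow> 'a::field)"
  by (rule injI) (metis unit_fun_def zero_neq_one)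

lemma independent_unit_fun: "finite I \<Longrightarrow> fvs.independent (unit_fun ` I :: ('i \<Rightarrow> 'a::field) set)"
proof (induction I rule: finite_induct)
  case empty
  then show ?case by (simp add: fvs.independent_empty)
next
  case (insert i I)
  have "fvs.span (unit_fun ` I) \<subseteq> {v :: 'i \<Rightarrow> 'a. v i = 0}"
    using insert.hyps
    by (intro fvs.span_minimal) (auto simp: unit_fun_def fvs.subspace_def fscale_def)
  moreover have "unit_fun i i = (1 :: 'a)" by (simp add: unit_fun_def)
  ultimately have "unit_fun i \<notin> fvs.span (unit_fun ` I :: ('i \<Rightarrow> 'a) set)" by auto
  then show ?case using insert.IH by (simp add: fvs.independent_insertI)
qed

lemma span_unit_fun:
  assumes "finite I"
  shows "fvs.span (unit_fun ` I :: ('i \<Rightarrow> 'a::field) set) = coord_space I"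
proof
  show "fvs.span (unit_fun ` I :: ('i \<Rightarrow> 'a) set) \<subseteq> coord_space I"
    by (intro fvs.span_minimal)
      (auto simp: unit_fun_def fvs.subspace_def fscale_def coord_space_def)
  show "coord_space I \<subseteq> fvs.span (unit_fun ` I :: ('i \<Rightarrow> 'a) set)"
  proof
    fix v :: "'i \<Rightarrow> 'a" assume v: "v \<in> coord_space I"
    have "v = (\<Sum>i\<in>I. fscale (v i) (unit_fun i))"
    proof
      fix j
      have "(\<Sum>i\<in>I. fscale (v i) (unit_fun i)) j = (\<Sum>i\<in>I. if i = j then v j else 0)"
        using assms by (induction I rule: finite_induct) (auto simp: fscale_def unit_fun_def)
      also have "\<dots> = v j" using v assms by (auto simp: coord_space_def)
      finally show "v j = (\<Sum>i\<in>I. fscale (v i) (unit_fun i)) j" ..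
    qed
    moreover have "(\<Sum>i\<in>I. fscale (v i) (unit_fun i)) \<in> fvs.span (unit_fun ` I)"
      by (intro fvs.span_sum fvs.span_scale fvs.span_base) auto
    ultimately show "v \<in> fvs.span (unit_fun ` I)" by metis
  qed
qed

lemma dim_coord_space: "finite I \<Longrightarrow> fvs.dim (coord_space I :: ('i \<Rightarrow> 'a::field) set) = card I"
  using fvs.dim_span_eq_card_independent[OF independent_unit_fun, where 'a='a]
  by (metis span_unit_fun card_image inj_unit_fun inj_on_subset subset_UNIV)

text \<open>By \<open>wedge_unit_vectors\<close> the wedges of standard basis vectors are themselves
  distinct unit vectors. This is the only place where independence of wedges is read off from
  coordinates; all other bases are compared with this one.\<close>

lemma choose_le_dim_ext_power_std:
  "N choose k \<le> fvs.dim (ext_power k (std_space N) :: (nat set \<Rightarrow> 'a::field) set)"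
proof -
  let ?U = "unit_fun ` ksubsets k {..<N} :: (nat set \<Rightarrow> 'a) set"
  have fin: "finite (ksubsets k {..<N})" by (simp add: finite_ksubsets)
  have "unit_fun T \<in> (ext_power k (std_space N) :: (nat set \<Rightarrow> 'a) set)" if "T \<in> ksubsets k {..<N}" for T
  proof -
    have T: "finite T" "card T = k" "T \<subseteq> {..<N}" using that by (auto simp: ksubsets_def finite_subset)
    let ?v = "\<lambda>i j. if j = sorted_list_of_set T ! i then 1 else (0::'a)"
    have "?v i \<in> std_space N" if "i < k" for i
    proof -
      have "sorted_list_of_set T ! i \<in> T"
        using T that by (metis nth_mem set_sorted_list_of_set
          sorted_list_of_set.length_sorted_key_list_of_set)
      then show ?thesis using T by (auto simp: coord_space_def)
    qed
    moreover have "unit_fun T = wedge k ?v"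
      using wedge_unit_vectors[OF T(1,2), where 'a='a] by (simp add: unit_fun_def fun_eq_iff)
    ultimately show ?thesis unfolding ext_power_def by (intro fvs.span_base) blast
  qed
  then have sub: "fvs.span ?U \<subseteq> ext_power k (std_space N)"
    by (intro fvs.span_minimal subspace_ext_power) auto
  have U: "finite (unit_fun ` {..<N} :: (nat \<Rightarrow> 'a) set)" by simp
  have "ext_power k (std_space N) \<subseteq> fvs.span (wedge_set k ` ksubsets k (unit_fun ` {..<N} :: (nat \<Rightarrow> 'a) set))"
    using ext_power_span[OF U, of k] by (simp add: span_unit_fun)
  then have "fvs.dim (fvs.span ?U) \<le> fvs.dim (ext_power k (std_space N) :: (nat set \<Rightarrow> 'a) set)"
    using sub by (intro fvs.dim_mono_fg[of "wedge_set k ` ksubsets k (unit_fun ` {..<N} :: (nat \<Rightarrow> 'a) set)"])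
       (auto simp: finite_ksubsets intro: fvs.span_base)
  moreover have "fvs.dim (fvs.span ?U) = N choose k"
    using fvs.dim_span_eq_card_independent[OF independent_unit_fun[OF fin], where 'a='a]
    by (simp add: card_image inj_on_subset[OF inj_unit_fun] card_ksubsets)
  ultimately show ?thesis by simp
qed

text \<open>After extension of \<open>B\<close> to a basis \<open>C\<close> of the whole space, at
  most \<open>N choose k\<close> wedges span a space of dimension at least
  \<open>N choose k\<close>. They are therefore distinct and independent, and so are those coming
  from \<open>B\<close>.\<close>

lemma independent_wedge_set:
  assumes "finite B" "fvs.independent B" "B \<subseteq> std_space N"
  shows "inj_on (wedge_set k) (ksubsets k B)" "fvs.independent (wedge_set k ` ksubsets k B)"
proof -
  let ?E = "unit_fun ` {..<N} :: (nat \<Rightarrow> 'a) set"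
  have E: "finite ?E" "fvs.span ?E = std_space N" by (simp_all add: span_unit_fun)
  obtain C where C: "B \<subseteq> C" "finite C" "C \<subseteq> std_space N" "fvs.independent C"
     "std_space N \<subseteq> fvs.span C" "card C = fvs.dim (std_space N :: (nat \<Rightarrow> 'a) set)"
    by (rule fvs.extend_basis_fg[OF E(1) _ assms(3,2)]) (simp_all add: E)
  have cC: "card C = N" using C(6) by (simp add: dim_coord_space)
  let ?W = "wedge_set k ` ksubsets k C"
  have finW: "finite ?W" by (simp add: finite_ksubsets C)
  have "fvs.span C = std_space N" using C(3,5)
    by (metis E(2) fvs.span_minimal fvs.subspace_span subset_antisym)
  then have sp: "ext_power k (std_space N) = fvs.span ?W" using ext_power_span[OF C(2), of k] by simp
  have le: "N choose k \<le> fvs.dim ?W"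
    using choose_le_dim_ext_power_std[of N k, where 'a='a] unfolding sp by simp
  have card_le: "card ?W \<le> N choose k"
    using card_image_le[OF finite_ksubsets[OF C(2)], of "wedge_set k" k] card_ksubsets[OF C(2), of k] cC by simp
  have "fvs.dim ?W \<le> card ?W" by (rule fvs.dim_le_card[OF fvs.span_superset finW])
  then have cW: "card ?W = card (ksubsets k C)" using card_le le card_ksubsets[OF C(2), of k] cC by simp
  then have inj: "inj_on (wedge_set k) (ksubsets k C)" by (rule eq_card_imp_inj_on[OF finite_ksubsets[OF C(2)]])
  have ind: "fvs.independent ?W"
    by (rule fvs.independent_if_card_le_dim[OF finW]) (use card_le le in linarith)
  have sub: "ksubsets k B \<subseteq> ksubsets k C" using C(1) by (auto simp: ksubsets_def)
  show "inj_on (wedge_set k) (ksubsets k B)" by (rule inj_on_subset[OF inj sub])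
  show "fvs.independent (wedge_set k ` ksubsets k B)" by (rule fvs.independent_mono[OF ind image_mono[OF sub]])
qed

lemma dim_span_wedge_set:
  assumes "finite B" "fvs.independent B" "B \<subseteq> std_space N" "\<A> \<subseteq> ksubsets k B"
  shows "fvs.dim (fvs.span (wedge_set k ` \<A>)) = card \<A>"
proof -
  note ind = independent_wedge_set[OF assms(1-3), of k]
  have "fvs.independent (wedge_set k ` \<A>)"
    by (rule fvs.independent_mono[OF ind(2) image_mono[OF assms(4)]])
  then have "fvs.dim (fvs.span (wedge_set k ` \<A>)) = card (wedge_set k ` \<A>)"
    by (rule fvs.dim_span_eq_card_independent)
  also have "\<dots> = card \<A>" by (rule card_image[OF inj_on_subset[OF ind(1) assms(4)]])
  finally show ?thesis .
qed

section \<open>Growth of sums of exterior powers\<close>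

lemma std_space_fg:
  obtains W :: "(nat \<Rightarrow> 'a::field) set" where "finite W" "fvs.span W = std_space N"
  by (rule that[of "unit_fun ` {..<N}"]) (simp_all add: span_unit_fun)

lemma ext_power_std_fg:
  obtains W :: "(nat set \<Rightarrow> 'a::field) set" where "finite W" "fvs.span W = ext_power k (std_space N)"
proof -
  obtain E :: "(nat \<Rightarrow> 'a) set" where E: "finite E" "fvs.span E = std_space N" by (rule std_space_fg)
  have "fvs.span (wedge_set k ` ksubsets k E) = ext_power k (std_space N)"
    using ext_power_span[OF E(1), of k] E(2) by simp
  then show ?thesis by (intro that[of "wedge_set k ` ksubsets k E"]) (simp_all add: finite_ksubsets E)
qed

lemma subspace_std_space: "fvs.subspace (std_space N :: (nat \<Rightarrow> 'a::field) set)"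
  by (auto simp: fvs.subspace_def coord_space_def fscale_def)

lemma wedge_in_ext_power: "(\<And>i. i < k \<Longrightarrow> v i \<in> H) \<Longrightarrow> wedge k v \<in> ext_power k H"
  unfolding ext_power_def by (rule fvs.span_base) blast

lemma subspace_basis:
  assumes "fvs.subspace H" "H \<subseteq> std_space N"
  obtains B where "finite B" "B \<subseteq> H" "fvs.independent B" "fvs.span B = H" "card B = fvs.dim H"
proof -
  obtain E :: "(nat \<Rightarrow> 'a) set" where E: "finite E" "fvs.span E = std_space N" by (rule std_space_fg)
  obtain B where B: "finite B" "B \<subseteq> H" "fvs.independent B" "H \<subseteq> fvs.span B" "card B = fvs.dim H"
    by (rule fvs.finite_basis_fg[OF E(1), of H]) (use assms E in simp)
  have "fvs.span B = H" by (rule subset_antisym[OF fvs.span_minimal[OF B(2) assms(1)] B(4)])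
  then show ?thesis by (rule that[OF B(1,2,3) _ B(5)])
qed

lemma dim_ext_power:
  assumes "fvs.subspace H" "H \<subseteq> std_space N"
  shows "fvs.dim (ext_power k H) = fvs.dim H choose k"
proof -
  obtain B where B: "finite B" "B \<subseteq> H" "fvs.independent B" "fvs.span B = H" "card B = fvs.dim H"
    by (rule subspace_basis[OF assms])
  have "fvs.dim (fvs.span (wedge_set k ` ksubsets k B)) = card (ksubsets k B)"
    by (rule dim_span_wedge_set[OF B(1,3)]) (use B(2) assms(2) in auto)
  then show ?thesis using ext_power_span[OF B(1), of k] by (simp add: B card_ksubsets)
qed

text \<open>In a basis adapted to \<open>H\<close> and \<open>U\<close>, the
  \<open>k\<close>-subsets of \<open>B1\<close> or of \<open>B2\<close> index independent wedges
  spanning the sum, and a \<open>k\<close>-subset of both is one of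
  \<open>B0 = B1 \<inter> B2\<close>.\<close>

lemma dim_ext_power_Un:
  assumes "fvs.subspace H" "H \<subseteq> std_space N" "fvs.subspace U" "U \<subseteq> std_space N"
  shows "fvs.dim (ext_power k U \<union> ext_power k H) + (fvs.dim (H \<inter> U) choose k)
    = (fvs.dim U choose k) + (fvs.dim H choose k)"
proof -
  obtain E :: "(nat \<Rightarrow> 'a) set" where E: "finite E" "fvs.span E = std_space N" by (rule std_space_fg)
  have HU: "H \<union> U \<subseteq> fvs.span E" using assms E by simp
  obtain B0 B1 B2 where B: "finite B1" "finite B2" "B0 = B1 \<inter> B2" "fvs.independent (B1 \<union> B2)"
    "fvs.span B0 = H \<inter> U" "fvs.span B1 = H" "fvs.span B2 = U"
    "card B0 = fvs.dim (H \<inter> U)" "card B1 = fvs.dim H" "card B2 = fvs.dim U"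
    by (rule fvs.basis_Un_Int[OF E(1) HU assms(1,3)])
  have B12: "B1 \<union> B2 \<subseteq> std_space N"
    using fvs.span_superset[of B1] fvs.span_superset[of B2] unfolding B(6,7) using assms by blast
  let ?S = "ksubsets k B1 \<union> ksubsets k B2"
  have "fvs.span (ext_power k U \<union> ext_power k H) = fvs.span (wedge_set k ` ?S)"
    unfolding image_Un fvs.span_Un[of "ext_power k U"] fvs.span_Un[of "wedge_set k ` ksubsets k B1"]
      ext_power_span[OF B(1), of k, unfolded B(6), symmetric]
      ext_power_span[OF B(2), of k, unfolded B(7), symmetric]
      fvs.span_eq_iff[THEN iffD2, OF subspace_ext_power]
    by (auto simp: add.commute) (use add.commute in blast)+
  then have "fvs.dim (ext_power k U \<union> ext_power k H) = fvs.dim (fvs.span (wedge_set k ` ?S))"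
    by (metis fvs.dim_span)
  also have "\<dots> = card ?S"
    by (rule dim_span_wedge_set[OF _ B(4) B12]) (use B(1,2) in \<open>auto simp: ksubsets_def\<close>)
  finally have 1: "fvs.dim (ext_power k U \<union> ext_power k H) = card ?S" .
  have "ksubsets k B1 \<inter> ksubsets k B2 = ksubsets k B0" unfolding B(3) by (auto simp: ksubsets_def)
  then have "card ?S + card (ksubsets k B0) = card (ksubsets k B1) + card (ksubsets k B2)"
    using card_Un_Int[OF finite_ksubsets[OF B(1)] finite_ksubsets[OF B(2)], of k k] by simp
  moreover have "finite B0" using B(1,3) by simp
  ultimately show ?thesis using 1 by (simp add: card_ksubsets B(1,2,8,9,10))
qed

text \<open>If \<open>A\<close> is all of \<open>ext_power k U\<close>, this is the equality
  \<open>dim_ext_power_Un\<close>; submodularity extends the gain to smaller \<open>A\<close>. In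
  use, \<open>U\<close> is the span of the members chosen so far.\<close>

lemma ext_gain:
  assumes H: "fvs.subspace H" "H \<subseteq> std_space N" and U: "fvs.subspace U" "U \<subseteq> std_space N"
    and A: "A \<subseteq> ext_power k U"
  shows "fvs.dim A + (fvs.dim H choose k)
    \<le> fvs.dim (A \<union> ext_power k H) + (fvs.dim (H \<inter> U) choose k)"
proof -
  obtain W :: "(nat set \<Rightarrow> 'a) set" where W: "finite W" "fvs.span W = ext_power k (std_space N)"
    by (rule ext_power_std_fg)
  have "fvs.dim (ext_power k U \<union> ext_power k H) + fvs.dim A
     \<le> fvs.dim (A \<union> ext_power k H) + fvs.dim (ext_power k U)"
  proof (rule fvs.dim_submodular[OF W(1)])
    show "ext_power k U \<union> ext_power k H \<subseteq> fvs.span W"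
      using H U unfolding W by (simp add: ext_power_mono)
    show "A \<subseteq> fvs.span (ext_power k U)" using A fvs.span_superset[of "ext_power k U"] by (rule subset_trans)
  qed
  then show ?thesis using dim_ext_power_Un[OF H U, of k] dim_ext_power[OF U, of k] by linarith
qed

text \<open>
  Choose a hyperplane \<open>K\<close> of \<open>X + P\<close> containing \<open>P\<close> but not \<open>x1 \<in> X\<close>. Modulo \<open>\<Lambda>\<^sup>kK\<close>, the space
  \<open>\<Lambda>\<^sup>k(X + P)\<close> is \<open>x1 \<and> \<Lambda>\<^bsup>k-1\<^esup>K\<close>; there \<open>\<Lambda>\<^sup>kP\<close> vanishes, while \<open>\<Lambda>\<^sup>kX\<close> and \<open>\<Lambda>\<^sup>kZ\<close> become
  \<open>\<Lambda>\<^bsup>k-1\<^esup>(X \<inter> K)\<close> and \<open>\<Lambda>\<^bsup>k-1\<^esup>(Z \<inter> K)\<close>, which meet only in 0.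
\<close>

lemma ext_gain_complement:
  assumes X: "fvs.subspace X" "X \<subseteq> std_space N" and Z: "fvs.subspace Z" "Z \<subseteq> std_space N"
    and P: "fvs.subspace P" "P \<subseteq> std_space N"
    and disj: "X \<inter> Z \<subseteq> {0}" "Z \<inter> P \<subseteq> {0}"
    and sub: "Z \<subseteq> fvs.span (X \<union> P)" and dim: "fvs.dim X = t" "fvs.dim Z = t" "t > 0"
    and A: "A \<subseteq> fvs.span (ext_power k X \<union> ext_power k P)" and k: "k \<ge> 2"
  shows "fvs.dim A + (t - 1 choose (k - 1)) \<le> fvs.dim (A \<union> ext_power k Z)"
proof -
  obtain E :: "(nat \<Rightarrow> 'a) set" where E: "finite E" "fvs.span E = std_space N" by (rule std_space_fg)
  obtain W :: "(nat set \<Rightarrow> 'a) set" where W: "finite W" "fvs.span W = ext_power k (std_space N)"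
    by (rule ext_power_std_fg)
  obtain BZ where BZ: "finite BZ" "BZ \<subseteq> Z" "fvs.independent BZ" "fvs.span BZ = Z" "card BZ = fvs.dim Z"
    by (rule subspace_basis[OF Z])
  obtain BP where BP: "finite BP" "BP \<subseteq> P" "fvs.independent BP" "fvs.span BP = P" "card BP = fvs.dim P"
    by (rule subspace_basis[OF P])
  have ZP: "fvs.independent (BZ \<union> BP)"
    by (rule fvs.independent_Un) (use BZ BP disj in simp_all)
  \<comment> \<open>Projection to \<open>X\<close> along \<open>P\<close>, well defined on each
    basis vector of \<open>Z\<close> once a decomposition has been chosen.\<close>
  have "\<exists>x\<in>X. z - x \<in> P" if "z \<in> BZ" for z
  proof -
    have "z \<in> fvs.span (X \<union> P)" using that BZ(2) sub by blast
    then obtain x p where "z = x + p" "x \<in> fvs.span X" "p \<in> fvs.span P" unfolding fvs.span_Un by blast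
    moreover have "fvs.span X = X" "fvs.span P = P" using X(1) P(1) by simp_all
    ultimately have "x \<in> X" "z - x \<in> P" by simp_all
    then show ?thesis by (intro bexI)
  qed
  then obtain f where f: "\<And>z. z \<in> BZ \<Longrightarrow> f z \<in> X" "\<And>z. z \<in> BZ \<Longrightarrow> z - f z \<in> P" by metis
  have z_in: "z \<in> fvs.span (insert (f z) BP)" if "z \<in> BZ" for z
  proof -
    have "z - f z \<in> fvs.span (insert (f z) BP)"
      using f(2)[OF that] fvs.span_mono[of BP "insert (f z) BP"] BP(4) by blast
    moreover have "f z \<in> fvs.span (insert (f z) BP)" by (intro fvs.span_base) simp
    ultimately have "(z - f z) + f z \<in> fvs.span (insert (f z) BP)" by (rule fvs.span_add)
    then show ?thesis by simp
  qed
  \<comment> \<open>\<open>F\<close> spans at least the dimension of the independent set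
    \<open>BZ \<union> BP\<close> and has no more elements. This one count yields independence of
    \<open>F\<close>, injectivity of \<open>f\<close> and disjointness of the two parts.\<close>
  define F where "F = f ` BZ \<union> BP"
  have finF: "finite F" using BZ BP by (simp add: F_def)
  have "BZ \<union> BP \<subseteq> fvs.span F"
  proof -
    have "BZ \<subseteq> fvs.span F"
    proof
      fix z assume z: "z \<in> BZ"
      have "insert (f z) BP \<subseteq> F" using z by (auto simp: F_def)
      then show "z \<in> fvs.span F" using z_in[OF z] fvs.span_mono by blast
    qed
    moreover have "BP \<subseteq> fvs.span F" by (auto simp: F_def intro: fvs.span_base)
    ultimately show ?thesis by simp
  qed
  then have "fvs.dim (BZ \<union> BP) \<le> fvs.dim F"
    by (intro fvs.dim_mono_fg[OF finF]) (auto intro: fvs.span_base)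
  moreover have "fvs.dim (BZ \<union> BP) = card (BZ \<union> BP)" by (rule fvs.dim_eq_card_independent[OF ZP])
  moreover have "card (BZ \<union> BP) = card BZ + card BP"
  proof (rule card_Un_disjoint[OF BZ(1) BP(1)])
    have "x = 0" if "x \<in> BZ" "x \<in> BP" for x using that BZ(2) BP(2) disj(2) by blast
    moreover have "0 \<notin> BZ" using BZ(3) fvs.dependent_zero by blast
    ultimately show "BZ \<inter> BP = {}" by blast
  qed
  ultimately have dimF: "card BZ + card BP \<le> fvs.dim F" by simp
  have c1: "card F \<le> card (f ` BZ) + card BP" unfolding F_def by (rule card_Un_le)
  have c2: "card (f ` BZ) \<le> card BZ" by (rule card_image_le[OF BZ(1)])
  have c3: "fvs.dim F \<le> card F" by (rule fvs.dim_le_card[OF fvs.span_superset finF])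
  have indF: "fvs.independent F" by (rule fvs.independent_if_card_le_dim[OF finF]) (use c1 c2 dimF in linarith)
  have cf: "card (f ` BZ) = card BZ" using c1 c2 c3 dimF by linarith
  then have inj: "inj_on f BZ" by (rule eq_card_imp_inj_on[OF BZ(1)])
  have "card (f ` BZ \<inter> BP) = 0"
    using card_Un_Int[OF finite_imageI[OF BZ(1), of f] BP(1)] c2 c3 dimF unfolding F_def by linarith
  then have disjF: "f ` BZ \<inter> BP = {}" using BZ(1) by simp
  have "BZ \<noteq> {}" using dim BZ by auto
  then obtain z1 where z1: "z1 \<in> BZ" by blast
  \<comment> \<open>The pair \<open>z1\<close>, \<open>x1\<close> is removed from the two bases.
    \<open>K\<close> is spanned by what remains, so it has codimension 1 in \<open>X + P\<close> and
    still contains \<open>P\<close>.\<close>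
  define x1 where "x1 = f z1"
  define Z' where "Z' = BZ - {z1}"
  define K where "K = fvs.span (f ` Z' \<union> BP)"
  have Ksub: "fvs.subspace K" by (simp add: K_def)
  have PK: "P \<subseteq> K" unfolding K_def BP(4)[symmetric] by (rule fvs.span_mono) blast
  have "f ` Z' \<union> BP \<subseteq> std_space N" using f(1) X(2) BP(2) P(2) by (auto simp: Z'_def)
  then have Kstd: "K \<subseteq> std_space N" unfolding K_def
    by (rule fvs.span_minimal[OF _ subspace_std_space])
  have x1K: "x1 \<notin> K"
  proof
    assume "x1 \<in> K"
    moreover have "f ` Z' \<union> BP \<subseteq> F - {x1}"
      using inj disjF z1 by (auto simp: F_def x1_def Z'_def inj_on_def)
    ultimately have "x1 \<in> fvs.span (F - {x1})" unfolding K_def using fvs.span_mono by blast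
    moreover have "x1 \<in> F" using z1 by (simp add: F_def x1_def)
    ultimately show False using indF unfolding fvs.dependent_def by blast
  qed
  have fX: "f ` BZ \<subseteq> X" using f by blast
  have indfZ: "fvs.independent (f ` BZ)" by (rule fvs.independent_mono[OF indF]) (simp add: F_def)
  have spX: "fvs.span (f ` BZ) = X"
  proof (rule fvs.subspace_eq_dim[OF E(1) _ fvs.subspace_span X(1)])
    show "X \<subseteq> fvs.span E" using X E by simp
    show "fvs.span (f ` BZ) \<subseteq> X" by (rule fvs.span_minimal[OF fX X(1)])
    show "fvs.dim X \<le> fvs.dim (fvs.span (f ` BZ))"
      using fvs.dim_span_eq_card_independent[OF indfZ] cf BZ(5) dim by simp
  qed
  have Z'K: "Z' \<subseteq> K"
  proof
    fix z assume z: "z \<in> Z'"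
    have "insert (f z) BP \<subseteq> f ` Z' \<union> BP" using z by blast
    then have "fvs.span (insert (f z) BP) \<subseteq> K" unfolding K_def by (rule fvs.span_mono)
    then show "z \<in> K" using z_in[of z] z by (auto simp: Z'_def)
  qed
  \<comment> \<open>Both halves lie in \<open>K\<close> and \<open>X \<inter> Z\<close> is trivial,
    so one basis of \<open>K\<close> contains a basis of a hyperplane of \<open>X\<close> and one of
    a hyperplane of \<open>Z\<close>.\<close>
  have ind': "fvs.independent (f ` Z' \<union> Z')"
  proof (rule fvs.independent_Un)
    show "finite Z'" using BZ(1) by (simp add: Z'_def)
    show "fvs.independent (f ` Z')" by (rule fvs.independent_mono[OF indfZ]) (auto simp: Z'_def)
    show "fvs.independent Z'" by (rule fvs.independent_mono[OF BZ(3)]) (auto simp: Z'_def)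
    have "fvs.span (f ` Z') \<subseteq> X" unfolding spX[symmetric] by (rule fvs.span_mono) (auto simp: Z'_def)
    moreover have "fvs.span Z' \<subseteq> Z" unfolding BZ(4)[symmetric] by (rule fvs.span_mono) (auto simp: Z'_def)
    ultimately show "fvs.span (f ` Z') \<inter> fvs.span Z' \<subseteq> {0}" using disj(1) by blast
  qed
  have f'K: "f ` Z' \<union> Z' \<subseteq> K" using Z'K by (auto simp: K_def intro: fvs.span_base)
  obtain BK where BK: "f ` Z' \<union> Z' \<subseteq> BK" "finite BK" "BK \<subseteq> K" "fvs.independent BK" "K \<subseteq> fvs.span BK"
    "card BK = fvs.dim K"
    by (rule fvs.extend_basis_fg[OF E(1) _ f'K ind']) (use Kstd E in simp)
  have spK: "fvs.span BK = K" by (rule subset_antisym[OF fvs.span_minimal[OF BK(3) Ksub] BK(5)])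
  define B where "B = insert x1 BK"
  have B: "finite B" "fvs.independent B"
    using BK x1K spK by (simp_all add: B_def fvs.independent_insertI)
  have Bstd: "B \<subseteq> std_space N"
    using BK(3) Kstd f(1)[OF z1] X(2) by (auto simp: B_def x1_def)
  \<comment> \<open>\<open>S\<close> indexes wedges spanning the exterior powers of \<open>K\<close>
    and \<open>X\<close>, hence also that of \<open>P\<close>. \<open>T\<close> indexes the new
    directions: \<open>x1\<close> wedged with \<open>k - 1\<close> basis vectors of \<open>Z\<close>
    lying in \<open>K\<close>.\<close>
  define S where "S = ksubsets k BK \<union> ksubsets k (f ` BZ)"
  define T where "T = insert x1 ` ksubsets (k - 1) Z'"
  have finZ': "finite Z'" using BZ(1) by (simp add: Z'_def)
  have x1Z': "x1 \<notin> BK" using x1K BK(3) by blast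
  have fB: "f ` BZ \<subseteq> B" using BK(1) by (auto simp: B_def x1_def Z'_def)
  have SB: "S \<subseteq> ksubsets k B" using fB unfolding S_def ksubsets_def B_def by blast
  have TB: "T \<subseteq> ksubsets k B"
  proof
    fix A assume "A \<in> T"
    then obtain A' where A': "A = insert x1 A'" "A' \<subseteq> Z'" "card A' = k - 1"
      by (auto simp: T_def ksubsets_def)
    have "finite A'" using A'(2) finZ' finite_subset by blast
    moreover have "x1 \<notin> A'" using A'(2) BK(1) x1Z' by blast
    ultimately have "card A = k" using A' k by simp
    moreover have "A \<subseteq> B" using A' BK(1) by (auto simp: B_def)
    ultimately show "A \<in> ksubsets k B" by (simp add: ksubsets_def)
  qed
  \<comment> \<open>A common set contains \<open>x1\<close>, so it does not lie in \<open>BK\<close>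
    and must lie in \<open>X\<close>. As \<open>k \<ge> 2\<close>, it also contains a vector of
    \<open>Z'\<close>, which would be a nonzero element of \<open>X \<inter> Z\<close>.\<close>
  have ST: "S \<inter> T = {}"
  proof -
    have False if AS: "A \<in> S" and AT: "A \<in> T" for A
    proof -
      obtain A' where A': "A = insert x1 A'" "A' \<subseteq> Z'" "card A' = k - 1"
        using AT by (auto simp: T_def ksubsets_def)
      have "A \<notin> ksubsets k BK" using A'(1) x1Z' by (auto simp: ksubsets_def)
      then have "A \<subseteq> f ` BZ" using AS by (auto simp: S_def ksubsets_def)
      moreover have "A' \<noteq> {}" using A'(3) k by auto
      ultimately obtain z where z: "z \<in> A'" "z \<in> f ` BZ" using A'(1) by blast
      then have "z \<in> BZ" "z \<in> X" using A'(2) fX by (auto simp: Z'_def)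
      then have "z = 0" using disj(1) BZ(2) by blast
      then show False using \<open>z \<in> BZ\<close> BZ(3) fvs.dependent_zero by blast
    qed
    then show ?thesis by blast
  qed
  have "inj_on (insert x1) (ksubsets (k - 1) Z')"
  proof (rule inj_onI)
    fix A A' assume "A \<in> ksubsets (k - 1) Z'" "A' \<in> ksubsets (k - 1) Z'" "insert x1 A = insert x1 A'"
    moreover have "x1 \<notin> Z'" using BK(1) x1Z' by blast
    ultimately show "A = A'" by (auto simp: ksubsets_def)
  qed
  then have "card T = card Z' choose (k - 1)" by (simp add: T_def card_image card_ksubsets finZ')
  then have cT: "card T = t - 1 choose (k - 1)" using z1 BZ dim by (simp add: Z'_def)
  have finST: "finite S" "finite T" using finite_subset[OF SB] finite_subset[OF TB] finite_ksubsets[OF B(1)] by auto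
  let ?WS = "wedge_set k ` S"
  have extK: "ext_power k K \<subseteq> fvs.span ?WS"
    using ext_power_span[OF BK(2), of k] unfolding spK by (simp add: S_def fvs.span_mono image_mono)
  have extX: "ext_power k X \<subseteq> fvs.span ?WS"
    using ext_power_span[OF finite_imageI[OF BZ(1)], of k f] unfolding spX
    by (simp add: S_def fvs.span_mono image_mono)
  have extP: "ext_power k P \<subseteq> fvs.span ?WS" using ext_power_mono[OF PK] extK by blast
  have "fvs.span (ext_power k X \<union> ext_power k P) \<subseteq> fvs.span ?WS"
    using extX extP by (intro fvs.span_minimal) (auto simp: fvs.subspace_span)
  then have AS: "A \<subseteq> fvs.span ?WS" using A by blast
  have Wstd: "wedge_set k ` ksubsets k B \<subseteq> ext_power k (std_space N)"
  proof -
    have "fvs.span B \<subseteq> std_space N" by (rule fvs.span_minimal[OF Bstd subspace_std_space])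
    then have "ext_power k (fvs.span B) \<subseteq> ext_power k (std_space N)" by (rule ext_power_mono)
    then show ?thesis unfolding ext_power_span[OF B(1)] using fvs.span_superset by blast
  qed
  have bigW: "?WS \<union> ext_power k Z \<subseteq> fvs.span W"
    using SB Wstd ext_power_mono[OF Z(2), of k] unfolding W by blast
  \<comment> \<open>Write \<open>x1 = z1 + (x1 - z1)\<close>: with factors from \<open>Z'\<close>,
    the first summand gives a wedge over \<open>Z\<close>, and the second, lying in \<open>P\<close>
    and so in \<open>K\<close>, gives one already spanned by \<open>S\<close>.\<close>
  have key: "wedge_set k ` T \<subseteq> fvs.span (?WS \<union> ext_power k Z)"
  proof
    fix w assume "w \<in> wedge_set k ` T"
    then obtain A' where A': "w = wedge_set k (insert x1 A')" "A' \<subseteq> Z'" "card A' = k - 1"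
      by (auto simp: T_def ksubsets_def)
    have "finite A'" using A'(2) finZ' finite_subset by blast
    then obtain v where v: "bij_betw v {0..<k - 1} A'" using ex_bij_betw_nat_finite A'(3) by metis
    have x1A': "x1 \<notin> A'" using A'(2) BK(1) x1Z' by blast
    have kk: "{0..<k} = insert (k - 1) {0..<k - 1}" using k by auto
    have vA: "v i \<in> A'" if "i < k" "i \<noteq> k - 1" for i
      using bij_betwE[OF v] that by simp
    have u: "bij_betw (v(k - 1 := x1)) {0..<k} (insert x1 A')"
      unfolding kk using v x1A' by (auto simp: bij_betw_def inj_on_def image_iff)
    have "wedge k (v(k - 1 := z1)) \<in> ext_power k Z"
      using vA A'(2) z1 BZ(2) by (intro wedge_in_ext_power) (auto simp: Z'_def)
    then have 1: "wedge k (v(k - 1 := z1)) \<in> fvs.span (?WS \<union> ext_power k Z)"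
      by (intro fvs.span_base) (rule UnI2)
    have "z1 - x1 \<in> P" using f(2)[OF z1] by (simp add: x1_def)
    then have xz: "x1 - z1 \<in> P" using fvs.subspace_neg[OF P(1)] by fastforce
    have "wedge k (v(k - 1 := x1 - z1)) \<in> ext_power k K"
      using vA A'(2) Z'K xz PK by (intro wedge_in_ext_power) auto
    then have "wedge k (v(k - 1 := x1 - z1)) \<in> fvs.span (?WS \<union> ext_power k Z)"
      using extK fvs.span_mono[of ?WS "?WS \<union> ext_power k Z"] by blast
    with 1 have "wedge k (v(k - 1 := z1)) + wedge k (v(k - 1 := x1 - z1)) \<in> fvs.span (?WS \<union> ext_power k Z)"
      by (rule fvs.span_add)
    moreover have "wedge k (v(k - 1 := z1 + (x1 - z1))) = wedge k (v(k - 1 := z1)) + wedge k (v(k - 1 := x1 - z1))"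
      using k by (intro wedge_update_add) simp
    moreover have "z1 + (x1 - z1) = x1" by simp
    ultimately have "wedge k (v(k - 1 := x1)) \<in> fvs.span (?WS \<union> ext_power k Z)" by (simp only:)
    then show "w \<in> fvs.span (?WS \<union> ext_power k Z)" unfolding A'(1) by (rule wedge_set_in_span[OF u])
  qed
  have dS: "fvs.dim ?WS = card S" using dim_span_wedge_set[OF B Bstd SB] by simp
  have "card (S \<union> T) = fvs.dim (fvs.span (wedge_set k ` (S \<union> T)))"
    using SB TB by (intro dim_span_wedge_set[OF B Bstd, symmetric]) simp
  also have "\<dots> \<le> fvs.dim (?WS \<union> ext_power k Z)"
  proof (rule fvs.dim_mono_fg[OF W(1) bigW])
    show "fvs.span (wedge_set k ` (S \<union> T)) \<subseteq> fvs.span (?WS \<union> ext_power k Z)"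
      unfolding image_Un using key by (intro fvs.span_minimal fvs.subspace_span) (auto intro: fvs.span_base)
  qed
  finally have "card S + card T \<le> fvs.dim (?WS \<union> ext_power k Z)"
    using finST ST by (simp add: card_Un_disjoint)
  moreover have "fvs.dim (?WS \<union> ext_power k Z) + fvs.dim A \<le> fvs.dim (A \<union> ext_power k Z) + fvs.dim ?WS"
    by (rule fvs.dim_submodular[OF W(1) bigW AS])
  ultimately show ?thesis using dS cT by linarith
qed

section \<open>Families of subspaces\<close>

definition grassmannian :: "nat \<Rightarrow> nat \<Rightarrow> (nat \<Rightarrow> 'a::field) set set" where
  "grassmannian N t = {H. fvs.subspace H \<and> H \<subseteq> std_space N \<and> fvs.dim H = t}"

definition span_rank :: "(nat \<Rightarrow> 'a::field) set set \<Rightarrow> nat" where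
  "span_rank \<H> = fvs.dim (\<Union>\<H>)"

definition ext_rank :: "nat \<Rightarrow> (nat \<Rightarrow> 'a::field) set set \<Rightarrow> nat" where
  "ext_rank k \<H> = fvs.dim (\<Union>H\<in>\<H>. ext_power k H)"

definition slack :: "nat \<Rightarrow> nat \<Rightarrow> (nat \<Rightarrow> 'a::field) set set \<Rightarrow> int" where
  "slack k t \<H> = int (t * ext_rank k \<H>) - int ((t choose k) * span_rank \<H>)"

section \<open>Binomial inequalities behind the growth of the slack\<close>

lemma Suc_times_choose_Suc: "Suc k * (n choose Suc k) = (n - k) * (n choose k)"
  by (metis binomial_absorb_comp binomial_absorption)

text \<open>Passing from \<open>k\<close> to \<open>k + 1\<close> multiplies the left side by
  \<open>d - k\<close> and the right side by \<open>t - k\<close>, apart from the common divisor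
  \<open>k + 1\<close>.\<close>

lemma choose_ratio_mono:
  fixes d t k :: nat
  assumes "d \<le> t" "2 \<le> k"
  shows "(d choose k) * (t choose 2) \<le> (t choose k) * (d choose 2)"
  using assms(2)
proof (induction k rule: dec_induct)
  case (step k)
  have "Suc k * ((d choose Suc k) * (t choose 2)) = (d - k) * ((d choose k) * (t choose 2))"
    using Suc_times_choose_Suc[of k d] by (metis mult.assoc)
  also have "\<dots> \<le> (t - k) * ((t choose k) * (d choose 2))"
    by (rule mult_le_mono[OF diff_le_mono[OF assms(1)] step.IH])
  also have "\<dots> = Suc k * ((t choose Suc k) * (d choose 2))"
    using Suc_times_choose_Suc[of k t] by (metis mult.assoc)
  finally show ?case by (simp only: mult_le_cancel1)
qed simp

text \<open>For \<open>0 < d < t\<close> the ratio of the binomials is at most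
  \<open>d (d - 1) / (t (t - 1))\<close>, hence at most \<open>(d - 1) / t\<close> because
  \<open>d \<le> t - 1\<close>. At \<open>d = 0\<close> and \<open>d = t\<close> there is equality,
  so the saved unit belongs to proper nonzero intersections.\<close>

lemma choose_gap:
  fixes d t k :: nat
  assumes "d \<le> t" "2 \<le> k"
  shows "t * (d choose k) \<le> (t choose k) * (if 0 < d \<and> d < t then d - 1 else d)"
proof (cases "0 < d \<and> d < t")
  case True
  have c2: "2 * (n choose 2) = n * (n - 1)" for n :: nat
    using binomial_absorption[of 1 n] by (simp add: numeral_2_eq_2)
  have "(t * (d choose k)) * (t - 1) = 2 * ((d choose k) * (t choose 2))" using c2[of t] by (simp add: mult_ac)
  also have "\<dots> \<le> 2 * ((t choose k) * (d choose 2))" using choose_ratio_mono[OF assms] by simp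
  also have "\<dots> = (t choose k) * (d * (d - 1))" using c2[of d] by (simp add: mult_ac)
  also have "\<dots> \<le> (t choose k) * ((t - 1) * (d - 1))" using True by (intro mult_mono) auto
  finally have "(t * (d choose k)) * (t - 1) \<le> ((t choose k) * (d - 1)) * (t - 1)" by (simp add: mult_ac)
  then have "t * (d choose k) \<le> (t choose k) * (d - 1)" using True by simp
  then show ?thesis using True by simp
next
  case False
  then show ?thesis using assms by (cases "d = 0") (auto simp: binomial_eq_0)
qed

section \<open>Ranks and slack of a growing family\<close>

lemma grassmannian_Union:
  assumes "\<H> \<subseteq> grassmannian N t"
  shows "\<Union>\<H> \<subseteq> std_space N" "(\<Union>H\<in>\<H>. ext_power k H) \<subseteq> ext_power k (std_space N)"
    "fvs.span (\<Union>\<H>) \<subseteq> std_space N" "(\<Union>H\<in>\<H>. ext_power k H) \<subseteq> ext_power k (fvs.span (\<Union>\<H>))"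
proof -
  show 1: "\<Union>\<H> \<subseteq> std_space N" using assms by (auto simp: grassmannian_def)
  show "fvs.span (\<Union>\<H>) \<subseteq> std_space N" by (rule fvs.span_minimal[OF 1 subspace_std_space])
  show "(\<Union>H\<in>\<H>. ext_power k H) \<subseteq> ext_power k (std_space N)"
    using assms by (intro UN_least ext_power_mono) (auto simp: grassmannian_def)
  show "(\<Union>H\<in>\<H>. ext_power k H) \<subseteq> ext_power k (fvs.span (\<Union>\<H>))"
    by (intro UN_least ext_power_mono) (auto intro: fvs.span_base)
qed

lemma dim_mono_std:
  assumes "V \<subseteq> fvs.span V'" "V' \<subseteq> std_space N"
  shows "fvs.dim V \<le> fvs.dim V'"
proof -
  obtain E :: "(nat \<Rightarrow> 'a) set" where E: "finite E" "fvs.span E = std_space N" by (rule std_space_fg)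
  show ?thesis by (rule fvs.dim_mono_fg[OF E(1) _ assms(1)]) (simp add: E assms(2))
qed

lemma span_rank_insert:
  assumes "\<H> \<subseteq> grassmannian N t" "H \<in> grassmannian N t"
  shows "span_rank (insert H \<H>) + fvs.dim (H \<inter> fvs.span (\<Union>\<H>)) = span_rank \<H> + t"
proof -
  obtain E :: "(nat \<Rightarrow> 'a) set" where E: "finite E" "fvs.span E = std_space N" by (rule std_space_fg)
  let ?U = "fvs.span (\<Union>\<H>)"
  have H: "fvs.subspace H" "H \<subseteq> std_space N" "fvs.dim H = t" using assms by (auto simp: grassmannian_def)
  have "fvs.span (H \<union> ?U) = fvs.span (\<Union>(insert H \<H>))"
    by (simp only: Union_insert fvs.span_Un fvs.span_span)
  then have "fvs.dim (H \<union> ?U) = span_rank (insert H \<H>)"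
    unfolding span_rank_def by (metis fvs.dim_span)
  moreover have "fvs.dim (H \<union> ?U) + fvs.dim (H \<inter> ?U) = fvs.dim H + fvs.dim ?U"
    using grassmannian_Union(3)[OF assms(1)] H
    by (intro fvs.dim_Un_Int[OF E(1)]) (simp_all add: E fvs.subspace_span)
  ultimately show ?thesis by (simp add: H span_rank_def)
qed

lemma ext_rank_insert:
  assumes "\<H> \<subseteq> grassmannian N t" "H \<in> grassmannian N t"
  shows "ext_rank k \<H> + (t choose k)
    \<le> ext_rank k (insert H \<H>) + (fvs.dim (H \<inter> fvs.span (\<Union>\<H>)) choose k)"
proof -
  have H: "fvs.subspace H" "H \<subseteq> std_space N" "fvs.dim H = t" using assms by (auto simp: grassmannian_def)
  show ?thesis
    using ext_gain[OF H(1,2) fvs.subspace_span grassmannian_Union(3)[OF assms(1)] grassmannian_Union(4)[OF assms(1), of k]]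
    unfolding ext_rank_def H(3) by (simp add: Un_commute)
qed

text \<open>The new member raises \<open>u\<close> by \<open>t - d\<close> and \<open>w\<close> by
  at least \<open>(t choose k) - (d choose k)\<close>. The slack thus grows by at least
  \<open>(t choose k) d - t (d choose k)\<close>, which \<open>choose_gap\<close> estimates.\<close>

lemma slack_insert:
  assumes "\<H> \<subseteq> grassmannian N t" "H \<in> grassmannian N t" "2 \<le> k"
    and d: "d = fvs.dim (H \<inter> fvs.span (\<Union>\<H>))"
  shows "slack k t (insert H \<H>) \<ge> slack k t \<H> + (if 0 < d \<and> d < t then int (t choose k) else 0)"
proof -
  have H: "fvs.subspace H" "H \<subseteq> std_space N" "fvs.dim H = t" using assms by (auto simp: grassmannian_def)
  have "d \<le> fvs.dim H" unfolding d by (rule dim_mono_std[OF _ H(2)]) (auto intro: fvs.span_base)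
  then have dt: "d \<le> t" by (simp add: H)
  have u: "span_rank (insert H \<H>) + d = span_rank \<H> + t" unfolding d by (rule span_rank_insert[OF assms(1,2)])
  have w: "ext_rank k \<H> + (t choose k) \<le> ext_rank k (insert H \<H>) + (d choose k)"
    unfolding d by (rule ext_rank_insert[OF assms(1,2)])
  from w have "t * (ext_rank k \<H> + (t choose k)) \<le> t * (ext_rank k (insert H \<H>) + (d choose k))"
    by (rule mult_le_mono2)
  then have w': "int t * ext_rank k \<H> + int t * int (t choose k)
      \<le> int t * ext_rank k (insert H \<H>) + int t * (d choose k)"
    by (simp add: algebra_simps flip: of_nat_mult of_nat_add)
  have u': "int (t choose k) * span_rank (insert H \<H>) + int (t choose k) * d
     = int (t choose k) * span_rank \<H> + int (t choose k) * t"
    using u by (metis distrib_left of_nat_add)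
  have "int t * int (d choose k) \<le> int (t choose k) * int (if 0 < d \<and> d < t then d - 1 else d)"
    using choose_gap[OF dt assms(3)] by (metis of_nat_le_iff of_nat_mult)
  also have "\<dots> = int (t choose k) * int d - (if 0 < d \<and> d < t then int (t choose k) else 0)"
    by (auto simp: of_nat_diff algebra_simps)
  finally show ?thesis using u' w' unfolding slack_def by (simp add: algebra_simps)
qed

lemma slack_mono:
  assumes "\<G> \<subseteq> \<H>" "finite \<H>" "\<H> \<subseteq> grassmannian N t" "2 \<le> k"
  shows "slack k t \<G> \<le> slack k t \<H>"
proof -
  have "slack k t \<G> \<le> slack k t (\<G> \<union> \<D>)" if "finite \<D>" "\<D> \<subseteq> \<H>" for \<D>
    using that
  proof (induction \<D> rule: finite_induct)
    case (insert H \<D>)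
    have "\<G> \<union> \<D> \<subseteq> grassmannian N t" "H \<in> grassmannian N t" using insert assms by auto
    from slack_insert[OF this assms(4) refl]
    have "slack k t (\<G> \<union> \<D>) \<le> slack k t (insert H (\<G> \<union> \<D>))" by (smt (verit) of_nat_0_le_iff)
    then show ?case using insert by simp
  qed simp
  from this[OF assms(2)] show ?thesis using assms(1) by (simp add: Un_absorb1)
qed

lemma slack_empty [simp]: "slack k t {} = 0"
  by (simp add: slack_def span_rank_def ext_rank_def fvs.dim_eq_card_independent[OF fvs.independent_empty])

lemma span_rank_le:
  assumes "finite \<H>" "\<H> \<subseteq> grassmannian N t"
  shows "span_rank \<H> \<le> t * card \<H>"
  using assms
proof (induction \<H> rule: finite_induct)
  case empty
  then show ?case by (simp add: span_rank_def fvs.dim_eq_card_independent[OF fvs.independent_empty])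
next
  case (insert H \<H>)
  then have "span_rank (insert H \<H>) \<le> span_rank \<H> + t" using span_rank_insert[of \<H> N t H] by auto
  then show ?case using insert by simp
qed

lemma dim_subset_0: "(V :: ('i \<Rightarrow> 'a::field) set) \<subseteq> {0} \<Longrightarrow> fvs.dim V = 0"
  using fvs.dim_le_card[of V "{}"] by simp

lemma subset_0_if_dim_0:
  assumes "V \<subseteq> std_space N" "fvs.dim V = 0"
  shows "V \<subseteq> {0}"
proof -
  obtain E :: "(nat \<Rightarrow> 'a) set" where E: "finite E" "fvs.span E = std_space N" by (rule std_space_fg)
  obtain B where B: "finite B" "V \<subseteq> fvs.span B" "card B = fvs.dim V"
    using fvs.finite_basis_fg[OF E(1), of V] assms(1) E(2) by metis
  then have "B = {}" using assms by simp
  then show ?thesis using B by simp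
qed

text \<open>Maximal rank leaves no room for loss: with \<open>H\<close> inserted last, any nonzero
  intersection would push the rank below \<open>t\<close> times the cardinality.\<close>

lemma independent_family_Int:
  assumes "finite \<H>" "\<H> \<subseteq> grassmannian N t" "H \<in> \<H>" "span_rank \<H> = t * card \<H>"
  shows "H \<inter> fvs.span (\<Union>(\<H> - {H})) \<subseteq> {0}"
proof -
  have g: "\<H> - {H} \<subseteq> grassmannian N t" "H \<in> grassmannian N t" using assms by auto
  have "span_rank (insert H (\<H> - {H})) + fvs.dim (H \<inter> fvs.span (\<Union>(\<H> - {H}))) = span_rank (\<H> - {H}) + t"
    by (rule span_rank_insert[OF g])
  moreover have "insert H (\<H> - {H}) = \<H>" using assms(3) by blast
  moreover have "span_rank (\<H> - {H}) \<le> t * card (\<H> - {H})" using assms g by (intro span_rank_le) auto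
  moreover have "card \<H> = Suc (card (\<H> - {H}))" using assms(1,3) by (metis card.remove)
  ultimately have "fvs.dim (H \<inter> fvs.span (\<Union>(\<H> - {H}))) = 0" using assms(4) by simp
  then show ?thesis by (rule subset_0_if_dim_0[rotated]) (use g(2) in \<open>auto simp: grassmannian_def\<close>)
qed

lemma slack_dependent:
  assumes "finite \<H>" "\<H> \<subseteq> grassmannian N t" "span_rank \<H> < t * card \<H>" "2 \<le> k" "k \<le> t"
  shows "int (t choose k) \<le> slack k t \<H>"
proof -
  define dep where "dep \<C> \<longleftrightarrow> \<C> \<subseteq> \<H> \<and> span_rank \<C> < t * card \<C>" for \<C>
  have "dep \<H>" using assms(3) by (simp add: dep_def)
  then obtain \<C> where dC: "dep \<C>" and least: "\<And>\<D>. dep \<D> \<Longrightarrow> card \<C> \<le> card \<D>"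
    using ex_has_least_nat[of dep \<H> card] by blast
  have C: "\<C> \<subseteq> \<H>" "finite \<C>" "\<C> \<subseteq> grassmannian N t" "span_rank \<C> < t * card \<C>"
    using dC assms(1,2) finite_subset[of \<C> \<H>] by (auto simp: dep_def)
  have proper: "span_rank \<D> = t * card \<D>" if "\<D> \<subset> \<C>" for \<D>
  proof -
    have "card \<D> < card \<C>" using that C(2) by (rule psubset_card_mono[rotated])
    then have "\<not> dep \<D>" using least by (meson linorder_not_less)
    moreover have "\<D> \<subseteq> \<H>" using that C(1) by blast
    ultimately have "t * card \<D> \<le> span_rank \<D>" by (simp add: dep_def)
    moreover have "span_rank \<D> \<le> t * card \<D>"
      using that C by (intro span_rank_le[of _ N]) (auto intro: finite_subset)
    ultimately show ?thesis by simp
  qed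
  have "\<C> \<noteq> {}" using C(4) by auto
  then obtain Z where Z: "Z \<in> \<C>" by blast
  define \<D> where "\<D> = \<C> - {Z}"
  have D: "\<D> \<subset> \<C>" "insert Z \<D> = \<C>" "\<D> \<subseteq> grassmannian N t" "finite \<D>" "Z \<notin> \<D>"
    using Z C by (auto simp: \<D>_def)
  have Zg: "Z \<in> grassmannian N t" using Z C by blast
  then have Zs: "fvs.subspace Z" "Z \<subseteq> std_space N" "fvs.dim Z = t" by (auto simp: grassmannian_def)
  define d where "d = fvs.dim (Z \<inter> fvs.span (\<Union>\<D>))"
  have ins: "slack k t \<C> \<ge> slack k t \<D> + (if 0 < d \<and> d < t then int (t choose k) else 0)"
    using slack_insert[OF D(3) Zg assms(4) d_def] D(2) by simp
  have pos: "0 \<le> slack k t \<D>" using slack_mono[of "{}" \<D> N t k] D assms(4) by simp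
  have rk: "span_rank \<C> + d = span_rank \<D> + t"
    using span_rank_insert[OF D(3) Zg] D(2) by (simp add: d_def)
  have cC: "card \<C> = Suc (card \<D>)" using D by (metis card_insert_disjoint)
  have "d > 0" using rk proper[OF D(1)] C(4) cC by simp
  have dt: "d \<le> t" unfolding d_def Zs(3)[symmetric]
    by (rule dim_mono_std[OF _ Zs(2)]) (auto intro: fvs.span_base)
  have slackC: "int (t choose k) \<le> slack k t \<C>"
  proof (cases "d < t")
    case True
    then show ?thesis using ins pos \<open>d > 0\<close> by simp
  next
    case False
    then have "d = t" using dt by simp
    have sub: "Z \<subseteq> fvs.span (\<Union>\<D>)"
    proof -
      obtain E :: "(nat \<Rightarrow> 'a) set" where E: "finite E" "fvs.span E = std_space N" by (rule std_space_fg)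
      have "Z \<inter> fvs.span (\<Union>\<D>) = Z"
        by (rule fvs.subspace_eq_dim[OF E(1)])
          (use Zs E \<open>d = t\<close> in \<open>auto simp: d_def fvs.subspace_inter fvs.subspace_span\<close>)
      then show ?thesis by blast
    qed
    have t0: "t > 0" using assms(4,5) by simp
    have "\<D> \<noteq> {}"
    proof
      assume "\<D> = {}"
      then have "d = 0" unfolding d_def by (intro dim_subset_0) simp
      then show False using \<open>d > 0\<close> by simp
    qed
    then obtain X where X: "X \<in> \<D>" by blast
    then have Xs: "fvs.subspace X" "X \<subseteq> std_space N" "fvs.dim X = t"
      using D(3) by (auto simp: grassmannian_def)
    define P where "P = fvs.span (\<Union>(\<D> - {X}))"
    have XZ: "X \<noteq> Z" using X D(5) by blast
    \<comment> \<open>A second member besides \<open>X\<close> makes \<open>{X, Z}\<close> a proper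
      subfamily of the minimal one, hence a direct sum. Otherwise \<open>Z\<close> would be
      contained in \<open>X\<close> and equal to it by dimension.\<close>
    have "\<D> - {X} \<noteq> {}"
    proof
      assume "\<D> - {X} = {}"
      then have "\<Union>\<D> = X" using X by blast
      then have "Z \<subseteq> X" using sub Xs(1) by (simp add: fvs.span_eq_iff[THEN iffD2])
      obtain E :: "(nat \<Rightarrow> 'a) set" where E: "finite E" "fvs.span E = std_space N" by (rule std_space_fg)
      have "Z = X" by (rule fvs.subspace_eq_dim[OF E(1)]) (use Zs Xs E \<open>Z \<subseteq> X\<close> in auto)
      then show False using XZ by simp
    qed
    then obtain Y where Y: "Y \<in> \<D>" "Y \<noteq> X" by blast
    have Y': "Y \<noteq> Z" "Y \<in> \<C>" "X \<in> \<C>" using Y X D(1,5) by auto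
    have "{X, Z} \<subset> \<C>" using Y Y' Z by blast
    moreover have "X \<in> grassmannian N t" using Y'(3) C(3) by blast
    ultimately have XZ0: "X \<inter> Z \<subseteq> {0}"
      using independent_family_Int[of "{X, Z}" N t X] proper[of "{X, Z}"] XZ Zg Zs(1)
      by (simp add: insert_Diff_if fvs.span_eq_iff[THEN iffD2])
    \<comment> \<open>Removing \<open>X\<close> also leaves a direct sum, so \<open>Z\<close> meets
      the span \<open>P\<close> of the other members trivially. These are the two disjointness
      conditions of \<open>ext_gain_complement\<close>.\<close>
    have "\<C> - {X} \<subset> \<C>" using Y' by blast
    then have "Z \<inter> fvs.span (\<Union>(\<C> - {X} - {Z})) \<subseteq> {0}"
      using C(2,3) Z XZ proper by (intro independent_family_Int[of "\<C> - {X}" N t Z]) auto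
    moreover have "\<C> - {X} - {Z} = \<D> - {X}" by (auto simp: \<D>_def)
    ultimately have ZP0: "Z \<inter> P \<subseteq> {0}" by (simp add: P_def)
    have Pstd: "P \<subseteq> std_space N" unfolding P_def
      by (rule grassmannian_Union(3)[of _ N t]) (use D(3) in blast)
    have "\<Union>\<D> \<subseteq> X \<union> P" unfolding P_def using fvs.span_superset[of "\<Union>(\<D> - {X})"] by blast
    then have sub': "Z \<subseteq> fvs.span (X \<union> P)" using sub fvs.span_mono by blast
    have A: "(\<Union>H\<in>\<D>. ext_power k H) \<subseteq> fvs.span (ext_power k X \<union> ext_power k P)"
    proof (rule UN_least)
      fix H assume "H \<in> \<D>"
      then have "ext_power k H \<subseteq> ext_power k X \<union> ext_power k P"
      proof (cases "H = X")
        case False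
        then have "H \<subseteq> P" using \<open>H \<in> \<D>\<close> unfolding P_def by (auto intro: fvs.span_base)
        then show ?thesis using ext_power_mono by blast
      qed simp
      then show "ext_power k H \<subseteq> fvs.span (ext_power k X \<union> ext_power k P)"
        using fvs.span_superset by blast
    qed
    have "ext_rank k \<D> + (t - 1 choose (k - 1)) \<le> fvs.dim ((\<Union>H\<in>\<D>. ext_power k H) \<union> ext_power k Z)"
      unfolding ext_rank_def
      by (rule ext_gain_complement[OF Xs(1,2) Zs(1,2) _ Pstd XZ0 ZP0 sub' Xs(3) Zs(3) t0 A assms(4)])
        (simp add: P_def fvs.subspace_span)
    also have "\<dots> = ext_rank k \<C>" unfolding ext_rank_def D(2)[symmetric] by (simp add: Un_commute)
    finally have w: "ext_rank k \<D> + (t - 1 choose (k - 1)) \<le> ext_rank k \<C>" .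
    \<comment> \<open>The absorption identity shows that \<open>(t - 1) choose (k - 1)\<close> new
      dimensions, multiplied by \<open>t\<close>, pay for a full \<open>t choose k\<close> of
      slack.\<close>
    have "(t choose k) \<le> k * (t choose k)" using assms(4) by simp
    also have "\<dots> = t * (t - 1 choose (k - 1))"
      using binomial_absorption[of "k - 1" t] assms(4) by simp
    finally have "(t choose k) \<le> t * (t - 1 choose (k - 1))" .
    moreover have "t * (ext_rank k \<D> + (t - 1 choose (k - 1))) \<le> t * ext_rank k \<C>"
      using w by (rule mult_le_mono2)
    ultimately have "t * ext_rank k \<D> + (t choose k) \<le> t * ext_rank k \<C>" by (simp add: distrib_left)
    moreover have "span_rank \<C> = span_rank \<D>" using rk \<open>d = t\<close> by simp
    ultimately have "slack k t \<D> + int (t choose k) \<le> slack k t \<C>"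
      unfolding slack_def by (simp flip: of_nat_mult of_nat_add)
    then show ?thesis using pos by simp
  qed
  also have "slack k t \<C> \<le> slack k t \<H>" by (rule slack_mono[OF C(1) assms(1,2,4)])
  finally show ?thesis .
qed

lemma ext_rank_dependent:
  assumes "finite \<H>" "\<H> \<subseteq> grassmannian N t" "span_rank \<H> < t * card \<H>" "2 \<le> k" "k \<le> t"
  shows "(t choose k) * (span_rank \<H> + 1) \<le> t * ext_rank k \<H>"
proof -
  have "int ((t choose k) * (span_rank \<H> + 1)) \<le> int (t * ext_rank k \<H>)"
    using slack_dependent[OF assms] unfolding slack_def by (simp add: algebra_simps)
  then show ?thesis by (simp only: of_nat_le_iff)
qed

text \<open>When the rank is maximal, nonnegativity of the slack is already the sharp bound matching
  \<open>ext_rank_le\<close>; no basis of the direct sum has to be constructed.\<close>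

lemma ext_rank_independent:
  assumes "finite \<H>" "\<H> \<subseteq> grassmannian N t" "span_rank \<H> = t * card \<H>" "2 \<le> k" "k \<le> t"
  shows "ext_rank k \<H> \<ge> (t choose k) * card \<H>"
proof -
  have "0 \<le> slack k t \<H>" using slack_mono[of "{}" \<H> N t k] assms by simp
  then have "(t choose k) * (t * card \<H>) \<le> t * ext_rank k \<H>" unfolding slack_def assms(3) by linarith
  then have "t * ((t choose k) * card \<H>) \<le> t * ext_rank k \<H>" by (simp add: mult_ac)
  moreover have "t > 0" using assms(4,5) by simp
  ultimately show ?thesis by simp
qed

lemma ext_rank_le:
  assumes "finite \<H>" "\<H> \<subseteq> grassmannian N t"
  shows "ext_rank k \<H> \<le> (t choose k) * card \<H>"
  using assms
proof (induction \<H> rule: finite_induct)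
  case empty
  then show ?case by (simp add: ext_rank_def fvs.dim_eq_card_independent[OF fvs.independent_empty])
next
  case (insert H \<H>)
  obtain W :: "(nat set \<Rightarrow> 'a) set" where W: "finite W" "fvs.span W = ext_power k (std_space N)"
    by (rule ext_power_std_fg)
  have H: "fvs.subspace H" "H \<subseteq> std_space N" "fvs.dim H = t" using insert.prems by (auto simp: grassmannian_def)
  have "ext_rank k (insert H \<H>) \<le> fvs.dim (ext_power k H) + ext_rank k \<H>"
    unfolding ext_rank_def UN_insert
    using grassmannian_Union(2)[of \<H> N t k] insert.prems ext_power_mono[OF H(2), of k]
    by (intro fvs.dim_Un_le[OF W(1)]) (auto simp: W)
  then show ?case using insert dim_ext_power[OF H(1,2), of k] H(3) by simp
qed

section \<open>Counting subspaces and homomorphisms\<close>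

lemma card_span_independent:
  assumes "finite B" "fvs.independent (B :: ('i \<Rightarrow> 'a::{field,finite}) set)"
  shows "finite (fvs.span B) \<and> card (fvs.span B) = CARD('a) ^ card B"
  using assms
proof (induction B rule: finite_induct)
  case (insert b B)
  then have ind: "fvs.independent B" and b: "b \<notin> fvs.span B"
    using fvs.independent_insert[of b B] by auto
  have fin: "finite (fvs.span B)" and c: "card (fvs.span B) = CARD('a) ^ card B"
    using insert.IH[OF ind] by simp_all
  let ?f = "\<lambda>(c, x). fscale c b + x"
  have im: "fvs.span (insert b B) = ?f ` (UNIV \<times> fvs.span B)"
  proof (intro equalityI subsetI)
    fix x assume "x \<in> fvs.span (insert b B)"
    then obtain c where "x - fscale c b \<in> fvs.span B" unfolding fvs.span_insert by blast
    then show "x \<in> ?f ` (UNIV \<times> fvs.span B)"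
      by (intro image_eqI[of _ _ "(c, x - fscale c b)"]) auto
  next
    fix x assume "x \<in> ?f ` (UNIV \<times> fvs.span B)"
    then obtain c y where "x = fscale c b + y" "y \<in> fvs.span B" by auto
    then show "x \<in> fvs.span (insert b B)" unfolding fvs.span_insert by (auto intro!: exI[of _ c])
  qed
  have inj: "inj_on ?f (UNIV \<times> fvs.span B)"
  proof (rule inj_onI, clarify)
    fix c x c' x' assume x: "x \<in> fvs.span B" "x' \<in> fvs.span B" and e: "fscale c b + x = fscale c' b + x'"
    have "fscale (c - c') b = x' - x" using e by (simp add: fvs.scale_left_diff_distrib algebra_simps)
    then have s: "fscale (c - c') b \<in> fvs.span B" using x by (simp add: fvs.span_diff)
    have "c = c'"
    proof (rule ccontr)
      assume "c \<noteq> c'"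
      then have "fscale (inverse (c - c')) (fscale (c - c') b) = b" by (simp add: fvs.scale_scale)
      then show False using b fvs.span_scale[OF s] by metis
    qed
    then show "c = c' \<and> x = x'" using e by simp
  qed
  show ?case unfolding im using inj fin c insert.hyps
    by (auto simp: card_image card_cartesian_product)
qed (simp add: card_gt_0_iff)

lemma card_subspace_fg:
  assumes "finite W" "S \<subseteq> fvs.span W" "fvs.subspace (S :: ('i \<Rightarrow> 'a::{field,finite}) set)"
  shows "finite S" "card S = CARD('a) ^ fvs.dim S"
proof -
  obtain B where B: "finite B" "B \<subseteq> S" "fvs.independent B" "S \<subseteq> fvs.span B" "card B = fvs.dim S"
    by (rule fvs.finite_basis_fg[OF assms(1,2)])
  have "fvs.span B = S" by (rule subset_antisym[OF fvs.span_minimal[OF B(2) assms(3)] B(4)])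
  then show "finite S" "card S = CARD('a) ^ fvs.dim S"
    using card_span_independent[OF B(1,3)] B(5) by simp_all
qed

lemma card_subspace:
  assumes "fvs.subspace (S :: (nat \<Rightarrow> 'a::{field,finite}) set)" "S \<subseteq> std_space N"
  shows "finite S" "card S = CARD('a) ^ fvs.dim S"
proof -
  obtain E :: "(nat \<Rightarrow> 'a) set" where E: "finite E" "fvs.span E = std_space N" by (rule std_space_fg)
  show "finite S" "card S = CARD('a) ^ fvs.dim S"
    using card_subspace_fg[OF E(1) _ assms(1)] assms(2) E by auto
qed

section \<open>Ordered bases and Gaussian binomial counts\<close>

definition frames :: "(nat \<Rightarrow> 'a::field) set \<Rightarrow> nat \<Rightarrow> (nat \<Rightarrow> 'a) list set" where
  "frames S t = {xs. length xs = t \<and> distinct xs \<and> fvs.independent (set xs) \<and> set xs \<subseteq> S}"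

lemma card_frames:
  assumes "fvs.subspace (S :: (nat \<Rightarrow> 'a::{field,finite}) set)" "S \<subseteq> std_space N"
  shows "finite (frames S t) \<and> card (frames S t) = (\<Prod>i<t. CARD('a) ^ fvs.dim S - CARD('a) ^ i)"
proof (induction t)
  case 0
  have "frames S 0 = {[]}" by (auto simp: frames_def fvs.independent_empty)
  then show ?case by simp
next
  case (Suc t)
  note finS = card_subspace(1)[OF assms] and cS = card_subspace(2)[OF assms]
  let ?f = "\<lambda>(xs, x). x # xs"
  let ?D = "SIGMA xs : frames S t. S - fvs.span (set xs)"
  have im: "frames S (Suc t) = ?f ` ?D"
  proof (intro equalityI subsetI)
    fix ys assume ys: "ys \<in> frames S (Suc t)"
    then obtain x xs where "ys = x # xs" by (cases ys) (auto simp: frames_def)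
    with ys show "ys \<in> ?f ` ?D"
      using fvs.independent_insert[of x "set xs"]
      by (intro image_eqI[of _ _ "(xs, x)"]) (auto simp: frames_def)
  next
    fix ys assume "ys \<in> ?f ` ?D"
    then obtain x xs where "ys = x # xs" "xs \<in> frames S t" "x \<in> S" "x \<notin> fvs.span (set xs)" by auto
    then show "ys \<in> frames S (Suc t)"
      using fvs.span_base[of x "set xs"] by (auto simp: frames_def fvs.independent_insertI)
  qed
  have inj: "inj_on ?f ?D" by (auto simp: inj_on_def)
  have c: "card (S - fvs.span (set xs)) = CARD('a) ^ fvs.dim S - CARD('a) ^ t" if "xs \<in> frames S t" for xs
  proof -
    have xs: "fvs.independent (set xs)" "card (set xs) = t" "set xs \<subseteq> S"
      using that by (auto simp: frames_def distinct_card)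
    have "fvs.span (set xs) \<subseteq> S" by (rule fvs.span_minimal[OF xs(3) assms(1)])
    then show ?thesis
      using card_span_independent[OF _ xs(1)] xs(2) by (simp add: card_Diff_subset cS)
  qed
  have "card (frames S (Suc t)) = card ?D" unfolding im by (rule card_image[OF inj])
  also have "\<dots> = (\<Sum>xs\<in>frames S t. card (S - fvs.span (set xs)))"
    using Suc finS by (intro card_SigmaI) auto
  also have "\<dots> = (\<Sum>xs\<in>frames S t. CARD('a) ^ fvs.dim S - CARD('a) ^ t)"
    by (rule sum.cong[OF refl c])
  also have "\<dots> = (\<Prod>i<Suc t. CARD('a) ^ fvs.dim S - CARD('a) ^ i)" using Suc by simp
  finally show ?case unfolding im using Suc finS by simp
qed

lemma finite_grassmannian: "finite (grassmannian N t :: (nat \<Rightarrow> 'a::{field,finite}) set set)"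
proof (rule finite_subset)
  show "(grassmannian N t :: (nat \<Rightarrow> 'a) set set) \<subseteq> Pow (std_space N)"
    by (auto simp: grassmannian_def)
  show "finite (Pow (std_space N :: (nat \<Rightarrow> 'a) set))"
    using card_subspace(1)[OF subspace_std_space subset_refl] by simp
qed

lemma frames_span:
  assumes "fvs.subspace S" "S \<subseteq> std_space N" "xs \<in> frames S t"
  shows "fvs.span (set xs) \<in> grassmannian N t" "fvs.span (set xs) \<subseteq> S"
proof -
  have xs: "fvs.independent (set xs)" "card (set xs) = t" "set xs \<subseteq> S"
    using assms by (auto simp: frames_def distinct_card)
  show 1: "fvs.span (set xs) \<subseteq> S" by (rule fvs.span_minimal[OF xs(3) assms(1)])
  have "fvs.dim (fvs.span (set xs)) = t" using fvs.dim_span_eq_card_independent[OF xs(1)] xs(2) by simp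
  then show "fvs.span (set xs) \<in> grassmannian N t"
    using 1 assms(2) fvs.subspace_span[of "set xs"] unfolding grassmannian_def by blast
qed

lemma span_frame:
  assumes "H \<in> grassmannian N t" "xs \<in> frames H t"
  shows "fvs.span (set xs) = H"
proof -
  have H: "fvs.subspace H" "H \<subseteq> std_space N" "fvs.dim H = t" using assms by (auto simp: grassmannian_def)
  obtain E :: "(nat \<Rightarrow> 'a) set" where E: "finite E" "fvs.span E = std_space N" by (rule std_space_fg)
  note f = frames_span[OF H(1,2) assms(2)]
  show ?thesis
    by (rule fvs.subspace_eq_dim[OF E(1) _ _ H(1) f(2)])
      (use E H f(1) in \<open>auto simp: grassmannian_def fvs.subspace_span\<close>)
qed

lemma dim_std_space: "fvs.dim (std_space N :: (nat \<Rightarrow> 'a::field) set) = N"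
  by (simp add: dim_coord_space)

text \<open>The Gaussian binomial without division: the independent \<open>t\<close>-tuples of the
  whole space are partitioned by their span, and each \<open>t\<close>-space receives exactly its
  ordered bases.\<close>

lemma card_grassmannian:
  "card (grassmannian N t :: (nat \<Rightarrow> 'a::{field,finite}) set set) * (\<Prod>i<t. CARD('a) ^ t - CARD('a) ^ i)
    = (\<Prod>i<t. CARD('a) ^ N - CARD('a) ^ i)"
proof -
  let ?G = "grassmannian N t :: (nat \<Rightarrow> 'a) set set"
  let ?V = "std_space N :: (nat \<Rightarrow> 'a) set"
  have un: "frames ?V t = (\<Union>H\<in>?G. frames H t)"
  proof (intro equalityI subsetI)
    fix xs assume xs: "xs \<in> frames ?V t"
    have "xs \<in> frames (fvs.span (set xs)) t" using xs fvs.span_superset by (auto simp: frames_def)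
    then show "xs \<in> (\<Union>H\<in>?G. frames H t)"
      using frames_span(1)[OF subspace_std_space subset_refl xs] by blast
  next
    fix xs assume "xs \<in> (\<Union>H\<in>?G. frames H t)"
    then show "xs \<in> frames ?V t" by (auto simp: frames_def grassmannian_def)
  qed
  have cH: "finite (frames H t) \<and> card (frames H t) = (\<Prod>i<t. CARD('a) ^ t - CARD('a) ^ i)" if "H \<in> ?G" for H
  proof -
    have H: "fvs.subspace H" "H \<subseteq> std_space N" "fvs.dim H = t" using that by (auto simp: grassmannian_def)
    show ?thesis using card_frames[OF H(1,2), of t] H(3) by simp
  qed
  have "card (frames ?V t) = (\<Sum>H\<in>?G. card (frames H t))"
    unfolding un
  proof (rule card_UN_disjoint[OF finite_grassmannian])
    show "\<forall>H\<in>?G. finite (frames H t)" using cH by blast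
    show "\<forall>H\<in>?G. \<forall>H'\<in>?G. H \<noteq> H' \<longrightarrow> frames H t \<inter> frames H' t = {}"
      using span_frame by blast
  qed
  also have "\<dots> = (\<Sum>H\<in>?G. (\<Prod>i<t. CARD('a) ^ t - CARD('a) ^ i))"
    by (rule sum.cong[OF refl]) (use cH in blast)
  finally show ?thesis
    using card_frames[OF subspace_std_space subset_refl, of N t, where 'a='a] by (simp add: dim_std_space)
qed

lemma exists_frame:
  assumes "H \<in> grassmannian N t"
  shows "\<exists>xs. xs \<in> frames H t"
proof -
  have H: "fvs.subspace H" "H \<subseteq> std_space N" "fvs.dim H = t" using assms by (auto simp: grassmannian_def)
  obtain B where B: "finite B" "B \<subseteq> H" "fvs.independent B" "fvs.span B = H" "card B = fvs.dim H"
    by (rule subspace_basis[OF H(1,2)])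
  obtain xs where "set xs = B" "distinct xs" using finite_distinct_list[OF B(1)] by blast
  then have "xs \<in> frames H t" using B H by (auto simp: frames_def distinct_card[symmetric])
  then show ?thesis ..
qed

text \<open>A subspace is recovered from one ordered basis, which is a \<open>t\<close>-tuple of
  elements of \<open>U\<close>. The loss is harmless: \<open>u\<close> and \<open>t\<close> will be
  of order \<open>r\<close>, so all such factors are of the form q^(O(r^2)).\<close>

lemma card_subspaces_within_le:
  assumes "U \<in> grassmannian N u"
  shows "card {H \<in> grassmannian N t. H \<subseteq> (U :: (nat \<Rightarrow> 'a::{field,finite}) set)} \<le> CARD('a) ^ (u * t)"
proof -
  have U: "fvs.subspace U" "U \<subseteq> std_space N" "fvs.dim U = u" using assms by (auto simp: grassmannian_def)
  note cU = card_subspace[OF U(1,2)]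
  have "{H \<in> grassmannian N t. H \<subseteq> U} \<subseteq> (\<lambda>xs. fvs.span (set xs)) ` {xs. set xs \<subseteq> U \<and> length xs = t}"
  proof
    fix H assume H: "H \<in> {H \<in> grassmannian N t. H \<subseteq> U}"
    then obtain xs where xs: "xs \<in> frames H t" using exists_frame by blast
    then have "H = fvs.span (set xs)" using span_frame H by blast
    then show "H \<in> (\<lambda>xs. fvs.span (set xs)) ` {xs. set xs \<subseteq> U \<and> length xs = t}"
      using xs H by (intro image_eqI[of _ _ xs]) (auto simp: frames_def)
  qed
  then have "card {H \<in> grassmannian N t. H \<subseteq> U} \<le> card ((\<lambda>xs. fvs.span (set xs)) ` {xs. set xs \<subseteq> U \<and> length xs = t})"
    by (rule card_mono[rotated]) (simp add: finite_lists_length_eq cU)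
  also have "\<dots> \<le> card {xs. set xs \<subseteq> U \<and> length xs = t}"
    by (rule card_image_le) (simp add: finite_lists_length_eq cU)
  also have "\<dots> = CARD('a) ^ (u * t)"
    using card_lists_length_eq[OF cU(1), of t] cU(2) U(3) by (simp add: power_mult)
  finally show ?thesis .
qed

lemma card_field_ge_2: "2 \<le> CARD('a::{field,finite})"
proof -
  have "card {0, 1 :: 'a} \<le> CARD('a)" by (rule card_mono) auto
  then show ?thesis by simp
qed

text \<open>Since \<open>q \<ge> 2\<close>, each factor \<open>q^u - q^i\<close> is at least
  \<open>q^(u-1)\<close>. The resulting loss of one power of \<open>q\<close> per factor is the
  summand \<open>+ u\<close>.\<close>

lemma card_grassmannian_le:
  assumes "u \<le> N"
  shows "card (grassmannian N u :: (nat \<Rightarrow> 'a::{field,finite}) set set) \<le> CARD('a) ^ (u * (N - u) + u)"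
proof -
  let ?q = "CARD('a)" and ?g = "card (grassmannian N u :: (nat \<Rightarrow> 'a) set set)"
  have q: "2 \<le> ?q" by (rule card_field_ge_2)
  have "?q ^ (u - 1) \<le> ?q ^ u - ?q ^ i" if "i < u" for i
  proof -
    have "?q ^ i \<le> ?q ^ (u - 1)" using that q by (intro power_increasing) auto
    moreover have "2 * ?q ^ (u - 1) \<le> ?q * ?q ^ (u - 1)" using q by (rule mult_le_mono1)
    moreover have "?q * ?q ^ (u - 1) = ?q ^ u" using that by (metis Suc_diff_1 less_nat_zero_code neq0_conv power_Suc)
    ultimately show ?thesis by linarith
  qed
  then have "(\<Prod>i<u. ?q ^ (u - 1)) \<le> (\<Prod>i<u. ?q ^ u - ?q ^ i)" by (intro prod_mono) auto
  then have "?g * ?q ^ ((u - 1) * u) \<le> ?g * (\<Prod>i<u. ?q ^ u - ?q ^ i)"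
    by (intro mult_le_mono2) (simp add: power_mult)
  also have "\<dots> = (\<Prod>i<u. ?q ^ N - ?q ^ i)" by (rule card_grassmannian)
  also have "\<dots> \<le> (\<Prod>i<u. ?q ^ N)" by (intro prod_mono) auto
  also have "\<dots> = ?q ^ (u * (N - u) + u) * ?q ^ ((u - 1) * u)"
  proof -
    obtain d where "N = u + d" using assms le_Suc_ex by blast
    then have "N * u = (u * (N - u) + u) + (u - 1) * u" by (cases u) (simp_all add: algebra_simps)
    then show ?thesis by (simp flip: power_mult power_add)
  qed
  finally show ?thesis using q by simp
qed

text \<open>Each quotient of corresponding factors in the Gaussian binomial is at least
  \<open>q^(N-u)\<close>.\<close>

lemma card_grassmannian_ge:
  assumes "u \<le> N"
  shows "CARD('a) ^ (u * (N - u)) \<le> card (grassmannian N u :: (nat \<Rightarrow> 'a::{field,finite}) set set)"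
proof -
  let ?q = "CARD('a)" and ?g = "card (grassmannian N u :: (nat \<Rightarrow> 'a) set set)"
  have q: "2 \<le> ?q" by (rule card_field_ge_2)
  have "?q ^ (N - u) * (?q ^ u - ?q ^ i) \<le> ?q ^ N - ?q ^ i" for i
  proof -
    have "?q ^ (N - u) * (?q ^ u - ?q ^ i) = ?q ^ N - ?q ^ (N - u) * ?q ^ i"
      using assms by (simp add: diff_mult_distrib2 flip: power_add)
    moreover have "?q ^ i \<le> ?q ^ (N - u) * ?q ^ i" using q mult_le_mono1[of 1 "?q ^ (N - u)" "?q ^ i"] by simp
    ultimately show ?thesis using diff_le_mono2 by metis
  qed
  then have "(\<Prod>i<u. ?q ^ (N - u) * (?q ^ u - ?q ^ i)) \<le> (\<Prod>i<u. ?q ^ N - ?q ^ i)" by (intro prod_mono) auto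
  then have "?q ^ (u * (N - u)) * (\<Prod>i<u. ?q ^ u - ?q ^ i) \<le> ?g * (\<Prod>i<u. ?q ^ u - ?q ^ i)"
    by (simp add: prod.distrib card_grassmannian power_mult mult.commute[of u])
  moreover have "0 < (\<Prod>i<u. ?q ^ u - ?q ^ i)" using q by (intro prod_pos) (auto intro: power_strict_increasing)
  ultimately show ?thesis by simp
qed

text \<open>First the span of the family is chosen among the \<open>u\<close>-spaces, then
  \<open>s\<close> members inside it. Only the first choice involves \<open>N\<close> and yields the
  decisive exponent.\<close>

lemma card_families_le:
  assumes "u \<le> N"
  shows "card {\<H>. \<H> \<subseteq> (grassmannian N t :: (nat \<Rightarrow> 'a::{field,finite}) set set) \<and> card \<H> = s \<and> span_rank \<H> = u}
    \<le> CARD('a) ^ (u * (N - u) + u + u * t * s)"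
proof -
  let ?Gt = "grassmannian N t :: (nat \<Rightarrow> 'a) set set" and ?Gu = "grassmannian N u :: (nat \<Rightarrow> 'a) set set"
  let ?in = "\<lambda>U. {H \<in> ?Gt. H \<subseteq> U}"
  have sub: "{\<H>. \<H> \<subseteq> ?Gt \<and> card \<H> = s \<and> span_rank \<H> = u} \<subseteq> (\<Union>U\<in>?Gu. {\<H>. \<H> \<subseteq> ?in U \<and> card \<H> = s})"
  proof
    fix \<H> assume H: "\<H> \<in> {\<H>. \<H> \<subseteq> ?Gt \<and> card \<H> = s \<and> span_rank \<H> = u}"
    have "fvs.span (\<Union>\<H>) \<in> ?Gu"
      using H grassmannian_Union(3)[of \<H> N t] by (auto simp: grassmannian_def span_rank_def fvs.subspace_span)
    moreover have "\<H> \<subseteq> ?in (fvs.span (\<Union>\<H>))" using H fvs.span_superset[of "\<Union>\<H>"] by blast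
    ultimately show "\<H> \<in> (\<Union>U\<in>?Gu. {\<H>. \<H> \<subseteq> ?in U \<and> card \<H> = s})" using H by blast
  qed
  have fin: "finite (?in U)" for U
    by (rule finite_subset[OF _ finite_grassmannian[of N t]]) blast
  have "card {\<H>. \<H> \<subseteq> ?in U \<and> card \<H> = s} \<le> CARD('a) ^ (u * t * s)" if "U \<in> ?Gu" for U
  proof (cases "s \<le> card (?in U)")
    case True
    have "card {\<H>. \<H> \<subseteq> ?in U \<and> card \<H> = s} = card (?in U) choose s" by (rule n_subsets[OF fin])
    also have "\<dots> \<le> card (?in U) ^ s" by (rule binomial_le_pow[OF True])
    also have "\<dots> \<le> (CARD('a) ^ (u * t)) ^ s" by (intro power_mono card_subspaces_within_le[OF that]) simp
    finally show ?thesis by (simp add: power_mult)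
  next
    case False
    then have "{\<H>. \<H> \<subseteq> ?in U \<and> card \<H> = s} = {}" using card_mono[OF fin] by auto
    then show ?thesis by (simp only: card.empty)
  qed
  then have "card (\<Union>U\<in>?Gu. {\<H>. \<H> \<subseteq> ?in U \<and> card \<H> = s}) \<le> card ?Gu * CARD('a) ^ (u * t * s)"
    by (intro order_trans[OF card_UN_le] sum_bounded_above[where K = "CARD('a) ^ (u * t * s)", THEN order_trans])
      (auto simp: finite_grassmannian)
  also have "\<dots> \<le> CARD('a) ^ (u * (N - u) + u) * CARD('a) ^ (u * t * s)"
    by (intro mult_le_mono1 card_grassmannian_le assms)
  finally have "card (\<Union>U\<in>?Gu. {\<H>. \<H> \<subseteq> ?in U \<and> card \<H> = s}) \<le> CARD('a) ^ (u * (N - u) + u + u * t * s)"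
    by (simp add: power_add)
  moreover have "finite (\<Union>U\<in>?Gu. {\<H>. \<H> \<subseteq> ?in U \<and> card \<H> = s})"
    by (intro finite_UN_I finite_grassmannian) (auto intro: finite_subset[OF _ finite_Pow_iff[THEN iffD2, OF fin]])
  ultimately show ?thesis using card_mono[OF _ sub] by linarith
qed

text \<open>Stated as a product because the truncated subtraction of exponents is awkward.\<close>

lemma card_Hom_vanishing:
  fixes W :: "(nat set \<Rightarrow> 'a::{field,finite}) set"
  assumes "W \<subseteq> ext_power k (std_space N)"
  shows "finite (Hom_ext k N m :: ((nat set \<Rightarrow> 'a) \<Rightarrow> nat \<Rightarrow> 'a) set)"
    "card {\<Theta> \<in> Hom_ext k N m. \<forall>x\<in>W. \<Theta> x = 0} * CARD('a) ^ (m * fvs.dim W)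
      = CARD('a) ^ (m * fvs.dim (ext_power k (std_space N) :: (nat set \<Rightarrow> 'a) set))"
proof -
  let ?E = "ext_power k (std_space N) :: (nat set \<Rightarrow> 'a) set"
  let ?F = "std_space m :: (nat \<Rightarrow> 'a) set"
  interpret p: vector_space_pair "fscale :: 'a \<Rightarrow> (nat set \<Rightarrow> 'a) \<Rightarrow> _" "fscale :: 'a \<Rightarrow> (nat \<Rightarrow> 'a) \<Rightarrow> _" ..
  obtain E :: "(nat set \<Rightarrow> 'a) set" where E: "finite E" "fvs.span E = ?E" by (rule ext_power_std_fg)
  note finE = card_subspace_fg(1)[OF E(1) _ subspace_ext_power, of k "std_space N", unfolded E(2), OF subset_refl]
  have finF: "finite ?F" and cF: "card ?F = CARD('a) ^ m"
    using card_subspace[OF subspace_std_space subset_refl, of m, where 'a='a] by (simp_all add: dim_std_space)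
  show "finite (Hom_ext k N m :: ((nat set \<Rightarrow> 'a) \<Rightarrow> nat \<Rightarrow> 'a) set)"
    by (rule finite_subset[OF _ finite_PiE[OF finE, of "\<lambda>_. ?F"]]) (auto simp: Hom_ext_def finF)
  have WE: "W \<subseteq> fvs.span E" using assms E by simp
  obtain B where B: "finite B" "B \<subseteq> W" "fvs.independent B" "W \<subseteq> fvs.span B" "card B = fvs.dim W"
    by (rule fvs.finite_basis_fg[OF E(1) WE])
  have EE: "?E \<subseteq> fvs.span E" using E by simp
  have BE: "B \<subseteq> ?E" using B assms by blast
  obtain B' where B': "B \<subseteq> B'" "finite B'" "B' \<subseteq> ?E" "fvs.independent B'" "?E \<subseteq> fvs.span B'" "card B' = fvs.dim ?E"
    by (rule fvs.extend_basis_fg[OF E(1) EE BE B(3)])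
  \<comment> \<open>A basis \<open>B\<close> of the span of \<open>W\<close> is completed to
    \<open>B'\<close>. Homomorphisms killing \<open>W\<close> correspond to arbitrary values on
    \<open>C\<close>, extended by 0 on \<open>B\<close>.\<close>
  define C where "C = B' - B"
  let ?K = "{\<Theta> \<in> Hom_ext k N m. \<forall>x\<in>W. \<Theta> x = 0}"
  have inj: "inj_on (\<lambda>\<Theta>. restrict \<Theta> C) ?K"
  proof (rule inj_onI)
    fix \<Theta>1 \<Theta>2 assume T: "\<Theta>1 \<in> ?K" "\<Theta>2 \<in> ?K" and e: "restrict \<Theta>1 C = restrict \<Theta>2 C"
    have "fvs.subspace {x \<in> ?E. \<Theta>1 x = \<Theta>2 x}"
    proof (rule fvs.subspaceI)
      have "0 \<in> ?E" using subspace_ext_power fvs.subspace_0 by blast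
      moreover have "\<Theta> 0 = 0" if "\<Theta> \<in> ?K" for \<Theta>
      proof -
        have "\<Theta> (fscale 0 0) = fscale 0 (\<Theta> 0)" using that \<open>0 \<in> ?E\<close> unfolding Hom_ext_def by blast
        then show ?thesis by simp
      qed
      ultimately show "0 \<in> {x \<in> ?E. \<Theta>1 x = \<Theta>2 x}" using T by simp
    next
      fix x y assume "x \<in> {x \<in> ?E. \<Theta>1 x = \<Theta>2 x}" "y \<in> {x \<in> ?E. \<Theta>1 x = \<Theta>2 x}"
      then show "x + y \<in> {x \<in> ?E. \<Theta>1 x = \<Theta>2 x}"
        using T fvs.subspace_add[OF subspace_ext_power] by (auto simp: Hom_ext_def)
    next
      fix c x assume "x \<in> {x \<in> ?E. \<Theta>1 x = \<Theta>2 x}"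
      then show "fscale c x \<in> {x \<in> ?E. \<Theta>1 x = \<Theta>2 x}"
        using T fvs.subspace_scale[OF subspace_ext_power] by (auto simp: Hom_ext_def)
    qed
    moreover have "B' \<subseteq> {x \<in> ?E. \<Theta>1 x = \<Theta>2 x}"
    proof
      fix x assume x: "x \<in> B'"
      have "\<Theta>1 x = \<Theta>2 x"
      proof (cases "x \<in> B")
        case True
        then show ?thesis using T B(2) by auto
      next
        case False
        then show ?thesis using x fun_cong[OF e, of x] by (simp add: C_def)
      qed
      then show "x \<in> {x \<in> ?E. \<Theta>1 x = \<Theta>2 x}" using x B'(3) by blast
    qed
    ultimately have "fvs.span B' \<subseteq> {x \<in> ?E. \<Theta>1 x = \<Theta>2 x}" by (rule fvs.span_minimal[rotated])
    then have "\<Theta>1 x = \<Theta>2 x" if "x \<in> ?E" for x using that B'(5) by blast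
    moreover have "\<Theta>1 \<in> ?E \<rightarrow>\<^sub>E ?F" "\<Theta>2 \<in> ?E \<rightarrow>\<^sub>E ?F" using T by (auto simp: Hom_ext_def)
    ultimately show "\<Theta>1 = \<Theta>2" by (intro PiE_ext[of _ ?E]) auto
  qed
  have im: "(\<lambda>\<Theta>. restrict \<Theta> C) ` ?K = C \<rightarrow>\<^sub>E ?F"
  proof (rule subset_antisym)
    show "(\<lambda>\<Theta>. restrict \<Theta> C) ` ?K \<subseteq> C \<rightarrow>\<^sub>E ?F"
      using B'(3) by (auto simp: Hom_ext_def C_def)
    show "C \<rightarrow>\<^sub>E ?F \<subseteq> (\<lambda>\<Theta>. restrict \<Theta> C) ` ?K"
    proof
      fix g assume g: "g \<in> C \<rightarrow>\<^sub>E ?F"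
      obtain h where h: "Vector_Spaces.linear fscale fscale h" "\<And>x. x \<in> B' \<Longrightarrow> h x = (if x \<in> C then g x else 0)"
        using p.linear_independent_extend[OF B'(4), of "\<lambda>x. if x \<in> C then g x else 0"] by blast
      interpret h: Vector_Spaces.linear fscale fscale h by (rule h(1))
      have hF: "h x \<in> ?F" if "x \<in> ?E" for x
      proof -
        have "fvs.subspace {x. h x \<in> ?F}"
          by (rule fvs.subspaceI)
            (simp_all add: h.add h.scale fvs.subspace_0 fvs.subspace_add fvs.subspace_scale subspace_std_space)
        moreover have "B' \<subseteq> {x. h x \<in> ?F}"
          using h(2) PiE_mem[OF g] fvs.subspace_0[OF subspace_std_space[of m, where 'a='a]] by auto
        ultimately have "fvs.span B' \<subseteq> {x. h x \<in> ?F}" by (rule fvs.span_minimal[rotated])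
        then show ?thesis using that B'(5) by blast
      qed
      have hW: "h x = 0" if "x \<in> W" for x
      proof (rule h.eq_0_on_span)
        show "x \<in> fvs.span B" using that B(4) by blast
        show "h b = 0" if "b \<in> B" for b using that B'(1) h(2) by (auto simp: C_def)
      qed
      have "restrict h ?E \<in> ?K"
        using hF hW assms fvs.subspace_add[OF subspace_ext_power[of k "std_space N :: (nat \<Rightarrow> 'a) set"]]
          fvs.subspace_scale[OF subspace_ext_power[of k "std_space N :: (nat \<Rightarrow> 'a) set"]]
        by (auto simp: Hom_ext_def h.add h.scale)
      moreover have "restrict (restrict h ?E) C = g"
      proof
        fix x
        show "restrict (restrict h ?E) C x = g x"
          using h(2)[of x] B'(3) PiE_arb[OF g, of x] by (cases "x \<in> C") (auto simp: C_def)
      qed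
      ultimately show "g \<in> (\<lambda>\<Theta>. restrict \<Theta> C) ` ?K" by (intro image_eqI) auto
    qed
  qed
  have finC: "finite C" using B'(2) by (simp add: C_def)
  have "card ?K = card (C \<rightarrow>\<^sub>E ?F)" using card_image[OF inj] im by simp
  also have "\<dots> = CARD('a) ^ (m * card C)" by (simp add: card_PiE finC cF power_mult)
  finally have "card ?K = CARD('a) ^ (m * card C)" .
  moreover have "card C + card B = card B'"
    using B'(1,2) B(1) by (simp add: C_def card_Diff_subset card_mono)
  ultimately show "card ?K * CARD('a) ^ (m * fvs.dim W) = CARD('a) ^ (m * fvs.dim ?E)"
    using B(5) B'(6) by (metis distrib_left power_add)
qed

section \<open>Moments of the number of null subspaces\<close>

lemma Hom_ext_nonempty:
  "finite (Hom_ext k N m :: ((nat set \<Rightarrow> 'a::{field,finite}) \<Rightarrow> nat \<Rightarrow> 'a) set)"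
  "(Hom_ext k N m :: ((nat set \<Rightarrow> 'a) \<Rightarrow> nat \<Rightarrow> 'a) set) \<noteq> {}"
proof -
  show "finite (Hom_ext k N m :: ((nat set \<Rightarrow> 'a) \<Rightarrow> nat \<Rightarrow> 'a) set)"
    by (rule card_Hom_vanishing(1)[of "{}"]) simp
  show "(Hom_ext k N m :: ((nat set \<Rightarrow> 'a) \<Rightarrow> nat \<Rightarrow> 'a) set) \<noteq> {}"
    using card_Hom_vanishing(2)[of "{} :: (nat set \<Rightarrow> 'a) set" k N m] by auto
qed

lemma prob_vanishing:
  fixes W :: "(nat set \<Rightarrow> 'a::{field,finite}) set"
  assumes "W \<subseteq> ext_power k (std_space N)"
  shows "measure_pmf.prob (random_hom k N m) {\<Theta>. \<forall>x\<in>W. \<Theta> x = 0} = 1 / real CARD('a) ^ (m * fvs.dim W)"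
proof -
  let ?Hom = "Hom_ext k N m :: ((nat set \<Rightarrow> 'a) \<Rightarrow> nat \<Rightarrow> 'a) set"
  let ?D = "m * fvs.dim (ext_power k (std_space N) :: (nat set \<Rightarrow> 'a) set)"
  have q: "real CARD('a) > 0" by (simp add: card_gt_0_iff)
  have "real (card {\<Theta> \<in> ?Hom. \<forall>x\<in>W. \<Theta> x = 0}) * real CARD('a) ^ (m * fvs.dim W) = real CARD('a) ^ ?D"
    using card_Hom_vanishing(2)[OF assms, of m] by (simp flip: of_nat_mult of_nat_power)
  moreover have "real (card ?Hom) = real CARD('a) ^ ?D"
  proof -
    have "fvs.dim ({} :: (nat set \<Rightarrow> 'a) set) = 0"
      using fvs.dim_eq_card_independent[OF fvs.independent_empty] by simp
    then have "card ?Hom = CARD('a) ^ ?D"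
      using card_Hom_vanishing(2)[of "{} :: (nat set \<Rightarrow> 'a) set" k N m] by simp
    then show ?thesis by simp
  qed
  moreover have "?Hom \<inter> {\<Theta>. \<forall>x\<in>W. \<Theta> x = 0} = {\<Theta> \<in> ?Hom. \<forall>x\<in>W. \<Theta> x = 0}" by blast
  ultimately show ?thesis
    unfolding random_hom_def measure_pmf_of_set[OF Hom_ext_nonempty(2,1)]
    using q by (simp add: field_simps)
qed

lemma null_subspaces_dim:
  "{H \<in> null_subspaces k N \<Theta>. fvs.dim H = t} = {H \<in> grassmannian N t. \<forall>x\<in>ext_power k H. \<Theta> x = 0}"
  by (auto simp: null_subspaces_def grassmannian_def)

text \<open>The binomial coefficient counts \<open>s\<close>-subsets of the null subspaces.
  Unordered families avoid coincidences, and all members of one are null exactly if the sum of their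
  exterior powers is killed.\<close>

lemma expectation_null_count_choose:
  "measure_pmf.expectation (random_hom k N m :: ((nat set \<Rightarrow> 'a::{field,finite}) \<Rightarrow> nat \<Rightarrow> 'a) pmf)
      (\<lambda>\<Theta>. real (null_count k N t \<Theta> choose s))
    = (\<Sum>\<H>\<in>ksubsets s (grassmannian N t :: (nat \<Rightarrow> 'a) set set). 1 / real CARD('a) ^ (m * ext_rank k \<H>))"
proof -
  let ?Hom = "Hom_ext k N m :: ((nat set \<Rightarrow> 'a) \<Rightarrow> nat \<Rightarrow> 'a) set"
  let ?G = "grassmannian N t :: (nat \<Rightarrow> 'a) set set"
  let ?W = "\<lambda>\<H>. \<Union>H\<in>\<H>. ext_power k H :: (nat set \<Rightarrow> 'a) set"
  let ?I = "\<lambda>\<H> \<Theta>. indicator {\<Theta>. \<forall>x\<in>?W \<H>. \<Theta> x = (0 :: nat \<Rightarrow> 'a)} \<Theta> :: real"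
  note finG = finite_grassmannian[of N t, where 'a='a]
  have fink: "finite (ksubsets s ?G)" by (rule finite_ksubsets[OF finG])
  have c: "real (null_count k N t \<Theta> choose s) = (\<Sum>\<H>\<in>ksubsets s ?G. ?I \<H> \<Theta>)" for \<Theta>
  proof -
    let ?NS = "{H \<in> ?G. \<forall>x\<in>ext_power k H. \<Theta> x = 0}"
    have "null_count k N t \<Theta> choose s = card (ksubsets s ?NS)"
      unfolding null_count_def null_subspaces_dim using finG by (simp add: card_ksubsets)
    also have "ksubsets s ?NS = ksubsets s ?G \<inter> {\<H>. \<forall>x\<in>?W \<H>. \<Theta> x = 0}"
      by (auto simp: ksubsets_def)
    also have "real (card \<dots>) = (\<Sum>\<H>\<in>ksubsets s ?G. indicator {\<H>. \<forall>x\<in>?W \<H>. \<Theta> x = 0} \<H>)"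
      using fink by (simp add: indicator_def sum.If_cases)
    also have "\<dots> = (\<Sum>\<H>\<in>ksubsets s ?G. ?I \<H> \<Theta>)" by (intro sum.cong) (auto simp: indicator_def)
    finally show ?thesis .
  qed
  have W: "?W \<H> \<subseteq> ext_power k (std_space N)" if "\<H> \<in> ksubsets s ?G" for \<H>
    using that grassmannian_Union(2)[of \<H> N t k] by (auto simp: ksubsets_def)
  have "measure_pmf.expectation (random_hom k N m :: ((nat set \<Rightarrow> 'a) \<Rightarrow> nat \<Rightarrow> 'a) pmf)
      (\<lambda>\<Theta>. real (null_count k N t \<Theta> choose s))
    = (\<Sum>\<Theta>\<in>?Hom. real (null_count k N t \<Theta> choose s)) / card ?Hom"
    unfolding random_hom_def by (rule integral_pmf_of_set[OF Hom_ext_nonempty(2,1)])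
  also have "\<dots> = (\<Sum>\<Theta>\<in>?Hom. \<Sum>\<H>\<in>ksubsets s ?G. ?I \<H> \<Theta>) / card ?Hom"
    by (simp only: c)
  also have "\<dots> = (\<Sum>\<H>\<in>ksubsets s ?G. (\<Sum>\<Theta>\<in>?Hom. ?I \<H> \<Theta>) / card ?Hom)"
    by (subst sum.swap) (simp add: sum_divide_distrib)
  also have "\<dots> = (\<Sum>\<H>\<in>ksubsets s ?G. measure_pmf.prob (random_hom k N m) {\<Theta>. \<forall>x\<in>?W \<H>. \<Theta> x = 0})"
    unfolding random_hom_def measure_pmf_of_set[OF Hom_ext_nonempty(2,1)]
    using Hom_ext_nonempty(1)[of k N m, where 'a='a] by (simp add: indicator_def sum.If_cases)
  also have "\<dots> = (\<Sum>\<H>\<in>ksubsets s ?G. 1 / real CARD('a) ^ (m * ext_rank k \<H>))"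
    unfolding ext_rank_def by (rule sum.cong[OF refl prob_vanishing[OF W]])
  finally show ?thesis .
qed

lemma expectation_null_count:
  "measure_pmf.expectation (random_hom k N m :: ((nat set \<Rightarrow> 'a::{field,finite}) \<Rightarrow> nat \<Rightarrow> 'a) pmf)
      (\<lambda>\<Theta>. real (null_count k N t \<Theta>))
    = real (card (grassmannian N t :: (nat \<Rightarrow> 'a) set set)) / real CARD('a) ^ (m * (t choose k))"
proof -
  let ?G = "grassmannian N t :: (nat \<Rightarrow> 'a) set set"
  have "ksubsets 1 ?G = (\<lambda>H. {H}) ` ?G" by (auto simp: ksubsets_def card_1_singleton_iff)
  then have "(\<Sum>\<H>\<in>ksubsets 1 ?G. 1 / real CARD('a) ^ (m * ext_rank k \<H>))
      = (\<Sum>H\<in>?G. 1 / real CARD('a) ^ (m * ext_rank k {H}))"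
    by (simp add: sum.reindex)
  also have "\<dots> = (\<Sum>H\<in>?G. 1 / real CARD('a) ^ (m * (t choose k)))"
    by (intro sum.cong refl) (auto simp: ext_rank_def grassmannian_def dim_ext_power)
  finally show ?thesis using expectation_null_count_choose[of k N m t 1, where 'a='a] by simp
qed

text \<open>The parameter \<open>\<rho>\<close> equals \<open>c\<close> for \<open>t = r\<close>; it is kept general since \<open>t = r - 1\<close> is needed as well.\<close>

lemma factorial_moment_bounds:
  fixes \<rho> :: real and k N m t s :: nat
  assumes k: "2 \<le> k" "k \<le> t" and \<rho>: "real t * \<rho> = real m * real (t choose k)"
  defines "g \<equiv> card (grassmannian N t :: (nat \<Rightarrow> 'a::{field,finite}) set set)"
  defines "E \<equiv> measure_pmf.expectation (random_hom k N m :: ((nat set \<Rightarrow> 'a) \<Rightarrow> nat \<Rightarrow> 'a) pmf)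
      (\<lambda>\<Theta>. real (null_count k N t \<Theta> choose s))"
  shows "real (g choose s) / real CARD('a) ^ (m * (t choose k) * s) \<le> E"
    and "E \<le> real (g choose s) / real CARD('a) ^ (m * (t choose k) * s) +
      (\<Sum>u\<in>{u. u < t * s \<and> u \<le> N}. real CARD('a) powr (real (u * (N - u) + u + u * t * s) - \<rho> * (real u + 1)))"
proof -
  let ?q = "real CARD('a)"
  let ?G = "grassmannian N t :: (nat \<Rightarrow> 'a) set set"
  let ?w = "\<lambda>\<H>. 1 / ?q ^ (m * ext_rank k \<H>)"
  let ?wz = "1 / ?q ^ (m * (t choose k) * s)"
  have q: "?q > 1" using card_field_ge_2[where 'a='a] by simp
  note finG = finite_grassmannian[of N t, where 'a='a]
  define K where "K = ksubsets s ?G"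
  have finK: "finite K" unfolding K_def by (rule finite_ksubsets[OF finG])
  have KD: "\<H> \<subseteq> ?G" "card \<H> = s" "finite \<H>" if "\<H> \<in> K" for \<H>
    using that finG by (auto simp: K_def ksubsets_def finite_subset)
  have cK: "card K = g choose s" unfolding K_def g_def by (rule card_ksubsets[OF finG])
  have E: "E = (\<Sum>\<H>\<in>K. ?w \<H>)" unfolding E_def K_def by (rule expectation_null_count_choose)
  have wge: "?wz \<le> ?w \<H>" if "\<H> \<in> K" for \<H>
  proof -
    have "m * ext_rank k \<H> \<le> m * ((t choose k) * s)"
      using ext_rank_le[OF KD(3,1)[OF that], of k] KD(2)[OF that] by simp
    then have "?q ^ (m * ext_rank k \<H>) \<le> ?q ^ (m * ((t choose k) * s))"
      using q by (intro power_increasing) auto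
    then show ?thesis using q by (intro divide_left_mono) (auto simp: mult.assoc)
  qed
  have sum0: "(\<Sum>\<H>\<in>K. ?wz) = real (g choose s) * ?wz" by (simp add: cK)
  show "real (g choose s) / ?q ^ (m * (t choose k) * s) \<le> E"
    using sum_mono[of K "\<lambda>_. ?wz" ?w] wge sum0 unfolding E by simp
  define D where "D = {\<H> \<in> K. span_rank \<H> < t * s}"
  let ?U = "{u. u < t * s \<and> u \<le> N}"
  have KDw: "?w \<H> \<le> ?wz" if "\<H> \<in> K - D" for \<H>
  proof -
    have H: "\<H> \<in> K" "\<not> span_rank \<H> < t * s" using that by (auto simp: D_def)
    then have "span_rank \<H> = t * card \<H>" using span_rank_le[OF KD(3,1)[OF H(1)]] KD(2)[OF H(1)] by simp
    then have "(t choose k) * s \<le> ext_rank k \<H>"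
      using ext_rank_independent[OF KD(3,1)[OF H(1)] _ k] KD(2)[OF H(1)] by simp
    then have "?q ^ (m * ((t choose k) * s)) \<le> ?q ^ (m * ext_rank k \<H>)"
      using q by (intro power_increasing) auto
    then show ?thesis using q by (intro divide_left_mono) (auto simp: mult.assoc)
  qed
  have "E = (\<Sum>\<H>\<in>K - D. ?w \<H>) + (\<Sum>\<H>\<in>D. ?w \<H>)"
    unfolding E using finK by (subst sum.subset_diff[of D K]) (auto simp: D_def)
  also have "(\<Sum>\<H>\<in>K - D. ?w \<H>) \<le> (\<Sum>\<H>\<in>K - D. ?wz)" by (rule sum_mono[OF KDw])
  \<comment> \<open>Dependent families are added back with the weight of independent ones. The lower
    bound also runs over all of \<open>K\<close>, so both bounds share the main term
    \<open>g choose s\<close> and independent families need no separate count.\<close>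
  also have "\<dots> \<le> (\<Sum>\<H>\<in>K. ?wz)" using finK by (intro sum_mono2) auto
  also note sum0
  also have "(\<Sum>\<H>\<in>D. ?w \<H>) \<le> (\<Sum>u\<in>?U. ?q powr (real (u * (N - u) + u + u * t * s) - \<rho> * (real u + 1)))"
  proof -
    have rkN: "span_rank \<H> \<le> N" if "\<H> \<in> K" for \<H>
    proof -
      have "span_rank \<H> \<le> fvs.dim (std_space N :: (nat \<Rightarrow> 'a) set)" unfolding span_rank_def
        by (rule dim_mono_std[OF _ subset_refl]) (use grassmannian_Union(1)[OF KD(1)[OF that]] fvs.span_superset in blast)
      then show ?thesis by (simp add: dim_std_space)
    qed
    let ?F = "\<lambda>u. {\<H> \<in> K. span_rank \<H> = u}"
    have w: "?w \<H> \<le> ?q powr (- (\<rho> * (real u + 1)))" if "u \<in> ?U" "\<H> \<in> ?F u" for u \<H>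
    proof -
      have H: "\<H> \<in> K" "span_rank \<H> = u" "u < t * s" using that by auto
      \<comment> \<open>Multiplied by \<open>m\<close> and divided by \<open>t\<close>, this becomes
        the exponent \<open>\<rho> (u + 1)\<close> by the choice of \<open>\<rho>\<close>.\<close>
      have "(t choose k) * (u + 1) \<le> t * ext_rank k \<H>"
        using ext_rank_dependent[OF KD(3,1)[OF H(1)] _ k] KD(2)[OF H(1)] H by simp
      then have "m * ((t choose k) * (u + 1)) \<le> m * (t * ext_rank k \<H>)" by (rule mult_le_mono2)
      then have "real (m * ((t choose k) * (u + 1))) \<le> real (m * (t * ext_rank k \<H>))"
        by (simp only: of_nat_le_iff)
      then have "real m * real (t choose k) * (real u + 1) \<le> real t * (real m * ext_rank k \<H>)"
        by (simp add: algebra_simps)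
      then have "real t * (\<rho> * (real u + 1)) \<le> real t * (real m * ext_rank k \<H>)"
        by (simp add: \<rho> flip: mult.assoc)
      then have "\<rho> * (real u + 1) \<le> real (m * ext_rank k \<H>)" using k by simp
      then have "?q powr (- real (m * ext_rank k \<H>)) \<le> ?q powr (- (\<rho> * (real u + 1)))"
        using q by (intro powr_mono) auto
      moreover have "?q powr (- real n) = 1 / ?q ^ n" for n
        using q by (simp add: powr_minus powr_realpow divide_inverse)
      ultimately show ?thesis by metis
    qed
    have "D = (\<Union>u\<in>?U. ?F u)" using rkN by (auto simp: D_def)
    then have "(\<Sum>\<H>\<in>D. ?w \<H>) = (\<Sum>u\<in>?U. \<Sum>\<H>\<in>?F u. ?w \<H>)"
      using finK by (simp only:) (intro sum.UNION_disjoint, auto)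
    also have "\<dots> \<le> (\<Sum>u\<in>?U. ?q powr (real (u * (N - u) + u + u * t * s) - \<rho> * (real u + 1)))"
    proof (rule sum_mono)
      fix u assume u: "u \<in> ?U"
      have "(\<Sum>\<H>\<in>?F u. ?w \<H>) \<le> (\<Sum>\<H>\<in>?F u. ?q powr (- (\<rho> * (real u + 1))))"
        by (rule sum_mono[OF w[OF u]])
      also have "\<dots> = real (card (?F u)) * ?q powr (- (\<rho> * (real u + 1)))" by simp
      also have "card (?F u) \<le> CARD('a) ^ (u * (N - u) + u + u * t * s)"
        using card_families_le[of u N t s, where 'a='a] u by (simp add: K_def ksubsets_def conj_assoc)
      then have "real (card (?F u)) * ?q powr (- (\<rho> * (real u + 1)))
          \<le> ?q ^ (u * (N - u) + u + u * t * s) * ?q powr (- (\<rho> * (real u + 1)))"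
        by (intro mult_right_mono) (simp_all flip: of_nat_power)
      also have "\<dots> = ?q powr (real (u * (N - u) + u + u * t * s) - \<rho> * (real u + 1))"
        using q by (simp add: powr_realpow[symmetric] powr_add[symmetric])
      finally show "(\<Sum>\<H>\<in>?F u. ?w \<H>) \<le> ?q powr (real (u * (N - u) + u + u * t * s) - \<rho> * (real u + 1))" .
    qed
    finally show ?thesis .
  qed
  finally show "E \<le> real (g choose s) / ?q ^ (m * (t choose k) * s) +
      (\<Sum>u\<in>?U. ?q powr (real (u * (N - u) + u + u * t * s) - \<rho> * (real u + 1)))"
    by simp
qed

text \<open>Subspaces of null subspaces are null, so the dimensions that occur have no gaps. The
  condition \<open>1 \<le> k\<close> makes \<open>{0}\<close> null, and the maximum is taken over a
  nonempty set.\<close>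

lemma max_null_dim_ge_iff:
  assumes "\<Theta> \<in> Hom_ext k N m" "1 \<le> k"
  shows "t \<le> max_null_dim k N (\<Theta> :: (nat set \<Rightarrow> 'a::{field,finite}) \<Rightarrow> nat \<Rightarrow> 'a) \<longleftrightarrow> 1 \<le> null_count k N t \<Theta>"
proof -
  let ?NS = "null_subspaces k N \<Theta>"
  have "?NS \<subseteq> Pow (std_space N)" by (auto simp: null_subspaces_def)
  moreover have "finite (Pow (std_space N :: (nat \<Rightarrow> 'a) set))"
    using card_subspace(1)[OF subspace_std_space subset_refl] by simp
  ultimately have fin: "finite ?NS" by (rule finite_subset)
  have "{0} \<in> ?NS"
  proof -
    have "wedge k v = (0 :: nat set \<Rightarrow> 'a)" if "\<forall>i<k. v i \<in> {0}" for v
    proof -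
      have "wedge k v = wedge k (v(0 := 0))" by (rule wedge_cong) (use that in auto)
      then show ?thesis using wedge_update_zero[of 0 k v] assms(2) by simp
    qed
    then have "ext_power k {0 :: nat \<Rightarrow> 'a} \<subseteq> {0}"
      unfolding ext_power_def by (intro fvs.span_minimal) auto
    moreover have "\<Theta> 0 = 0"
    proof -
      have "0 \<in> ext_power k (std_space N :: (nat \<Rightarrow> 'a) set)" using subspace_ext_power fvs.subspace_0 by blast
      then have "\<Theta> (fscale 0 0) = fscale 0 (\<Theta> 0)" using assms(1) unfolding Hom_ext_def by blast
      then show ?thesis by simp
    qed
    ultimately show ?thesis
      by (auto simp: null_subspaces_def fvs.subspace_0[OF subspace_std_space])
  qed
  then have ne: "fvs.dim ` ?NS \<noteq> {}" by blast
  have "(\<exists>H\<in>?NS. t \<le> fvs.dim H) \<longleftrightarrow> (\<exists>H\<in>?NS. fvs.dim H = t)"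
  proof
    assume "\<exists>H\<in>?NS. t \<le> fvs.dim H"
    then obtain H where H: "H \<in> ?NS" "t \<le> fvs.dim H" by blast
    then have Hs: "fvs.subspace H" "H \<subseteq> std_space N" by (auto simp: null_subspaces_def)
    obtain B where B: "finite B" "B \<subseteq> H" "fvs.independent B" "fvs.span B = H" "card B = fvs.dim H"
      by (rule subspace_basis[OF Hs])
    obtain B' where B': "B' \<subseteq> B" "card B' = t" using obtain_subset_with_card_n[of t B] H(2) B(5) by metis
    have "fvs.dim (fvs.span B') = t"
      using fvs.dim_span_eq_card_independent[OF fvs.independent_mono[OF B(3) B'(1)]] B'(2) by simp
    moreover have "fvs.span B' \<subseteq> H" using fvs.span_mono[OF B'(1)] B(4) by simp
    then have "fvs.span B' \<in> ?NS"
      using H(1) ext_power_mono[of "fvs.span B'" H k] by (auto simp: null_subspaces_def fvs.subspace_span)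
    ultimately show "\<exists>H\<in>?NS. fvs.dim H = t" by blast
  qed auto
  also have "\<dots> \<longleftrightarrow> {H \<in> ?NS. fvs.dim H = t} \<noteq> {}" by blast
  also have "\<dots> \<longleftrightarrow> 1 \<le> null_count k N t \<Theta>"
    unfolding null_count_def using fin by (simp add: Suc_le_eq card_gt_0_iff)
  finally show ?thesis unfolding max_null_dim_def using fin ne by (simp add: Max_ge_iff)
qed

section \<open>Poisson convergence from binomial moments\<close>

text \<open>Pascal's rule makes the alternating sum telescope.\<close>

lemma alternating_choose_partial_sum:
  "(\<Sum>i\<le>T. (-1) ^ i * real (Suc y choose i)) = (-1) ^ T * real (y choose T)"
proof (induction T)
  case (Suc T)
  then show ?case by (simp add: algebra_simps)
qed simp

text \<open>With \<open>x = j + y\<close>, each product of binomials becomes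
  \<open>(x choose j) * (y choose i)\<close>, which leaves a partial alternating row sum. For
  \<open>y > 0\<close> it is, up to sign, \<open>(y - 1) choose T\<close>, at most
  \<open>y choose (T + 1)\<close>. Absolute values make the parity of \<open>T\<close>
  irrelevant.\<close>

lemma bonferroni_pointwise:
  "\<bar>indicator {j} x - (\<Sum>i\<le>T. (-1) ^ i * real (j + i choose j) * real (x choose (j + i)))\<bar>
    \<le> real (j + Suc T choose j) * real (x choose (j + Suc T))"
proof (cases "j \<le> x")
  case False
  then have "(\<Sum>i\<le>T. (-1) ^ i * real (j + i choose j) * real (x choose (j + i))) = 0"
    by (intro sum.neutral) (auto simp: binomial_eq_0)
  then show ?thesis using False by (simp add: indicator_def)
next
  case True
  then obtain y where x: "x = j + y" using le_Suc_ex by blast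
  have tri: "(j + i choose j) * (x choose (j + i)) = (x choose j) * (y choose i)" for i
  proof (cases "i \<le> y")
    case True
    then show ?thesis using choose_mult[of j "j + i" x] x by (simp add: mult.commute)
  next
    case False
    then show ?thesis by (simp add: x binomial_eq_0)
  qed
  have tri': "real (j + i choose j) * real (x choose (j + i)) = real (x choose j) * real (y choose i)" for i
    using tri[of i] by (metis of_nat_mult)
  have s: "(\<Sum>i\<le>T. (-1) ^ i * real (j + i choose j) * real (x choose (j + i)))
    = real (x choose j) * (\<Sum>i\<le>T. (-1) ^ i * real (y choose i))"
    unfolding sum_distrib_left
    unfolding mult.assoc tri' by (intro sum.cong refl) (simp only: mult_ac)
  note r = tri'[of "Suc T"]
  show ?thesis
  proof (cases y)
    case 0
    have "(\<Sum>i\<le>T. (-1) ^ i * real (0 choose i)) = (\<Sum>i\<le>T. if i = 0 then 1 else 0)"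
      by (intro sum.cong) (auto simp: binomial_eq_0)
    then show ?thesis unfolding s r using 0 x by simp
  next
    case (Suc z)
    have "indicator {j} x = (0 :: real)" using x Suc by (simp add: indicator_def)
    moreover have "real (z choose T) \<le> real (Suc z choose Suc T)" by simp
    ultimately show ?thesis unfolding s r
      by (simp add: Suc alternating_choose_partial_sum abs_mult mult_left_mono del: binomial_Suc_Suc)
  qed
qed

text \<open>Two successive limits: \<open>n\<close> tends to infinity at a fixed truncation level
  \<open>T\<close>, then \<open>T\<close> does. No uniformity in \<open>T\<close> is
  assumed.\<close>

lemma abs_diff_le_imp_tendsto:
  fixes f :: "nat \<Rightarrow> real"
  assumes bound: "\<And>T n. \<bar>f n - a T n\<bar> \<le> b T n"
    and a: "\<And>T. a T \<longlonglongrightarrow> A T" and b: "\<And>T. b T \<longlonglongrightarrow> B T"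
    and A: "A \<longlonglongrightarrow> L" and B: "B \<longlonglongrightarrow> 0"
  shows "f \<longlonglongrightarrow> L"
proof (rule LIMSEQ_I)
  fix e :: real assume "0 < e"
  then have e4: "0 < e / 4" by simp
  have "\<forall>\<^sub>F T in sequentially. dist (A T) L < e / 4 \<and> dist (B T) 0 < e / 4"
    using tendstoD[OF A e4] tendstoD[OF B e4] by (rule eventually_conj)
  then obtain T where T: "\<bar>A T - L\<bar> < e / 4" "\<bar>B T\<bar> < e / 4"
    using eventually_happens[of _ sequentially] by (auto simp: dist_real_def)
  have "\<forall>\<^sub>F n in sequentially. dist (a T n) (A T) < e / 4 \<and> dist (b T n) (B T) < e / 4"
    using tendstoD[OF a e4] tendstoD[OF b e4] by (rule eventually_conj)
  then obtain n0 where n0: "\<And>n. n \<ge> n0 \<Longrightarrow> \<bar>a T n - A T\<bar> < e / 4 \<and> \<bar>b T n - B T\<bar> < e / 4"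
    by (auto simp: eventually_sequentially dist_real_def)
  show "\<exists>no. \<forall>n\<ge>no. norm (f n - L) < e"
  proof (intro exI allI impI)
    fix n assume "n \<ge> n0"
    from n0[OF this] T bound[of n T] show "norm (f n - L) < e" by (auto simp: abs_if split: if_splits)
  qed
qed

text \<open>Truncated inclusion-exclusion expresses a point probability by finitely many binomial
  moments, with the next moment as error. In the limit the main terms form the series of
  \<open>exp (- \<mu>)\<close>, and the errors are multiples of terms of the series of
  \<open>exp \<mu>\<close>.\<close>

lemma pmf_tendsto_poisson:
  fixes P :: "nat \<Rightarrow> nat pmf"
  assumes fin: "\<And>n. finite (set_pmf (P n))" and \<mu>: "0 < \<mu>"
    and mom: "\<And>s. (\<lambda>n. measure_pmf.expectation (P n) (\<lambda>x. real (x choose s))) \<longlonglongrightarrow> \<mu> ^ s / fact s"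
  shows "(\<lambda>n. pmf (P n) j) \<longlonglongrightarrow> pmf (poisson_pmf \<mu>) j"
proof (rule abs_diff_le_imp_tendsto)
  define M where "M s n = measure_pmf.expectation (P n) (\<lambda>x. real (x choose s))" for s n
  have int: "integrable (measure_pmf (P n)) f" for n and f :: "nat \<Rightarrow> real"
    by (rule integrable_measure_pmf_finite[OF fin])
  show "\<bar>pmf (P n) j - (\<Sum>i\<le>T. (-1) ^ i * real (j + i choose j) * M (j + i) n)\<bar>
      \<le> real (j + Suc T choose j) * M (j + Suc T) n" for T n
  proof -
    have "pmf (P n) j = measure_pmf.expectation (P n) (indicator {j} :: nat \<Rightarrow> real)"
      by (simp add: measure_pmf_single)
    moreover have "(\<Sum>i\<le>T. (-1) ^ i * real (j + i choose j) * M (j + i) n)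
      = measure_pmf.expectation (P n) (\<lambda>x. \<Sum>i\<le>T. (-1) ^ i * real (j + i choose j) * real (x choose (j + i)))"
      unfolding M_def by (subst Bochner_Integration.integral_sum[OF int]) (simp only: integral_mult_right_zero)
    ultimately have eq: "pmf (P n) j - (\<Sum>i\<le>T. (-1) ^ i * real (j + i choose j) * M (j + i) n)
      = measure_pmf.expectation (P n) (\<lambda>x. indicator {j} x - (\<Sum>i\<le>T. (-1) ^ i * real (j + i choose j) * real (x choose (j + i))))"
      by (simp only: Bochner_Integration.integral_diff[OF int int])
    have "\<bar>measure_pmf.expectation (P n) (\<lambda>x. indicator {j} x - (\<Sum>i\<le>T. (-1) ^ i * real (j + i choose j) * real (x choose (j + i))))\<bar>
      \<le> measure_pmf.expectation (P n) (\<lambda>x. \<bar>indicator {j} x - (\<Sum>i\<le>T. (-1) ^ i * real (j + i choose j) * real (x choose (j + i)))\<bar>)"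
      by (rule integral_abs_bound)
    also have "\<dots> \<le> measure_pmf.expectation (P n) (\<lambda>x. real (j + Suc T choose j) * real (x choose (j + Suc T)))"
      by (intro integral_mono int bonferroni_pointwise)
    also have "\<dots> = real (j + Suc T choose j) * M (j + Suc T) n"
      unfolding M_def by (rule integral_mult_right_zero)
    finally show ?thesis unfolding eq .
  qed
  have mom': "M s \<longlonglongrightarrow> \<mu> ^ s / fact s" for s using mom[of s] by (simp add: M_def[abs_def])
  show "(\<lambda>n. \<Sum>i\<le>T. (-1) ^ i * real (j + i choose j) * M (j + i) n)
      \<longlonglongrightarrow> (\<Sum>i\<le>T. (-1) ^ i * real (j + i choose j) * (\<mu> ^ (j + i) / fact (j + i)))" for T
    by (intro tendsto_intros mom')
  show "(\<lambda>n. real (j + Suc T choose j) * M (j + Suc T) n)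
      \<longlonglongrightarrow> real (j + Suc T choose j) * (\<mu> ^ (j + Suc T) / fact (j + Suc T))" for T
    by (intro tendsto_intros mom')
  have c: "real (j + i choose j) * (\<mu> ^ (j + i) / fact (j + i)) = \<mu> ^ j / fact j * (\<mu> ^ i / fact i)" for i
    by (simp add: binomial_fact power_add field_simps)
  have ex: "(\<lambda>i. x ^ i / fact i) sums exp x" for x :: real
    using exp_converges[of x] by (simp add: divide_inverse mult.commute)
  have "(\<lambda>T. \<mu> ^ j / fact j * (\<Sum>i\<le>T. (- \<mu>) ^ i / fact i)) \<longlonglongrightarrow> \<mu> ^ j / fact j * exp (- \<mu>)"
    using ex[of "- \<mu>"] by (intro tendsto_intros) (simp add: sums_def_le)
  moreover have "\<mu> ^ j / fact j * (\<Sum>i\<le>T. (- \<mu>) ^ i / fact i)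
     = (\<Sum>i\<le>T. (-1) ^ i * real (j + i choose j) * (\<mu> ^ (j + i) / fact (j + i)))" for T
    unfolding sum_distrib_left
  proof (rule sum.cong[OF refl])
    fix i
    have "(-1) ^ i * real (j + i choose j) * (\<mu> ^ (j + i) / fact (j + i))
       = (-1) ^ i * (\<mu> ^ j / fact j * (\<mu> ^ i / fact i))"
      unfolding mult.assoc c ..
    also have "\<dots> = \<mu> ^ j / fact j * ((- \<mu>) ^ i / fact i)" by (simp add: power_minus[of \<mu>])
    finally show "\<mu> ^ j / fact j * ((- \<mu>) ^ i / fact i)
      = (-1) ^ i * real (j + i choose j) * (\<mu> ^ (j + i) / fact (j + i))" ..
  qed
  moreover have "pmf (poisson_pmf \<mu>) j = \<mu> ^ j / fact j * exp (- \<mu>)"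
    using \<mu> by simp
  ultimately show "(\<lambda>T. \<Sum>i\<le>T. (-1) ^ i * real (j + i choose j) * (\<mu> ^ (j + i) / fact (j + i)))
      \<longlonglongrightarrow> pmf (poisson_pmf \<mu>) j" by simp
  have "(\<lambda>i. \<mu> ^ i / fact i) \<longlonglongrightarrow> 0" by (rule summable_LIMSEQ_zero[OF sums_summable[OF ex]])
  then have "(\<lambda>T. \<mu> ^ j / fact j * (\<mu> ^ Suc T / fact (Suc T))) \<longlonglongrightarrow> \<mu> ^ j / fact j * 0"
    by (intro tendsto_intros LIMSEQ_Suc)
  then show "(\<lambda>T. real (j + Suc T choose j) * (\<mu> ^ (j + Suc T) / fact (j + Suc T))) \<longlonglongrightarrow> 0"
    unfolding c by simp
qed

text \<open>On the natural numbers a distribution function is a finite sum of point probabilities,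
  so it converges at every point, continuity point or not.\<close>

lemma converges_to_Poisson_if_pmf:
  assumes "\<And>j. (\<lambda>n. pmf (P n) j) \<longlonglongrightarrow> pmf (poisson_pmf \<mu>) j"
  shows "converges_to_Poisson P \<mu>"
proof -
  have cdf: "cdf (distr (measure_pmf p) borel real) x = (\<Sum>j\<in>{j. real j \<le> x}. pmf p j)" for p :: "nat pmf" and x
  proof -
    have "{j. real j \<le> x} \<subseteq> {..nat \<lfloor>x\<rfloor>}" by (auto simp: le_nat_floor)
    then have fin: "finite {j. real j \<le> x}" by (rule finite_subset) simp
    have "cdf (distr (measure_pmf p) borel real) x = measure (measure_pmf p) (real -` {..x})"
      unfolding cdf_def by (subst measure_distr) auto
    also have "real -` {..x} = {j. real j \<le> x}" by auto
    also have "measure (measure_pmf p) {j. real j \<le> x} = (\<Sum>j\<in>{j. real j \<le> x}. pmf p j)"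
      by (rule measure_measure_pmf_finite[OF fin])
    finally show ?thesis .
  qed
  show ?thesis
    unfolding converges_to_Poisson_def weak_conv_m_def weak_conv_def cdf by (intro allI impI tendsto_sum assms)
qed

section \<open>Estimates at resonance\<close>

lemma set_random_hom:
  "set_pmf (random_hom k N m :: ((nat set \<Rightarrow> 'a::{field,finite}) \<Rightarrow> nat \<Rightarrow> 'a) pmf) = Hom_ext k N m"
  "finite (set_pmf (random_hom k N m :: ((nat set \<Rightarrow> 'a) \<Rightarrow> nat \<Rightarrow> 'a) pmf))"
  using Hom_ext_nonempty[of k N m, where 'a='a] by (simp_all add: random_hom_def)

lemma integrable_random_hom:
  fixes f :: "((nat set \<Rightarrow> 'a::{field,finite}) \<Rightarrow> nat \<Rightarrow> 'a) \<Rightarrow> real"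
  shows "integrable (measure_pmf (random_hom k N m)) f"
  by (rule integrable_measure_pmf_finite[OF set_random_hom(2)])

text \<open>Absorbs the number of summands into a power of \<open>q\<close>.\<close>

lemma le_powr_self:
  fixes q x :: real
  assumes "2 \<le> q" "0 \<le> x"
  shows "x \<le> q powr x"
proof -
  define n where "n = nat \<lfloor>x\<rfloor>"
  have n: "real n \<le> x" "x \<le> real (n + 1)" using assms(2) unfolding n_def by linarith+
  have "n + 1 \<le> 2 ^ n" using less_exp[of n] by linarith
  then have "real (n + 1) \<le> real (2 ^ n)" by (simp only: of_nat_le_iff)
  also have "\<dots> = 2 powr real n" by (simp add: powr_realpow)
  also have "\<dots> \<le> 2 powr x" using n by (intro powr_mono) auto
  also have "\<dots> \<le> q powr x" using assms by (intro powr_mono2) auto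
  finally show ?thesis using n by linarith
qed

text \<open>At resonance \<open>\<rho> = c\<close>, and everything linear in \<open>c\<close>
  cancels except \<open>-c\<close>. From \<open>u \<le> r s\<close> the rest of the exponent is at
  most \<open>r s (r + 1 + r s)\<close>, so at most \<open>(2 s + s^2) r^2\<close>; the at most
  \<open>r s\<close> values of \<open>u\<close> cost another \<open>s r^2\<close>, which gives the
  constant \<open>3 s + s^2\<close>.\<close>

lemma factorial_moment_resonance:
  fixes k r m c s :: nat
  assumes k: "2 \<le> k" "k \<le> r" and res: "r * c = m * (r choose k)"
  defines "g \<equiv> card (grassmannian (r + c) r :: (nat \<Rightarrow> 'a::{field,finite}) set set)"
  defines "E \<equiv> measure_pmf.expectation (random_hom k (r + c) m :: ((nat set \<Rightarrow> 'a) \<Rightarrow> nat \<Rightarrow> 'a) pmf)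
      (\<lambda>\<Theta>. real (null_count k (r + c) r \<Theta> choose s))"
  shows "\<bar>E - real (g choose s) / real CARD('a) ^ (r * c * s)\<bar>
    \<le> real CARD('a) powr (real (3 * s + s * s) * (real r)\<^sup>2 - real c)"
proof -
  let ?q = "real CARD('a)"
  have q: "2 \<le> ?q" using card_field_ge_2[where 'a='a] by simp
  have \<rho>: "real r * real c = real m * real (r choose k)" using res by (metis of_nat_mult)
  let ?U = "{u. u < r * s \<and> u \<le> r + c}"
  let ?f = "\<lambda>u. ?q powr (real (u * (r + c - u) + u + u * r * s) - real c * (real u + 1))"
  let ?B = "?q powr (real (2 * s + s * s) * (real r)\<^sup>2 - real c)"
  have r1: "1 \<le> real r" using k by simp
  then have rr: "real r \<le> (real r)\<^sup>2" by (simp add: power2_eq_square)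
  have f: "?f u \<le> ?B" if "u \<in> ?U" for u
  proof -
    have u: "real u \<le> real r * real s" "u \<le> r + c"
      using that by (simp_all flip: of_nat_mult)
    have "real (u * (r + c - u) + u + u * r * s) - real c * (real u + 1)
      = real u * (real r + 1 + real r * real s - real u) - real c"
      unfolding of_nat_mult of_nat_add of_nat_diff[OF u(2)] by (simp add: algebra_simps)
    also have "real u * (real r + 1 + real r * real s - real u) \<le> (real r * real s) * (real r + 1 + real r * real s)"
    proof -
      have "real u * (real r + 1 + real r * real s - real u) \<le> real u * (real r + 1 + real r * real s)"
        by (intro mult_left_mono) auto
      also have "\<dots> \<le> (real r * real s) * (real r + 1 + real r * real s)"
        using u(1) by (intro mult_right_mono) auto
      finally show ?thesis .
    qed
    also have "\<dots> = real s * (real r)\<^sup>2 + real s * real r + real (s * s) * (real r)\<^sup>2"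
      by (simp add: algebra_simps power2_eq_square)
    also have "\<dots> \<le> real s * (real r)\<^sup>2 + real s * (real r)\<^sup>2 + real (s * s) * (real r)\<^sup>2"
      using rr by (intro add_mono mult_left_mono) auto
    also have "\<dots> = real (2 * s + s * s) * (real r)\<^sup>2" by (simp add: algebra_simps)
    finally show ?thesis using q by (intro powr_mono) auto
  qed
  have "(\<Sum>u\<in>?U. ?f u) \<le> real (card ?U) * ?B"
    using f by (rule sum_bounded_above)
  also have "\<dots> \<le> ?q powr (real s * (real r)\<^sup>2) * ?B"
  proof (rule mult_right_mono)
    have "card ?U \<le> card {..<r * s}" by (rule card_mono) auto
    then have "real (card ?U) \<le> real (r * s)" by (simp only: card_lessThan of_nat_le_iff)
    also have "real (r * s) = real s * real r" by simp
    also have "\<dots> \<le> real s * (real r)\<^sup>2" by (rule mult_left_mono[OF rr]) simp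
    also have "\<dots> \<le> ?q powr (real s * (real r)\<^sup>2)" using q by (intro le_powr_self) auto
    finally show "real (card ?U) \<le> ?q powr (real s * (real r)\<^sup>2)" .
  qed simp
  also have "\<dots> = ?q powr (real (3 * s + s * s) * (real r)\<^sup>2 - real c)"
    by (simp add: powr_add[symmetric] algebra_simps)
  finally have err: "(\<Sum>u\<in>?U. ?f u) \<le> ?q powr (real (3 * s + s * s) * (real r)\<^sup>2 - real c)" .
  show ?thesis
    using factorial_moment_bounds[OF k \<rho>, of "r + c" s, where 'a='a] err
    unfolding E_def g_def res[symmetric] by simp
qed

text \<open>Markov's inequality for an integer-valued count.\<close>

lemma prob_null_count_ge_1_le:
  "measure_pmf.prob (random_hom k N m :: ((nat set \<Rightarrow> 'a::{field,finite}) \<Rightarrow> nat \<Rightarrow> 'a) pmf)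
     {\<Theta>. 1 \<le> null_count k N t \<Theta>}
   \<le> real (card (grassmannian N t :: (nat \<Rightarrow> 'a) set set)) / real CARD('a) ^ (m * (t choose k))"
proof -
  let ?M = "random_hom k N m :: ((nat set \<Rightarrow> 'a) \<Rightarrow> nat \<Rightarrow> 'a) pmf"
  have "measure_pmf.prob ?M {\<Theta>. 1 \<le> null_count k N t \<Theta>}
      = measure_pmf.expectation ?M (indicator {\<Theta>. 1 \<le> null_count k N t \<Theta>})" by simp
  also have "\<dots> \<le> measure_pmf.expectation ?M (\<lambda>\<Theta>. real (null_count k N t \<Theta>))"
    by (intro integral_mono integrable_random_hom) (auto simp: indicator_def)
  finally show ?thesis unfolding expectation_null_count .
qed

text \<open>By absorption and \<open>k \<ge> 2\<close>, the exponent
  \<open>m (r + 1 choose k)\<close> is at least \<open>(r + 1) r c / (r - 1)\<close>, hence at least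
  \<open>(r + 2) c\<close>. There are at most q^((r+1)c) candidates, because the surplus in
  \<open>card_grassmannian_le\<close> exactly restores \<open>(r + 1) (c - 1)\<close> to
  \<open>(r + 1) c\<close>.\<close>

lemma prob_null_above:
  fixes k r m c :: nat
  assumes k: "2 \<le> k" "k \<le> r" and res: "r * c = m * (r choose k)" and c: "1 \<le> c"
  shows "measure_pmf.prob (random_hom k (r + c) m :: ((nat set \<Rightarrow> 'a::{field,finite}) \<Rightarrow> nat \<Rightarrow> 'a) pmf)
     {\<Theta>. 1 \<le> null_count k (r + c) (r + 1) \<Theta>} \<le> real CARD('a) powr (- real c)"
proof -
  let ?q = "real CARD('a)"
  have q: "2 \<le> ?q" using card_field_ge_2[where 'a='a] by simp
  let ?X = "m * (r + 1 choose k)"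
  have "(r + 1 - k) * (r + 1 choose k) = (r + 1) * (r choose k)"
    using binomial_absorb_comp[of "r + 1" k] by simp
  then have "?X * (r + 1 - k) = (r + 1) * (m * (r choose k))" by (metis mult.assoc mult.commute)
  also have "\<dots> = (r + 1) * (r * c)" using res by simp
  finally have "(r + 1) * (r * c) = ?X * (r + 1 - k)" ..
  also have "\<dots> \<le> ?X * (r - 1)" using k by (intro mult_le_mono2) auto
  finally have 1: "(r + 1) * (r * c) \<le> ?X * (r - 1)" .
  have "((r + 2) * c) * (r - 1) \<le> (r + 1) * (r * c)"
  proof -
    obtain d where "r = d + 2" using k le_Suc_ex[of 2 r] by auto
    then show ?thesis by (simp add: algebra_simps)
  qed
  then have "((r + 2) * c) * (r - 1) \<le> ?X * (r - 1)" using 1 by (rule le_trans)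
  then have X: "(r + 2) * c \<le> ?X" using k by simp
  have "card (grassmannian (r + c) (r + 1) :: (nat \<Rightarrow> 'a) set set)
      \<le> CARD('a) ^ ((r + 1) * (r + c - (r + 1)) + (r + 1))"
    using c by (intro card_grassmannian_le) simp
  also have "(r + 1) * (r + c - (r + 1)) + (r + 1) = (r + 1) * c"
    using c by (cases c) (simp_all add: algebra_simps)
  finally have "real (card (grassmannian (r + c) (r + 1) :: (nat \<Rightarrow> 'a) set set)) \<le> ?q ^ ((r + 1) * c)"
    by (simp flip: of_nat_power)
  then have "real (card (grassmannian (r + c) (r + 1) :: (nat \<Rightarrow> 'a) set set)) / ?q ^ ?X
      \<le> ?q ^ ((r + 1) * c) / ?q ^ ((r + 2) * c)"
    using X q by (intro frac_le power_increasing) auto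
  also have "\<dots> = ?q powr (- real c)"
  proof -
    have "(r + 2) * c = (r + 1) * c + c" by simp
    then have "?q ^ ((r + 2) * c) = ?q ^ ((r + 1) * c) * ?q ^ c" by (simp only: power_add)
    then show ?thesis using q by (simp add: powr_minus powr_realpow divide_simps)
  qed
  finally show ?thesis
    using prob_null_count_ge_1_le[of k "r + c" m "r + 1", where 'a='a] by linarith
qed

text \<open>Chebyshev's inequality: the right side is the variance, since the square of a count
  \<open>X\<close> is \<open>2 (X choose 2) + X\<close>, and \<open>X = 0\<close> contributes the
  squared mean.\<close>

lemma prob_null_count_eq_0_le:
  fixes k N m t :: nat
  defines "M \<equiv> random_hom k N m :: ((nat set \<Rightarrow> 'a::{field,finite}) \<Rightarrow> nat \<Rightarrow> 'a) pmf"
  defines "\<mu> \<equiv> measure_pmf.expectation M (\<lambda>\<Theta>. real (null_count k N t \<Theta>))"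
  shows "\<mu>\<^sup>2 * measure_pmf.prob M {\<Theta>. null_count k N t \<Theta> = 0}
    \<le> 2 * measure_pmf.expectation M (\<lambda>\<Theta>. real (null_count k N t \<Theta> choose 2)) + \<mu> - \<mu>\<^sup>2"
proof -
  let ?X = "\<lambda>\<Theta>. real (null_count k N t \<Theta>)"
  note int = integrable_random_hom[of k N m, where 'a='a, folded M_def]
  have "\<mu>\<^sup>2 * measure_pmf.prob M {\<Theta>. null_count k N t \<Theta> = 0}
    = measure_pmf.expectation M (\<lambda>\<Theta>. \<mu>\<^sup>2 * indicator {\<Theta>. null_count k N t \<Theta> = 0} \<Theta>)"
    by simp
  also have "\<dots> \<le> measure_pmf.expectation M (\<lambda>\<Theta>. (?X \<Theta> - \<mu>)\<^sup>2)"
    by (intro integral_mono int) (auto simp: indicator_def)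
  also have "\<dots> = measure_pmf.expectation M (\<lambda>\<Theta>. (2 * real (null_count k N t \<Theta> choose 2) + (1 - 2 * \<mu>) * ?X \<Theta>) + \<mu>\<^sup>2)"
  proof (rule arg_cong[of _ _ "measure_pmf.expectation M"], rule ext)
    fix \<Theta>
    let ?x = "null_count k N t \<Theta>"
    have "2 * (?x choose 2) = ?x * (?x - 1)"
      using binomial_absorption[of 1 ?x] by (simp add: numeral_2_eq_2)
    then have "2 * real (?x choose 2) = real ?x * real (?x - 1)" by (metis of_nat_mult of_nat_numeral)
    also have "\<dots> = real ?x * (real ?x - 1)" by (cases ?x) auto
    finally show "(?X \<Theta> - \<mu>)\<^sup>2 = (2 * real (?x choose 2) + (1 - 2 * \<mu>) * ?X \<Theta>) + \<mu>\<^sup>2"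
      by (simp add: power2_eq_square algebra_simps)
  qed
  also have "\<dots> = 2 * measure_pmf.expectation M (\<lambda>\<Theta>. real (null_count k N t \<Theta> choose 2))
      + (1 - 2 * \<mu>) * \<mu> + \<mu>\<^sup>2"
    by (simp add: Bochner_Integration.integral_add[OF int int] \<mu>_def)
  also have "\<dots> = 2 * measure_pmf.expectation M (\<lambda>\<Theta>. real (null_count k N t \<Theta> choose 2)) + \<mu> - \<mu>\<^sup>2"
    by (simp add: power2_eq_square algebra_simps)
  finally show ?thesis .
qed

text \<open>Below dimension \<open>k\<close> the exterior power is zero, so every subspace is null;
  \<open>t \<le> N\<close> ensures that one exists.\<close>

lemma null_count_below_k:
  assumes "\<Theta> \<in> Hom_ext k N m" "t < k" "t \<le> N"
  shows "1 \<le> null_count k N t (\<Theta> :: (nat set \<Rightarrow> 'a::{field,finite}) \<Rightarrow> nat \<Rightarrow> 'a)"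
proof -
  have "0 \<in> ext_power k (std_space N :: (nat \<Rightarrow> 'a) set)" using subspace_ext_power fvs.subspace_0 by blast
  then have "\<Theta> (fscale 0 0) = fscale 0 (\<Theta> 0)" using assms(1) unfolding Hom_ext_def by blast
  then have z: "\<Theta> 0 = 0" by simp
  have "\<forall>x\<in>ext_power k H. \<Theta> x = 0" if "H \<in> grassmannian N t" for H
  proof -
    have H: "fvs.subspace H" "H \<subseteq> std_space N" "fvs.dim H = t" using that by (auto simp: grassmannian_def)
    obtain W :: "(nat set \<Rightarrow> 'a) set" where W: "finite W" "fvs.span W = ext_power k (std_space N)"
      by (rule ext_power_std_fg)
    obtain B where B: "finite B" "ext_power k H \<subseteq> fvs.span B" "card B = fvs.dim (ext_power k H)"
      using fvs.finite_basis_fg[OF W(1), of "ext_power k H"] W(2) ext_power_mono[OF H(2), of k] by metis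
    have "card B = 0" using B(3) dim_ext_power[OF H(1,2), of k] H(3) assms(2) by (simp add: binomial_eq_0)
    then have "ext_power k H \<subseteq> {0}" using B by simp
    then show ?thesis using z by auto
  qed
  then have "{H \<in> null_subspaces k N \<Theta>. fvs.dim H = t} = grassmannian N t"
    unfolding null_subspaces_dim by blast
  moreover have "1 \<le> CARD('a) ^ (t * (N - t))" by (simp add: Suc_le_eq)
  ultimately show ?thesis
    using card_grassmannian_ge[OF assms(3), where 'a='a] unfolding null_count_def by (metis order_trans)
qed

text \<open>Second moment method in dimension \<open>r - 1\<close>. The case \<open>k = r\<close> is
  separate because \<open>factorial_moment_bounds\<close> requires \<open>k\<close> to be at most
  this dimension. The constant 10 is 8 from an exponent of at most \<open>2 r * 4 r\<close>, plus 2
  from fewer than \<open>2 r\<close> values of \<open>u\<close>.\<close>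

lemma prob_null_below:
  fixes k r m c :: nat
  assumes k: "2 \<le> k" "k \<le> r" and res: "r * c = m * (r choose k)"
  shows "measure_pmf.prob (random_hom k (r + c) m :: ((nat set \<Rightarrow> 'a::{field,finite}) \<Rightarrow> nat \<Rightarrow> 'a) pmf)
     {\<Theta>. null_count k (r + c) (r - 1) \<Theta> = 0}
     \<le> 2 * real CARD('a) powr (10 * (real r)\<^sup>2 - real c) + real CARD('a) powr (- real c)"
proof (cases "k = r")
  case True
  have "measure_pmf.prob (random_hom k (r + c) m :: ((nat set \<Rightarrow> 'a) \<Rightarrow> nat \<Rightarrow> 'a) pmf)
     {\<Theta>. null_count k (r + c) (r - 1) \<Theta> = 0} = 0"
  proof (subst measure_pmf_zero_iff, rule equals0I)
    fix \<Theta> assume "\<Theta> \<in> set_pmf (random_hom k (r + c) m :: ((nat set \<Rightarrow> 'a) \<Rightarrow> nat \<Rightarrow> 'a) pmf)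
      \<inter> {\<Theta>. null_count k (r + c) (r - 1) \<Theta> = 0}"
    moreover have "r - 1 \<le> r + c" by linarith
    ultimately show False
      using null_count_below_k[of \<Theta> k "r + c" m "r - 1"] True k by (auto simp: set_random_hom)
  qed
  then show ?thesis by simp
next
  case False
  let ?q = "real CARD('a)" and ?t = "r - 1" and ?N = "r + c"
  let ?M = "random_hom k ?N m :: ((nat set \<Rightarrow> 'a) \<Rightarrow> nat \<Rightarrow> 'a) pmf"
  have q: "2 \<le> ?q" using card_field_ge_2[where 'a='a] by simp
  have kt: "k \<le> ?t" using False k by simp
  have t: "real ?t = real r - 1" "real r \<ge> 2" using k by (auto simp: of_nat_diff)
  let ?g = "card (grassmannian ?N ?t :: (nat \<Rightarrow> 'a) set set)"
  \<comment> \<open>The exponent for a single \<open>t\<close>-space. Absorption and resonance give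
    \<open>a = (r - k) c\<close>, so \<open>\<rho> = (r - k) c / (r - 1)\<close> is at most
    \<open>c\<close>.\<close>
  define a where "a = m * (?t choose k)"
  have "r * a = (r - k) * (m * (r choose k))"
    using binomial_absorb_comp[of r k] unfolding a_def by (metis mult.assoc mult.commute)
  also have "\<dots> = r * ((r - k) * c)" using res by (simp add: mult_ac)
  finally have a: "a = (r - k) * c" using k by simp
  define \<rho> where "\<rho> = real a / real ?t"
  have \<rho>: "real ?t * \<rho> = real m * real (?t choose k)" unfolding \<rho>_def a_def using t by simp
  have t\<rho>: "real ?t * \<rho> = real a" unfolding \<rho>_def using t by simp
  have "real (r - k) \<le> real ?t" using k by simp
  then have "real a \<le> real ?t * real c" unfolding a by (simp add: mult_right_mono)
  then have \<rho>c: "\<rho> \<le> real c" "0 \<le> \<rho>" using t by (simp_all add: \<rho>_def field_simps)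
  define \<mu> where "\<mu> = measure_pmf.expectation ?M (\<lambda>\<Theta>. real (null_count k ?N ?t \<Theta>))"
  have \<mu>: "\<mu> = real ?g / ?q ^ a" unfolding \<mu>_def expectation_null_count a_def ..
  have Nt: "?N - ?t = c + 1" "?t \<le> ?N" using k by auto
  have "CARD('a) ^ (?t * (c + 1)) \<le> ?g"
    using card_grassmannian_ge[OF Nt(2), where 'a='a] unfolding Nt(1) .
  then have "?q ^ (?t * (c + 1)) \<le> real ?g" by (simp flip: of_nat_power)
  then have \<mu>_ge: "?q powr (real ?t * (real c + 1) - real ?t * \<rho>) \<le> \<mu>"
  proof -
    have "real ?t * (real c + 1) = real (?t * (c + 1))" by (simp only: of_nat_mult of_nat_add of_nat_1)
    then have "?q powr (real ?t * (real c + 1) - real ?t * \<rho>) = ?q ^ (?t * (c + 1)) / ?q ^ a"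
      using q by (simp only: t\<rho> powr_diff powr_realpow)
    with \<open>?q ^ (?t * (c + 1)) \<le> real ?g\<close> show ?thesis
      using q by (simp only: \<mu>) (rule divide_right_mono, simp_all)
  qed
  then have \<mu>0: "\<mu> > 0" using q by (smt (verit) powr_gt_zero)
  let ?U = "{u. u < ?t * 2 \<and> u \<le> ?N}"
  let ?f = "\<lambda>u. ?q powr (real (u * (?N - u) + u + u * ?t * 2) - \<rho> * (real u + 1))"
  let ?err = "\<Sum>u\<in>?U. ?f u"
  have "measure_pmf.expectation ?M (\<lambda>\<Theta>. real (null_count k ?N ?t \<Theta> choose 2))
      \<le> real (?g choose 2) / ?q ^ (a * 2) + ?err"
    unfolding a_def by (rule factorial_moment_bounds(2)[OF k(1) kt \<rho>])
  moreover have "2 * (real (?g choose 2) / ?q ^ (a * 2)) \<le> \<mu>\<^sup>2"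
  proof -
    have "2 * (?g choose 2) = ?g * (?g - 1)"
      using binomial_absorption[of 1 ?g] by (simp add: numeral_2_eq_2)
    then have "2 * (?g choose 2) \<le> ?g * ?g" by simp
    then have "2 * real (?g choose 2) \<le> real ?g * real ?g"
      by (metis of_nat_le_iff of_nat_mult of_nat_numeral)
    then show ?thesis
      using q by (simp add: \<mu> power_divide power_mult divide_right_mono power2_eq_square)
  qed
  ultimately have P: "\<mu>\<^sup>2 * measure_pmf.prob ?M {\<Theta>. null_count k ?N ?t \<Theta> = 0} \<le> 2 * ?err + \<mu>"
    using prob_null_count_eq_0_le[of k ?N m ?t, where 'a='a] unfolding \<mu>_def by linarith
  \<comment> \<open>The exponent of the mean is at least \<open>t c - a = (k - 1) c\<close>, and
    \<open>k \<ge> 2\<close>.\<close>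
  have "1 / \<mu> \<le> ?q powr (- real c)"
  proof -
    have "real a + real c \<le> real ?t * real c"
    proof -
      have "(r - k) + 1 \<le> ?t" using k by simp
      then have "((r - k) + 1) * c \<le> ?t * c" by (rule mult_le_mono1)
      then show ?thesis unfolding a by (simp add: algebra_simps flip: of_nat_mult of_nat_add)
    qed
    then have "?q powr real c \<le> ?q powr (real ?t * (real c + 1) - real ?t * \<rho>)"
      using q t t\<rho> by (intro powr_mono) (auto simp: algebra_simps)
    then have "?q powr real c \<le> \<mu>" using \<mu>_ge by linarith
    then show ?thesis using q \<mu>0 by (simp add: powr_minus field_simps)
  qed
  moreover have "?err / \<mu>\<^sup>2 \<le> ?q powr (10 * (real r)\<^sup>2 - real c)"
  proof -
    have rr: "real r \<le> (real r)\<^sup>2" using t by (simp add: power2_eq_square)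
    let ?e = "2 * (real ?t * (real c + 1) - real ?t * \<rho>)"
    have \<mu>2: "?q powr ?e \<le> \<mu>\<^sup>2"
    proof -
      have "?q powr ?e = (?q powr (real ?t * (real c + 1) - real ?t * \<rho>))\<^sup>2"
        unfolding power2_eq_square mult_2 by (rule powr_add)
      also have "\<dots> \<le> \<mu>\<^sup>2" using \<mu>_ge by (intro power_mono) auto
      finally show ?thesis .
    qed
    have f: "?f u \<le> ?q powr (8 * (real r)\<^sup>2 - real c) * \<mu>\<^sup>2" if "u \<in> ?U" for u
    proof -
      have u: "u \<le> 2 * ?t - 1" "u \<le> r + c" "u < 2 * ?t" using that by auto
      then have u': "real u \<le> 2 * real ?t - 1" by linarith
      \<comment> \<open>Because \<open>\<rho> \<le> c\<close>, the exponent
        \<open>u c - \<rho> (u + 1)\<close> is largest at the top value \<open>u = 2 t - 1\<close>.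
        There it is \<open>c\<close> below \<open>2 t c - 2 t \<rho>\<close>, which is at most the
        exponent of the squared mean.\<close>
      have "(real u - (2 * real ?t - 1)) * (real c - \<rho>) \<le> 0"
        using u' \<rho>c by (intro mult_nonpos_nonneg) auto
      then have i1: "real u * real c - \<rho> * (real u + 1)
          \<le> 2 * real ?t * real c - real c - 2 * real ?t * \<rho>"
        by (simp add: algebra_simps)
      have ut: "real u \<le> 2 * real r" using u' t by linarith
      have i2: "real u * (real r + 1 + 2 * real ?t - real u) \<le> (2 * real r) * (real r + real r + 2 * real r)"
      proof -
        have "real u * (real r + 1 + 2 * real ?t - real u) \<le> real u * (real r + real r + 2 * real r)"
          using t by (intro mult_left_mono) auto
        also have "\<dots> \<le> (2 * real r) * (real r + real r + 2 * real r)"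
          using ut by (intro mult_right_mono) auto
        finally show ?thesis .
      qed
      have "real (u * (?N - u) + u + u * ?t * 2) - \<rho> * (real u + 1)
        = real u * (real r + 1 + 2 * real ?t - real u) + (real u * real c - \<rho> * (real u + 1))"
        unfolding of_nat_mult of_nat_add of_nat_diff[OF u(2)] by (simp add: algebra_simps)
      also have "\<dots> \<le> 8 * (real r)\<^sup>2 + (2 * real ?t * real c - real c - 2 * real ?t * \<rho>)"
        using i1 i2 by (simp add: power2_eq_square)
      also have "\<dots> \<le> (8 * (real r)\<^sup>2 - real c) + ?e" using t by (simp add: algebra_simps)
      finally have "?f u \<le> ?q powr ((8 * (real r)\<^sup>2 - real c) + ?e)" using q by (intro powr_mono) auto
      also have "\<dots> = ?q powr (8 * (real r)\<^sup>2 - real c) * ?q powr ?e" by (rule powr_add)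
      also have "\<dots> \<le> ?q powr (8 * (real r)\<^sup>2 - real c) * \<mu>\<^sup>2" using \<mu>2 by (intro mult_left_mono) auto
      finally show ?thesis .
    qed
    have "?err \<le> real (card ?U) * (?q powr (8 * (real r)\<^sup>2 - real c) * \<mu>\<^sup>2)" using f by (rule sum_bounded_above)
    also have "\<dots> \<le> ?q powr (2 * (real r)\<^sup>2) * (?q powr (8 * (real r)\<^sup>2 - real c) * \<mu>\<^sup>2)"
    proof (rule mult_right_mono)
      have "card ?U \<le> card {..<?t * 2}" by (rule card_mono) auto
      then have "real (card ?U) \<le> real (?t * 2)" by (simp only: card_lessThan of_nat_le_iff)
      also have "real (?t * 2) \<le> 2 * real r" using t(1) unfolding of_nat_mult by simp
      also have "\<dots> \<le> 2 * (real r)\<^sup>2" by (rule mult_left_mono[OF rr]) simp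
      also have "\<dots> \<le> ?q powr (2 * (real r)\<^sup>2)" using q by (intro le_powr_self) auto
      finally show "real (card ?U) \<le> ?q powr (2 * (real r)\<^sup>2)" .
    qed simp
    also have "\<dots> = ?q powr (10 * (real r)\<^sup>2 - real c) * \<mu>\<^sup>2"
      by (simp add: mult.assoc[symmetric] powr_add[symmetric])
    finally show ?thesis using \<mu>0 by (simp add: field_simps)
  qed
  moreover have "measure_pmf.prob ?M {\<Theta>. null_count k ?N ?t \<Theta> = 0} \<le> 2 * (?err / \<mu>\<^sup>2) + 1 / \<mu>"
  proof -
    have "measure_pmf.prob ?M {\<Theta>. null_count k ?N ?t \<Theta> = 0} \<le> (2 * ?err + \<mu>) / \<mu>\<^sup>2"
      using P \<mu>0 by (simp add: field_simps)
    also have "\<dots> = 2 * (?err / \<mu>\<^sup>2) + 1 / \<mu>" using \<mu>0 by (simp add: add_divide_distrib power2_eq_square)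
    finally show ?thesis .
  qed
  ultimately show ?thesis by linarith
qed

section \<open>Limits\<close>

text \<open>Pulling the leading power out of each factor of the Gaussian binomial leaves a quotient
  of products: the denominator is the inverse of \<open>C_const\<close>, the numerator a correction
  that will tend to 1.\<close>

lemma card_grassmannian_resonance:
  "real (card (grassmannian (r + c) r :: (nat \<Rightarrow> 'a::{field,finite}) set set)) / real CARD('a) ^ (r * c)
    = (\<Prod>i<r. 1 - 1 / real CARD('a) ^ (r + c - i)) * C_const CARD('a) (enat r)"
proof -
  let ?q = "real CARD('a)" and ?g = "card (grassmannian (r + c) r :: (nat \<Rightarrow> 'a) set set)"
  have q: "?q > 1" using card_field_ge_2[where 'a='a] by simp
  have qle: "?q ^ i \<le> ?q ^ j" if "i \<le> j" for i j using q that by (intro power_increasing) auto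
  have real_prod: "real (\<Prod>i<r. CARD('a) ^ n - CARD('a) ^ i) = (\<Prod>i<r. ?q ^ n * (1 - 1 / ?q ^ (n - i)))" if "r \<le> n" for n
    unfolding of_nat_prod
  proof (rule prod.cong[OF refl])
    fix i assume "i \<in> {..<r}"
    then have i: "i \<le> n" using that by simp
    then have "CARD('a) ^ i \<le> CARD('a) ^ n" using q by (intro power_increasing) auto
    then have "real (CARD('a) ^ n - CARD('a) ^ i) = ?q ^ n - ?q ^ i" by (simp add: of_nat_diff)
    also have "?q ^ n = ?q ^ (n - i) * ?q ^ i" using i by (simp flip: power_add)
    then have "?q ^ n - ?q ^ i = ?q ^ n * (1 - 1 / ?q ^ (n - i))" using q by (simp add: field_simps)
    finally show "real (CARD('a) ^ n - CARD('a) ^ i) = ?q ^ n * (1 - 1 / ?q ^ (n - i))" .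
  qed
  have pos: "1 - 1 / ?q ^ (r - i) > 0" if "i < r" for i
  proof -
    have "?q ^ (r - i) > 1" using q that by (intro one_less_power) auto
    then show ?thesis by simp
  qed
  define D where "D = (\<Prod>i<r. 1 - 1 / ?q ^ (r - i))"
  define A where "A = (\<Prod>i<r. 1 - 1 / ?q ^ (r + c - i))"
  have "real ?g * (?q ^ (r * r) * D) = ?q ^ ((r + c) * r) * A"
    using arg_cong[OF card_grassmannian[of "r + c" r, where 'a='a], of real]
    unfolding of_nat_mult[of "card _"] real_prod[OF order_refl] real_prod[OF le_add1[of r c]]
    by (simp add: prod.distrib power_mult A_def D_def)
  moreover have "?q ^ ((r + c) * r) = ?q ^ (r * r) * ?q ^ (r * c)"
    by (simp add: algebra_simps flip: power_add)
  ultimately have "?q ^ (r * r) * (real ?g * D) = ?q ^ (r * r) * (?q ^ (r * c) * A)" by (simp add: mult_ac)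
  then have "real ?g * D = ?q ^ (r * c) * A" using q by simp
  moreover have "D > 0" unfolding D_def by (rule prod_pos) (use pos in auto)
  ultimately have "real ?g / ?q ^ (r * c) = A * inverse D" using q by (simp add: divide_simps mult_ac)
  also have "inverse D = C_const CARD('a) (enat r)"
  proof -
    have "C_const CARD('a) (enat r) = (\<Prod>i<r. inverse (1 - 1 / ?q ^ (r - i)))"
      by (simp, rule prod.reindex_bij_witness[of _ "\<lambda>i. r - i" "\<lambda>j. r - j"]) auto
    then show ?thesis by (simp only: D_def prod_inversef[symmetric] o_def)
  qed
  finally show ?thesis unfolding A_def .
qed

text \<open>Factor \<open>c - K r^2\<close> as \<open>r^2 (c / r^2 - K)\<close>. Since
  \<open>r \<ge> 1\<close>, it eventually dominates \<open>c / r^2 - K\<close>, whether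
  \<open>r\<close> stays bounded or not.\<close>

lemma powr_minus_square_tendsto_0:
  fixes q K :: real and r c :: "nat \<Rightarrow> nat"
  assumes q: "1 < q" and r: "\<And>n. 1 \<le> r n"
    and c: "filterlim (\<lambda>n. real (c n) / (real (r n))\<^sup>2) at_top sequentially"
  shows "(\<lambda>n. q powr (K * (real (r n))\<^sup>2 - real (c n))) \<longlonglongrightarrow> 0"
proof -
  have "filterlim (\<lambda>n. - K + real (c n) / (real (r n))\<^sup>2) at_top sequentially"
    by (rule filterlim_tendsto_add_at_top[OF tendsto_const c])
  moreover have "\<forall>\<^sub>F n in sequentially. - K + real (c n) / (real (r n))\<^sup>2 \<le> real (c n) - K * (real (r n))\<^sup>2"
  proof -
    have "\<forall>\<^sub>F n in sequentially. K \<le> real (c n) / (real (r n))\<^sup>2"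
      using c by (simp add: filterlim_at_top)
    then show ?thesis
    proof eventually_elim
      case (elim n)
      have r2: "1 \<le> (real (r n))\<^sup>2" using r[of n] by simp
      then have "1 * (real (c n) / (real (r n))\<^sup>2 - K) \<le> (real (r n))\<^sup>2 * (real (c n) / (real (r n))\<^sup>2 - K)"
        using elim by (intro mult_right_mono) auto
      also have "\<dots> = real (c n) - K * (real (r n))\<^sup>2" using r[of n] by (simp add: field_simps)
      finally show ?case by simp
    qed
  qed
  ultimately have "filterlim (\<lambda>n. real (c n) - K * (real (r n))\<^sup>2) at_top sequentially"
    by (rule filterlim_at_top_mono)
  then have "filterlim (\<lambda>n. - (real (c n) - K * (real (r n))\<^sup>2)) at_bot sequentially"
    by (simp add: filterlim_uminus_at_top)
  then have "filterlim (\<lambda>n. ln q * (K * (real (r n))\<^sup>2 - real (c n))) at_bot sequentially"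
    using q by (intro filterlim_tendsto_pos_mult_at_bot[OF tendsto_const]) auto
  then have "(\<lambda>n. exp (ln q * (K * (real (r n))\<^sup>2 - real (c n)))) \<longlonglongrightarrow> 0"
    by (rule filterlim_compose[OF exp_at_bot])
  then show ?thesis using q by (simp add: powr_def mult.commute)
qed

section \<open>Limits of the Poisson parameter\<close>

lemma C_const_ge_1:
  assumes "2 \<le> q"
  shows "1 \<le> C_const q (enat l)"
proof -
  have "1 \<le> inverse (1 - 1 / real q ^ j)" if "j \<in> {1..l}" for j
  proof -
    have "real q ^ j > 1" using assms that by (intro one_less_power) auto
    then have "1 / real q ^ j < 1" by (subst divide_less_eq_1_pos) (use assms in auto)
    then have "0 < 1 - 1 / real q ^ j" "1 - 1 / real q ^ j \<le> 1" by simp_all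
    then show ?thesis by (rule one_le_inverse)
  qed
  then show ?thesis unfolding C_const.simps by (rule prod_ge_1)
qed

text \<open>Summability of the geometric series makes the product of the factors converge
  absolutely, so the inverse factors have a convergent product. The infinite product starts at 0,
  hence the shift by \<open>Suc\<close>.\<close>

lemma C_const_tendsto_infinity:
  assumes q: "2 \<le> q"
  shows "(\<lambda>l. C_const q (enat l)) \<longlonglongrightarrow> C_const q \<infinity>"
proof -
  let ?f = "\<lambda>j. 1 - 1 / real q ^ Suc j"
  have "summable (\<lambda>j. (1 / real q) * (1 / real q) ^ j)"
    using q by (intro summable_mult summable_geometric) auto
  then have "summable (\<lambda>j. norm (?f j - 1))" by (simp add: power_one_over)
  then have "convergent_prod ?f"
    by (intro abs_convergent_prod_imp_convergent_prod) (simp add: abs_convergent_prod_conv_summable)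
  then have "convergent_prod (\<lambda>j. inverse (?f j))" by (rule convergent_prod_inverse)
  then have "(\<lambda>l. \<Prod>j\<le>l. inverse (?f j)) \<longlonglongrightarrow> C_const q \<infinity>"
    unfolding C_const.simps by (rule convergent_prod_LIMSEQ)
  moreover have "(\<Prod>j\<le>l. inverse (?f j)) = C_const q (enat (Suc l))" for l
    by (simp del: prod.cl_ivl_Suc power_Suc, rule prod.reindex_bij_witness[of _ "\<lambda>j. j - 1" Suc]) auto
  ultimately have "(\<lambda>l. C_const q (enat (Suc l))) \<longlonglongrightarrow> C_const q \<infinity>" by simp
  then show ?thesis by (rule LIMSEQ_imp_Suc)
qed

text \<open>Finite points of \<open>enat\<close> are isolated: a finite limit makes \<open>r\<close>
  eventually constant, while an infinite one means that \<open>r\<close> grows without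
  bound.\<close>

lemma C_const_tendsto:
  assumes "2 \<le> q" "(\<lambda>n. enat (r n)) \<longlonglongrightarrow> l"
  shows "(\<lambda>n. C_const q (enat (r n))) \<longlonglongrightarrow> C_const q l"
proof (cases l)
  case (enat j)
  have "\<forall>\<^sub>F n in sequentially. enat (r n) \<in> {enat j}"
    using assms(2) unfolding enat by (rule topological_tendstoD) (simp_all add: open_enat)
  then have "\<forall>\<^sub>F n in sequentially. C_const q (enat (r n)) = C_const q l"
    by eventually_elim (simp add: enat)
  then show ?thesis by (rule tendsto_eventually)
next
  case infinity
  have "filterlim r at_top sequentially"
    unfolding filterlim_at_top
  proof
    fix Z
    have "\<forall>\<^sub>F n in sequentially. enat Z < enat (r n)"
      using assms(2) unfolding infinity by (rule order_tendstoD) simp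
    then show "\<forall>\<^sub>F n in sequentially. Z \<le> r n" by eventually_elim simp
  qed
  then show ?thesis unfolding infinity
    by (rule filterlim_compose[OF C_const_tendsto_infinity[OF assms(1)]])
qed

text \<open>The binomial is a falling factorial over \<open>fact s\<close>. After division by the
  power, each of its \<open>s\<close> factors differs from \<open>g / p\<close> by
  \<open>i / p\<close>, which vanishes.\<close>

lemma choose_div_power_tendsto:
  fixes g p :: "nat \<Rightarrow> nat"
  assumes "(\<lambda>n. real (g n) / real (p n)) \<longlonglongrightarrow> \<mu>" "(\<lambda>n. 1 / real (p n)) \<longlonglongrightarrow> 0"
  shows "(\<lambda>n. real (g n choose s) / real (p n) ^ s) \<longlonglongrightarrow> \<mu> ^ s / fact s"
proof -
  have "real (g n choose s) / real (p n) ^ s = (\<Prod>i=0..<s. real (g n) / real (p n) - real i * (1 / real (p n))) / fact s" for n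
  proof -
    have "real (g n choose s) = (\<Prod>i=0..<s. real (g n) - real i) / fact s"
      by (simp add: binomial_gbinomial gbinomial_prod_rev)
    then have "real (g n choose s) / real (p n) ^ s = (\<Prod>i=0..<s. real (g n) - real i) / real (p n) ^ s / fact s"
      by simp
    also have "(\<Prod>i=0..<s. real (g n) - real i) / real (p n) ^ s = (\<Prod>i=0..<s. (real (g n) - real i) / real (p n))"
      by (simp add: prod_dividef)
    finally show ?thesis by (simp add: diff_divide_distrib)
  qed
  moreover have "(\<lambda>n. (\<Prod>i=0..<s. real (g n) / real (p n) - real i * (1 / real (p n))) / fact s)
     \<longlonglongrightarrow> (\<Prod>i=0..<s. \<mu> - real i * 0) / fact s"
    by (intro tendsto_intros assms) simp
  ultimately show ?thesis by simp
qed

theorem theorem5p1: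
  fixes q :: nat and k r m c N :: "nat \<Rightarrow> nat" and rstar :: enat
    and \<Theta> :: "nat \<Rightarrow> ((nat set \<Rightarrow> 'a::{field,finite}) \<Rightarrow> nat \<Rightarrow> 'a) pmf"
  assumes q: "q = CARD('a)"
    and k: "\<And>n. 2 \<le> k n" and kr: "\<And>n. k n \<le> r n" and m: "\<And>n. 1 \<le> m n"
    and c: "\<And>n. real (c n) = real (m n) / real (r n) * real (r n choose k n)"
    and N: "\<And>n. N n = r n + c n"
    and c_large: "filterlim (\<lambda>n. real (c n) / (real (r n))\<^sup>2) at_top sequentially"
    and rstar: "2 \<le> rstar" "(\<lambda>n. enat (r n)) \<longlonglongrightarrow> rstar"
    and \<Theta>: "\<And>n. \<Theta> n = random_hom (k n) (N n) (m n)"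
  shows "converges_to_Poisson (\<lambda>n. map_pmf (null_count (k n) (N n) (r n)) (\<Theta> n))
           (C_const q rstar)
    \<and> (\<lambda>n. measure_pmf.prob (\<Theta> n) {\<theta>. max_null_dim (k n) (N n) \<theta> = r n})
        \<longlonglongrightarrow> 1 - exp (- C_const q rstar)
    \<and> (\<lambda>n. measure_pmf.prob (\<Theta> n) {\<theta>. max_null_dim (k n) (N n) \<theta> = r n - 1})
        \<longlonglongrightarrow> exp (- C_const q rstar)"
proof -
  let ?\<mu> = "C_const q rstar"
  have q2: "2 \<le> q" unfolding q by (rule card_field_ge_2)
  have q1: "1 < real q" "2 \<le> real q" using q2 by simp_all
  have r2: "2 \<le> r n" for n using k[of n] kr[of n] by simp
  then have r1: "1 \<le> r n" for n by (meson le_trans one_le_numeral)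
  have res: "r n * c n = m n * (r n choose k n)" for n
  proof -
    have "real (r n * c n) = real (m n * (r n choose k n))" using c[of n] r1[of n] by simp
    then show ?thesis by (simp only: of_nat_eq_iff)
  qed
  note small = powr_minus_square_tendsto_0[OF q1(1) r1 c_large]
  have q_c: "(\<lambda>n. real q powr (- real (c n))) \<longlonglongrightarrow> 0" using small[of 0] by simp
  define g where "g n = card (grassmannian (N n) (r n) :: (nat \<Rightarrow> 'a) set set)" for n
  define p where "p n = q ^ (r n * c n)" for n
  have \<mu>_lim: "(\<lambda>n. real (g n) / real (p n)) \<longlonglongrightarrow> ?\<mu>"
  proof -
    let ?A = "\<lambda>n. \<Prod>i<r n. 1 - 1 / real q ^ (r n + c n - i)"
    have A: "1 - real q powr (1 * (real (r n))\<^sup>2 - real (c n)) \<le> ?A n" "?A n \<le> 1" for n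
    proof -
      have fac: "1 - 1 / real q ^ c n \<le> 1 - 1 / real q ^ (r n + c n - i) \<and> 1 - 1 / real q ^ (r n + c n - i) \<le> 1"
        if "i < r n" for i
      proof -
        have "real q ^ c n \<le> real q ^ (r n + c n - i)" using q1 that by (intro power_increasing) auto
        then show ?thesis using q1 by (simp add: frac_le)
      qed
      have c0: "0 \<le> 1 - 1 / real q ^ c n" using q1 by simp
      show "?A n \<le> 1" using fac c0 by (intro prod_le_1) force
      \<comment> \<open>Bernoulli's inequality bounds the product below by
        \<open>1 - r q^(-c)\<close>. The factor \<open>r\<close> is at most q^(r^2), and the
        coefficient 1 matches the form of \<open>small\<close>.\<close>
      have "1 - real q powr (1 * (real (r n))\<^sup>2 - real (c n)) \<le> 1 + real (r n) * (- (1 / real q ^ c n))"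
      proof -
        have "real (r n) \<le> (real (r n))\<^sup>2" using r1[of n] by (simp add: power2_eq_square)
        also have "\<dots> \<le> real q powr ((real (r n))\<^sup>2)" using q1 by (intro le_powr_self) auto
        finally have "real (r n) * real q powr (- real (c n)) \<le> real q powr ((real (r n))\<^sup>2) * real q powr (- real (c n))"
          by (rule mult_right_mono) simp
        then show ?thesis using q1 by (simp add: powr_minus powr_realpow powr_diff divide_inverse)
      qed
      also have "\<dots> \<le> (1 + - (1 / real q ^ c n)) ^ r n"
        using c0 by (intro Bernoulli_inequality) simp
      also have "\<dots> = (\<Prod>i<r n. 1 - 1 / real q ^ c n)" by simp
      also have "\<dots> \<le> ?A n" using fac c0 by (intro prod_mono) auto
      finally show "1 - real q powr (1 * (real (r n))\<^sup>2 - real (c n)) \<le> ?A n" .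
    qed
    have "?A \<longlonglongrightarrow> 1"
    proof (rule tendsto_sandwich)
      show "(\<lambda>n. 1 - real q powr (1 * (real (r n))\<^sup>2 - real (c n))) \<longlonglongrightarrow> 1"
        using tendsto_diff[OF tendsto_const small[of 1], of 1] by simp
    qed (use A in auto)
    then have "(\<lambda>n. ?A n * C_const q (enat (r n))) \<longlonglongrightarrow> 1 * ?\<mu>"
      by (intro tendsto_mult C_const_tendsto q2 rstar(2))
    moreover have "real (g n) / real (p n) = ?A n * C_const q (enat (r n))" for n
      unfolding g_def p_def N q of_nat_power by (rule card_grassmannian_resonance)
    ultimately show ?thesis by simp
  qed
  have \<mu>_ge: "1 \<le> ?\<mu>"
    by (rule LIMSEQ_le_const[OF C_const_tendsto[OF q2 rstar(2)]]) (use C_const_ge_1[OF q2] in blast)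
  have p_lim: "(\<lambda>n. 1 / real (p n)) \<longlonglongrightarrow> 0"
  proof (rule tendsto_sandwich[OF _ _ tendsto_const q_c])
    have "1 / real (p n) \<le> real q powr (- real (c n))" for n
    proof -
      have "c n \<le> r n * c n" using r1[of n] by simp
      then have "real q ^ c n \<le> real (p n)" using q1 unfolding p_def of_nat_power by (intro power_increasing) auto
      then have "1 / real (p n) \<le> 1 / real q ^ c n" using q1 by (intro frac_le) auto
      then show ?thesis using q1 by (simp add: powr_minus powr_realpow divide_inverse)
    qed
    then show "\<forall>\<^sub>F n in sequentially. 1 / real (p n) \<le> real q powr (- real (c n))" by simp
  qed simp
  let ?X = "\<lambda>n. null_count (k n) (N n) (r n) :: ((nat set \<Rightarrow> 'a) \<Rightarrow> nat \<Rightarrow> 'a) \<Rightarrow> nat"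
  let ?P = "\<lambda>n. map_pmf (?X n) (\<Theta> n)"
  have mom: "(\<lambda>n. measure_pmf.expectation (?P n) (\<lambda>x. real (x choose s))) \<longlonglongrightarrow> ?\<mu> ^ s / fact s" for s
  proof -
    let ?E = "\<lambda>n. measure_pmf.expectation (?P n) (\<lambda>x. real (x choose s))"
    let ?G = "\<lambda>n. real (g n choose s) / real (p n) ^ s"
    have "\<bar>?E n - ?G n\<bar> \<le> real q powr (real (3 * s + s * s) * (real (r n))\<^sup>2 - real (c n))" for n
      using factorial_moment_resonance[OF k kr res, of n s, where 'a='a]
      by (simp add: \<Theta> N g_def p_def q power_mult)
    then have "(\<lambda>n. ?E n - ?G n) \<longlonglongrightarrow> 0"
      by (intro Lim_null_comparison[OF _ small[of "real (3 * s + s * s)"]]) simp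
    from tendsto_add[OF this choose_div_power_tendsto[OF \<mu>_lim p_lim, of s]]
    show ?thesis by simp
  qed
  have pmf_lim: "(\<lambda>n. pmf (?P n) j) \<longlonglongrightarrow> pmf (poisson_pmf ?\<mu>) j" for j
  proof (rule pmf_tendsto_poisson[OF _ _ mom])
    show "finite (set_pmf (?P n))" for n
      by (simp add: \<Theta> set_random_hom Hom_ext_nonempty(1))
    show "0 < ?\<mu>" using \<mu>_ge by simp
  qed
  define T where "T t n = measure_pmf.prob (\<Theta> n) {\<theta>. 1 \<le> null_count (k n) (N n) (t n) \<theta>}" for t :: "nat \<Rightarrow> nat" and n
  have zero: "measure_pmf.prob (\<Theta> n) {\<theta>. null_count (k n) (N n) t \<theta> = 0}
      = 1 - measure_pmf.prob (\<Theta> n) {\<theta>. 1 \<le> null_count (k n) (N n) t \<theta>}" for n t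
  proof -
    have "{\<theta>. null_count (k n) (N n) t \<theta> = 0}
        = space (measure_pmf (\<Theta> n)) - {\<theta>. 1 \<le> null_count (k n) (N n) t \<theta>}"
      by auto
    then show ?thesis by (simp only: measure_pmf.prob_compl sets_measure_pmf UNIV_I)
  qed
  have T_r: "T r \<longlonglongrightarrow> 1 - exp (- ?\<mu>)"
  proof -
    have "T r = (\<lambda>n. 1 - pmf (?P n) 0)"
    proof
      fix n
      have "pmf (?P n) 0 = measure_pmf.prob (\<Theta> n) {\<theta>. null_count (k n) (N n) (r n) \<theta> = 0}"
        by (simp add: pmf_map vimage_def)
      then show "T r n = 1 - pmf (?P n) 0" unfolding zero T_def by simp
    qed
    moreover have "(\<lambda>n. 1 - pmf (?P n) 0) \<longlonglongrightarrow> 1 - exp (- ?\<mu>)"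
      using tendsto_diff[OF tendsto_const pmf_lim[of 0], of 1] \<mu>_ge by simp
    ultimately show ?thesis by simp
  qed
  have T_above: "T (\<lambda>n. r n + 1) \<longlonglongrightarrow> 0"
  proof (rule tendsto_sandwich[OF _ _ tendsto_const q_c])
    \<comment> \<open>Provides \<open>1 \<le> c n\<close> for \<open>prob_null_above\<close>, so
      that the ambient space has dimension at least \<open>r n + 1\<close>.\<close>
    have "\<forall>\<^sub>F n in sequentially. 1 \<le> real (c n) / (real (r n))\<^sup>2"
      using c_large by (simp add: filterlim_at_top)
    then show "\<forall>\<^sub>F n in sequentially. T (\<lambda>n. r n + 1) n \<le> real q powr (- real (c n))"
    proof eventually_elim
      case (elim n)
      then have "1 \<le> c n" by (cases "c n") auto
      from prob_null_above[OF k kr res this, where 'a='a]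
      show ?case by (simp add: T_def \<Theta> N q)
    qed
  qed (simp add: T_def)
  have T_below: "T (\<lambda>n. r n - 1) \<longlonglongrightarrow> 1"
  proof (rule tendsto_sandwich[OF _ _ _ tendsto_const])
    show "(\<lambda>n. 1 - (2 * real q powr (10 * (real (r n))\<^sup>2 - real (c n)) + real q powr (- real (c n)))) \<longlonglongrightarrow> 1"
      using tendsto_diff[OF tendsto_const tendsto_add[OF tendsto_mult[OF tendsto_const small[of 10]] q_c], of 1 2]
      by simp
    have "1 - (2 * real q powr (10 * (real (r n))\<^sup>2 - real (c n)) + real q powr (- real (c n))) \<le> T (\<lambda>n. r n - 1) n" for n
      using prob_null_below[OF k kr res, of n, where 'a='a] zero[of n "r n - 1"]
      by (simp add: T_def \<Theta> N q)
    then show "\<forall>\<^sub>F n in sequentially.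
        1 - (2 * real q powr (10 * (real (r n))\<^sup>2 - real (c n)) + real q powr (- real (c n))) \<le> T (\<lambda>n. r n - 1) n"
      by simp
  qed (simp add: T_def)
  \<comment> \<open>The event that the maximal dimension is at least \<open>t\<close> is the event
    that a null \<open>t\<close>-space exists. These events decrease in \<open>t\<close>, so the
    probability of equality is a difference of two consecutive ones.\<close>
  have prob_eq: "measure_pmf.prob (\<Theta> n) {\<theta>. max_null_dim (k n) (N n) \<theta> = t n} = T t n - T (\<lambda>n. t n + 1) n" for t n
  proof -
    have ge: "t \<le> max_null_dim (k n) (N n) \<theta> \<longleftrightarrow> 1 \<le> null_count (k n) (N n) t \<theta>" if "\<theta> \<in> set_pmf (\<Theta> n)" for \<theta> t
      using max_null_dim_ge_iff[of \<theta> "k n" "N n" "m n" t] that k[of n] by (simp add: \<Theta> set_random_hom)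
    have T: "T t n = measure_pmf.prob (\<Theta> n) {\<theta>. t n \<le> max_null_dim (k n) (N n) \<theta>}" for t :: "nat \<Rightarrow> nat"
      unfolding T_def
      by (rule measure_pmf.finite_measure_eq_AE) (auto simp: AE_measure_pmf_iff ge)
    let ?A = "\<lambda>t. {\<theta> :: (nat set \<Rightarrow> 'a) \<Rightarrow> nat \<Rightarrow> 'a. t \<le> max_null_dim (k n) (N n) \<theta>}"
    have "{\<theta>. max_null_dim (k n) (N n) \<theta> = t n} = ?A (t n) - ?A (t n + 1)" by auto
    moreover have "measure_pmf.prob (\<Theta> n) (?A (t n) - ?A (t n + 1))
      = measure_pmf.prob (\<Theta> n) (?A (t n)) - measure_pmf.prob (\<Theta> n) (?A (t n + 1))"
      by (rule measure_pmf.finite_measure_Diff) auto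
    ultimately show ?thesis unfolding T by simp
  qed
  have "converges_to_Poisson ?P ?\<mu>" by (rule converges_to_Poisson_if_pmf[OF pmf_lim])
  moreover have "(\<lambda>n. measure_pmf.prob (\<Theta> n) {\<theta>. max_null_dim (k n) (N n) \<theta> = r n}) \<longlonglongrightarrow> 1 - exp (- ?\<mu>)"
    unfolding prob_eq using tendsto_diff[OF T_r T_above] by simp
  moreover have "(\<lambda>n. measure_pmf.prob (\<Theta> n) {\<theta>. max_null_dim (k n) (N n) \<theta> = r n - 1}) \<longlonglongrightarrow> exp (- ?\<mu>)"
  proof -
    have "(\<lambda>n. T (\<lambda>n. r n - 1) n - T r n) \<longlonglongrightarrow> 1 - (1 - exp (- ?\<mu>))"
      by (rule tendsto_diff[OF T_below T_r])
    moreover have "measure_pmf.prob (\<Theta> n) {\<theta>. max_null_dim (k n) (N n) \<theta> = r n - 1}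
      = T (\<lambda>n. r n - 1) n - T r n" for n
    proof -
      \<comment> \<open>Subtraction on natural numbers is truncated, so this uses
        \<open>1 \<le> r n\<close>.\<close>
      have "(\<lambda>n. r n - 1 + 1) = r" by (rule ext) (rule le_add_diff_inverse2[OF r1])
      then show ?thesis using prob_eq[of n "\<lambda>n. r n - 1"] by (simp only:)
    qed
    ultimately show ?thesis by simp
  qed
  ultimately show ?thesis by blast
qed

end
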